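(* Let $\delta\in(0,1]$ and $\lambda>0$ be constants with $\lambda>\frac{1}{(\sqrt{2\delta}+\sqrt{1-\delta})^2}$. Let $H^*$ be a uniformly random single cycle on $\delta n$ vertices planted in an Erdős–Rényi graph, $G=G_0\cup H^*$ (see context). Then there exists a constant $\epsilon>0$ depending only on $\lambda$ and $\delta$ such that for any estimator $\hat H$, $$\mathbb{P}\left(\ell(H^*,\hat H)\ge\epsilon/2\right)\ge 1-n^{-\Omega(\log n)},$$ and consequently $\mathbb{E}[\ell(H^*,\hat H)]\ge\epsilon/4$ for all sufficiently large $n$.
   Context: Single planted cycle model: generate an Erdős–Rényi graph $G_0\sim\mathcal{G}(n,\lambda/n)$ on vertex set $[n]$; independently choose a uniformly random set $V\subseteq[n]$ of $\lfloor\delta n\rfloor$ vertices (written $\delta n$), and then a uniformly random Hamiltonian cycle $H^*$ on $V$ (a single cycle visiting every vertex of $V$ exactly once). Observe the simple graph $G=G_0\cup H^*$. Graphs are identified with edge sets. An estimator $\hat H=\hat H(G)$ is a (possibly randomized) function of $G$ that outputs a set of edges of the complete graph $K_n$; its reconstruction error is $\ell(H^*,\hat H)=|H^*\Delta\hat H|/|H^*|$, with $\Delta$ the symmetric difference. Asymptotic notation is as $n\to\infty$. *)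

theory Defs
  imports "HOL-Probability.Probability" "HOL-Probability.Product_PMF" "HOL-Library.Ramsey"
begin

text \<open>Simple graphs are identified with their edge sets, an edge being a two-element vertex set.\<close>

type_synonym graph = "nat set set"

abbreviation complete_edges :: "nat \<Rightarrow> graph" where
  "complete_edges n \<equiv> [{1..n}]\<^bsup>2\<^esup>"

definition erdos_renyi :: "nat \<Rightarrow> real \<Rightarrow> graph pmf" where
  "erdos_renyi n p =
     map_pmf (\<lambda>f. {e \<in> complete_edges n. f e})
       (Pi_pmf (complete_edges n) False (\<lambda>_. bernoulli_pmf p))"

definition cycle_edges :: "nat list \<Rightarrow> graph" where
  "cycle_edges xs = {{xs ! i, xs ! (Suc i mod length xs)} | i. i < length xs}"

text \<open>A Hamiltonian cycle is an undirected, unrooted cycle: the image below identifies the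
  listings of \<open>V\<close> that differ by rotation or reflection.\<close>

definition hamiltonian_cycles :: "nat set \<Rightarrow> graph set" where
  "hamiltonian_cycles V = cycle_edges ` {xs. distinct xs \<and> set xs = V \<and> length xs \<ge> 3}"

text \<open>The joint law of the planted cycle and the observed graph. It is meaningful once
  \<open>\<lfloor>\<delta> n\<rfloor> \<ge> 3\<close> (so that a cycle on \<open>V\<close> exists) and \<open>lam \<le> n\<close> (as \<open>bernoulli_pmf\<close> truncates its
  argument to \<open>[0, 1]\<close>), hence for all sufficiently large \<open>n\<close>.\<close>

definition planted_cycle :: "nat \<Rightarrow> real \<Rightarrow> real \<Rightarrow> (graph \<times> graph) pmf" where
  "planted_cycle n \<delta> lam = do {
     G0 \<leftarrow> erdos_renyi n (lam / real n);
     V \<leftarrow> pmf_of_set ([{1..n}]\<^bsup>nat \<lfloor>\<delta> * real n\<rfloor>\<^esup>);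
     H \<leftarrow> pmf_of_set (hamiltonian_cycles V);
     return_pmf (H, G0 \<union> H)
   }"

text \<open>A randomized estimator is a Markov kernel from observed graphs to edge sets; as there are
  only finitely many possible outputs, its law given \<open>G\<close> is a \<open>pmf\<close>. A deterministic estimator
  is one of the form \<open>\<lambda>G. return_pmf (h G)\<close>.\<close>

definition estimator :: "nat \<Rightarrow> (graph \<Rightarrow> graph pmf) \<Rightarrow> bool" where
  "estimator n est \<longleftrightarrow>
     (\<forall>G \<subseteq> complete_edges n. set_pmf (est G) \<subseteq> Pow (complete_edges n))"

definition estimation :: "nat \<Rightarrow> real \<Rightarrow> real \<Rightarrow> (graph \<Rightarrow> graph pmf) \<Rightarrow> (graph \<times> graph) pmf" where
  "estimation n \<delta> lam est = do {
     (H, G) \<leftarrow> planted_cycle n \<delta> lam;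
     K \<leftarrow> est G;
     return_pmf (H, K)
   }"

definition recon_error :: "graph \<Rightarrow> graph \<Rightarrow> real" where
  "recon_error H K = real (card (sym_diff H K)) / real (card H)"

end

(* Given G, the planted cycle is uniform among the m-cycles contained in G, m = floor (\<delta> n).
  Compare cycles with the larger family F of near-factors: graphs with m edges in which all but
  boundedly many vertices have degree 0 or 2. Bounding the number of graphs with a given degree
  sequence, F is only polynomially larger than the set of m-cycles, so an estimator succeeds with
  probability at most

    poly n * (number of subgraphs of G close to a given one) / (number of members of F in G)

  and it suffices that G has e^(a n) members of F. It does not matter that these are not cycles.
  Removing each noise edge with a small probability destroys a member of F that has t n noise edges
  with probability 1 - e^(-a n); hence it is enough that one such member survives the thinning,
  with probability exponentially close to 1. This member is obtained by exchanging the cycle and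
  the noise edges along a single long alternating path.

  The path is found by depth-first search. A noise edge out of the current endpoint leads either
  to a vertex outside the cycle, or to a cycle vertex, from where i \<ge> 1 consecutive cycle edges are
  removed in one of the two directions. With b the surplus of noise edges, a node of type b thus
  has lam (1 - \<delta>) expected children of type b + 1 and 2 lam \<delta> of each type b, b - 1, ...; keeping
  only the types 0..B makes the exchange balanced. The condition on lam is exactly that
  lam ((1 - \<delta>) / x + 2 \<delta> / (1 - x)) > 1 for all x in (0, 1), and at the minimizing x the weights
  x^(-b) (b + 1) (B + 1 - b) grow under the branching operator, so that an exponential
  supermartingale shows that the search stack becomes linearly long.
*)

theory Submission
  imports Defs "HOL-Combinatorics.Multiset_Permutations" "HOL-Real_Asymp.Real_Asymp"
begin

subsection \<open>Random subsets\<close>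

text \<open>The comparison rests on a symmetry: planting any fixed set of \<open>m\<close> edges
  into the random graph produces a given \<open>G\<close> containing it with a probability that
  depends on \<open>card G\<close> only. Summed over all \<open>G\<close>, these weights contribute
  at most 1 for each member of \<open>F\<close>, although no member of \<open>F\<close> was ever
  planted. This permits near-factors in place of cycles and avoids the task of closing the
  alternating path to one cycle of the prescribed length. The price is entropy. The gain is a fixed
  exponential rate, so \<open>F\<close> may outnumber the \<open>m\<close>-cycles of the complete
  graph by a polynomial factor only; therefore the surplus has to stay bounded. Under the
  restriction to \<open>0..B\<close> the weights \<open>x^(-b)\<close> alone need not grow at the
  two ends of the range; the concave factor \<open>(b + 1) (B + 1 - b)\<close> pays for the
  truncation, with a relative loss that vanishes as \<open>B\<close> grows. Depth-first order
  matters because it ties the length of the stack to the length of the current path.\<close>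

definition random_subset :: "'a set \<Rightarrow> real \<Rightarrow> 'a set pmf" where
  "random_subset A p = map_pmf (\<lambda>f. {e \<in> A. f e}) (Pi_pmf A False (\<lambda>_. bernoulli_pmf p))"

lemma random_subset_empty [simp]: "random_subset {} p = return_pmf {}"
  by (simp add: random_subset_def)

text \<open>Revealing the single element \<open>e\<close> first. The inductions over the ground set,
  and later the edge-by-edge conditioning of the search, come from this recursion.\<close>

lemma random_subset_insert:
  assumes "finite A" "e \<notin> A"
  shows "random_subset (insert e A) p =
    bernoulli_pmf p \<bind> (\<lambda>b. map_pmf (\<lambda>S. if b then insert e S else S) (random_subset A p))"
proof -
  have eq: "{x \<in> insert e A. (f(e := y)) x} = (if y then insert e {x \<in> A. f x} else {x \<in> A. f x})"
    for f and y
    using assms(2) by auto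
  have "random_subset (insert e A) p =
    bernoulli_pmf p \<bind> (\<lambda>b. Pi_pmf A False (\<lambda>_. bernoulli_pmf p) \<bind>
      (\<lambda>f. return_pmf {x \<in> insert e A. (f(e := b)) x}))"
    unfolding random_subset_def by (simp add: Pi_pmf_insert'[OF assms] map_bind_pmf)
  also have "\<dots> = bernoulli_pmf p \<bind> (\<lambda>b. Pi_pmf A False (\<lambda>_. bernoulli_pmf p) \<bind>
      (\<lambda>f. return_pmf (if b then insert e {x \<in> A. f x} else {x \<in> A. f x})))"
    by (simp only: eq)
  also have "\<dots> = bernoulli_pmf p \<bind> (\<lambda>b. map_pmf (\<lambda>S. if b then insert e S else S) (random_subset A p))"
    unfolding random_subset_def by (simp add: map_pmf_def bind_assoc_pmf bind_return_pmf)
  finally show ?thesis .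
qed

lemma set_random_subset: "finite A \<Longrightarrow> set_pmf (random_subset A p) \<subseteq> Pow A"
  unfolding random_subset_def by auto

lemma expectation_bernoulli_bind:
  fixes f :: "'a \<Rightarrow> real"
  assumes "0 \<le> p" "p \<le> 1" and fin: "\<And>b. finite (set_pmf (g b))"
  shows "measure_pmf.expectation (bernoulli_pmf p \<bind> g) f =
    p * measure_pmf.expectation (g True) f + (1 - p) * measure_pmf.expectation (g False) f"
proof -
  have "measure_pmf.expectation (bernoulli_pmf p \<bind> g) f =
    (\<Sum>a\<in>UNIV. pmf (bernoulli_pmf p) a *\<^sub>R measure_pmf.expectation (g a) f)"
    by (rule pmf_expectation_bind) (auto simp: fin)
  then show ?thesis
    using assms by (simp add: UNIV_bool)
qed

lemma finite_set_random_subset [simp]: "finite A \<Longrightarrow> finite (set_pmf (random_subset A p))"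
  using set_random_subset finite_subset by blast

lemma expectation_random_subset_insert:
  fixes f :: "'a set \<Rightarrow> real"
  assumes "0 \<le> p" "p \<le> 1" "finite A" "e \<notin> A"
  shows "measure_pmf.expectation (random_subset (insert e A) p) f =
    p * measure_pmf.expectation (random_subset A p) (\<lambda>S. f (insert e S)) +
    (1 - p) * measure_pmf.expectation (random_subset A p) f"
  unfolding random_subset_insert[OF assms(3,4)]
  using assms by (subst expectation_bernoulli_bind) auto

lemma prob_random_subset_insert:
  assumes "0 \<le> p" "p \<le> 1" "finite A" "e \<notin> A"
  shows "measure_pmf.prob (random_subset (insert e A) p) {S. P S} =
    p * measure_pmf.prob (random_subset A p) {S. P (insert e S)} +
    (1 - p) * measure_pmf.prob (random_subset A p) {S. P S}"
proof -
  have "measure_pmf.prob M {S. Q S} = measure_pmf.expectation M (\<lambda>S. indicator {S. Q S} S :: real)"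
    for M :: "'a set pmf" and Q
    by simp
  note this[of "random_subset (insert e A) p"]
  also have "measure_pmf.expectation (random_subset (insert e A) p) (\<lambda>S. indicator {S. P S} S :: real) =
     p * measure_pmf.expectation (random_subset A p) (\<lambda>S. indicator {S. P S} (insert e S)) +
    (1 - p) * measure_pmf.expectation (random_subset A p) (\<lambda>S. indicator {S. P S} S)"
    by (rule expectation_random_subset_insert[OF assms])
  also have "(\<lambda>S. indicator {S. P S} (insert e S) :: real) = indicator {S. P (insert e S)}"
    by (auto simp: indicator_def)
  finally show ?thesis by simp
qed

lemma prob_random_subset_superset:
  assumes "0 \<le> p" "p \<le> 1" "finite A" "T \<subseteq> A"
  shows "measure_pmf.prob (random_subset A p) {S. T \<subseteq> S} = p ^ card T"
  using assms(3,4)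
proof (induction A arbitrary: T rule: finite_induct)
  case empty
  then show ?case by simp
next
  case (insert e A)
  have finT: "finite T" using insert finite_subset by blast
  show ?case
  proof (cases "e \<in> T")
    case True
    have 1: "{S. T \<subseteq> insert e S} = {S. T - {e} \<subseteq> S}" by auto
    have "measure_pmf.prob (random_subset A p) {S. T \<subseteq> S} = 0"
      using set_random_subset[OF insert(1), of p] insert(2) True
      by (intro measure_pmf.prob_eq_0[THEN iffD2]) (auto simp: AE_measure_pmf_iff)
    moreover have "measure_pmf.prob (random_subset A p) {S. T \<subseteq> insert e S} = p ^ card (T - {e})"
      unfolding 1 using insert by (intro insert.IH) auto
    moreover have "card T = Suc (card (T - {e}))"
      using True finT by (metis card_Suc_Diff1)
    ultimately show ?thesis
      using assms insert by (simp add: prob_random_subset_insert)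
  next
    case False
    then have 1: "{S. T \<subseteq> insert e S} = {S. T \<subseteq> S}" and "T \<subseteq> A" using insert(4) by auto
    then show ?thesis
      using assms insert by (simp add: prob_random_subset_insert algebra_simps)
  qed
qed

text \<open>A \<open>p\<close>-coin followed by a \<open>q\<close>-coin is a
  \<open>p * q\<close>-coin, independently for each element. Read backwards, the sparser random
  graph is a thinning of the denser one.\<close>

lemma random_subset_compose:
  assumes "0 \<le> p" "p \<le> 1" "0 \<le> q" "q \<le> 1" "finite A"
  shows "random_subset A p \<bind> (\<lambda>S. random_subset S q) = random_subset A (p * q)"
  using assms(5)
proof (induction A rule: finite_induct)
  case empty
  then show ?case by (simp add: bind_return_pmf)
next
  case (insert e A)
  have *: "e \<notin> S \<and> finite S" if "S \<in> set_pmf (random_subset A p)" for S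
    using set_random_subset[OF insert(1), of p] that insert finite_subset by blast
  have b: "bernoulli_pmf p \<bind> (\<lambda>b. if b then bernoulli_pmf q else return_pmf False) = bernoulli_pmf (p * q)"
  proof (rule pmf_eqI)
    fix i
    have "p * q \<le> 1" using assms by (simp add: mult_le_one)
    then show "pmf (bernoulli_pmf p \<bind> (\<lambda>b. if b then bernoulli_pmf q else return_pmf False)) i = pmf (bernoulli_pmf (p * q)) i"
      using assms by (cases i) (auto simp: pmf_bind algebra_simps)
  qed
  have "random_subset (insert e A) p \<bind> (\<lambda>S. random_subset S q) =
    bernoulli_pmf p \<bind> (\<lambda>b. random_subset A p \<bind> (\<lambda>S. random_subset (if b then insert e S else S) q))"
    by (simp add: random_subset_insert[OF insert(1,2)] bind_assoc_pmf bind_map_pmf)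
  also have "\<dots> = bernoulli_pmf p \<bind> (\<lambda>b. random_subset A p \<bind> (\<lambda>S.
     (if b then bernoulli_pmf q else return_pmf False) \<bind> (\<lambda>c. map_pmf (\<lambda>S. if c then insert e S else S) (random_subset S q))))"
    using * by (intro bind_pmf_cong refl) (auto simp: random_subset_insert bind_return_pmf)
  also have "\<dots> = bernoulli_pmf p \<bind> (\<lambda>b. (if b then bernoulli_pmf q else return_pmf False) \<bind> (\<lambda>c. random_subset A p \<bind> (\<lambda>S.
      map_pmf (\<lambda>S. if c then insert e S else S) (random_subset S q))))"
    by (subst bind_commute_pmf) simp
  also have "\<dots> = bernoulli_pmf (p * q) \<bind> (\<lambda>c. map_pmf (\<lambda>S. if c then insert e S else S) (random_subset A p \<bind> (\<lambda>S. random_subset S q)))"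
    by (simp flip: b add: bind_assoc_pmf map_bind_pmf)
  also have "\<dots> = random_subset (insert e A) (p * q)"
    by (simp add: insert random_subset_insert)
  finally show ?case .
qed

text \<open>The value depends on \<open>H\<close> only through \<open>card H\<close>: all sets of
  the same size inside \<open>G\<close> are equally likely to have been planted. This is the
  uniformity of the posterior.\<close>

lemma pmf_union_random_subset:
  assumes "0 \<le> p" "p \<le> 1" "finite A" "H \<subseteq> G" "G \<subseteq> A"
  shows "pmf (map_pmf (\<lambda>S. S \<union> H) (random_subset A p)) G = p ^ (card G - card H) * (1 - p) ^ (card A - card G)"
proof -
  have fin: "finite G" "finite H"
    using finite_subset[OF assms(5,3)] finite_subset[OF assms(4)] by auto
  have "pmf (map_pmf (\<lambda>S. S \<union> H) (random_subset A p)) G =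
    measure_pmf.prob (Pi_pmf A False (\<lambda>_. bernoulli_pmf p)) ((\<lambda>f. {e \<in> A. f e} \<union> H) -` {G})"
    unfolding random_subset_def by (simp add: pmf_map pmf.map_comp o_def)
  \<comment> \<open>Elements of \<open>H\<close> are free, those of \<open>G - H\<close> must be
    chosen, those outside \<open>G\<close> must not: the event is a product over
    \<open>A\<close>.\<close>
  also have "\<dots> = measure_pmf.prob (Pi_pmf A False (\<lambda>_. bernoulli_pmf p))
     (Pi A (\<lambda>e. if e \<in> H then UNIV else if e \<in> G then {True} else {False}))"
    using assms(4,5) by (intro arg_cong2[where f = measure] refl) (auto simp: Pi_def split: if_splits)
  also have "\<dots> = (\<Prod>e\<in>A. if e \<in> H then 1 else if e \<in> G then p else 1 - p)"
    using assms by (subst measure_Pi_pmf_Pi) (auto intro!: prod.cong simp: measure_pmf_single)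
  also have "\<dots> = (\<Prod>e\<in>H \<union> (G - H) \<union> (A - G). if e \<in> H then 1 else if e \<in> G then p else 1 - p)"
    using assms by (intro prod.cong) auto
  also have "\<dots> = (\<Prod>e\<in>H. if e \<in> H then 1 else if e \<in> G then p else 1 - p) *
      (\<Prod>e\<in>G - H. if e \<in> H then 1 else if e \<in> G then p else 1 - p) *
      (\<Prod>e\<in>A - G. if e \<in> H then 1 else if e \<in> G then p else 1 - p)"
    using assms fin
    by (subst prod.union_disjoint prod.union_disjoint[of H], (auto simp del: prod.If_cases)[3])+ (rule refl)
  also have "\<dots> = p ^ card (G - H) * (1 - p) ^ card (A - G)"
  proof -
    have "(\<Prod>e\<in>H. if e \<in> H then 1 else if e \<in> G then p else 1 - p) = 1"
      by (simp)
    moreover have "(\<Prod>e\<in>G - H. if e \<in> H then 1 else if e \<in> G then p else 1 - p) = (\<Prod>e\<in>G - H. p)"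
      by (intro prod.cong) auto
    moreover have "(\<Prod>e\<in>A - G. if e \<in> H then 1 else if e \<in> G then p else 1 - p) = (\<Prod>e\<in>A - G. 1 - p)"
      using assms(4) by (intro prod.cong) auto
    ultimately show ?thesis by simp
  qed
  finally show ?thesis
    using assms fin by (simp add: card_Diff_subset)
qed

lemma expectation_power_card_random_subset:
  fixes x :: real
  assumes "0 \<le> p" "p \<le> 1" "finite A"
  shows "measure_pmf.expectation (random_subset A p) (\<lambda>S. x ^ card S) = (1 - p + p * x) ^ card A"
  using assms(3)
proof (induction A rule: finite_induct)
  case empty
  then show ?case by simp
next
  case (insert e A)
  have "measure_pmf.expectation (random_subset A p) (\<lambda>S. x ^ card (insert e S)) =
    measure_pmf.expectation (random_subset A p) (\<lambda>S. x * x ^ card S)"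
  proof (intro integral_cong_AE)
    have "x ^ card (insert e S) = x * x ^ card S" if "S \<in> set_pmf (random_subset A p)" for S
    proof -
      have "S \<subseteq> A" using set_random_subset[OF insert(1), of p] that by blast
      then have "e \<notin> S" "finite S" using insert(1,2) finite_subset by auto
      then show ?thesis by simp
    qed
    then show "AE S in random_subset A p. x ^ card (insert e S) = x * x ^ card S"
      by (simp add: AE_measure_pmf_iff)
  qed auto
  then show ?case
    using insert assms by (simp add: expectation_random_subset_insert algebra_simps)
qed

subsection \<open>A positive weight growing under the branching operator\<close>

text \<open>With \<open>a = sqrt (1 - \<delta>)\<close> and \<open>c = sqrt (2 * \<delta>)\<close>,
  the minimum of \<open>a\<^sup>2 / x + c\<^sup>2 / (1 - x)\<close> over (0, 1) is
  \<open>(a + c)\<^sup>2\<close>, attained at \<open>x = a / (a + c)\<close>. Since the derivative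
  vanishes there, the first-order effect of the polynomial factor \<open>\<phi>\<close> cancels
  between the step up and the steps down, and only a constant \<open>C0\<close> from its second
  differences is lost.\<close>

lemma weight_exists:
  fixes \<delta> lam :: real
  assumes "0 < \<delta>" and "\<delta> \<le> 1" and "0 < lam"
    and super: "lam * (sqrt (2 * \<delta>) + sqrt (1 - \<delta>))\<^sup>2 > 1"
  shows "\<exists>(B::nat) w \<eta>. 0 < \<eta> \<and> (\<forall>b\<le>B. 0 < w b) \<and> w (Suc B) = 0 \<and>
    (\<forall>b\<le>B. (1 + \<eta>) * w b \<le> lam * (1 - \<delta>) * w (Suc b) + 2 * lam * \<delta> * (\<Sum>j\<le>b. w j))"
proof (cases "\<delta> = 1")
  \<comment> \<open>Without vertices off the cycle the minimizing \<open>x\<close> degenerates to 0.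
    A single type suffices: every noise edge leads to a cycle vertex and continues in two
    directions.\<close>
  case True
  then have "2 * lam > 1" using super by simp
  then show ?thesis
    using True by (intro exI[of _ 0] exI[of _ "\<lambda>b. if b = 0 then 1 else 0"] exI[of _ "2 * lam - 1"]) auto
next
  case False
  define a where "a = sqrt (1 - \<delta>)"
  define c where "c = sqrt (2 * \<delta>)"
  have a: "a > 0" "a\<^sup>2 = 1 - \<delta>" using False assms by (auto simp: a_def)
  have c: "c > 0" "c\<^sup>2 = 2 * \<delta>" using assms by (auto simp: c_def)
  define x where "x = a / (a + c)"
  have x: "0 < x" "x < 1" using a c by (auto simp: x_def)
  have x1: "1 - x = c / (a + c)" using a c by (simp add: x_def field_simps)
  define \<Lambda> where "\<Lambda> = lam * (a + c)\<^sup>2"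
  have L: "\<Lambda> > 1" using super by (simp add: \<Lambda>_def a_def c_def add.commute)
  define C0 where "C0 = lam * (a\<^sup>2 / x + c\<^sup>2 * (x * (1 + x) / (1 - x) ^ 3))"
  have C0: "C0 > 0" using assms(3) a(1) c(1) x unfolding C0_def
    by (intro mult_pos_pos add_pos_pos divide_pos_pos zero_less_power) auto
  define \<eta> where "\<eta> = (\<Lambda> - 1) / 2"
  \<comment> \<open>\<open>\<phi>\<close> is at least \<open>B + 1\<close> on all types, so for
    large \<open>B\<close> half of the excess \<open>\<Lambda> - 1 = 2 * \<eta>\<close> absorbs the
    loss \<open>C0\<close>.\<close>
  obtain B :: nat where B: "real B + 1 \<ge> C0 / \<eta>" "B \<ge> 1"
  proof -
    obtain B' :: nat where "real B' \<ge> C0 / \<eta>" using real_arch_simple by blast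
    then show ?thesis by (intro that[of "Suc B'"]) auto
  qed
  \<comment> \<open>This value makes \<open>\<phi>\<close> vanish just outside the type range on
    both sides: below type 0 and at type \<open>B + 1\<close>.\<close>
  define D where "D = real B + 2"
  define \<phi> where "\<phi> = (\<lambda>t::real. t * (D - t))"
  \<comment> \<open>The closed form of the infinite series of \<open>x ^ i * \<phi> (t - i)\<close>
    over \<open>i \<ge> 0\<close>. It bounds the finite sum of weights from below, because
    \<open>\<phi>\<close> is at most 0 at the arguments of the tail.\<close>
  define T where "T = (\<lambda>t. \<phi> t / (1 - x) - (D - 2 * t) * (x / (1 - x)\<^sup>2) - x * (1 + x) / (1 - x) ^ 3)"
  have Trec: "T (t + 1) = \<phi> (t + 1) + x * T t" for t
  proof -
    define y where "y = 1 - x"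
    have y: "y \<noteq> 0" "x = 1 - y" using x by (auto simp: y_def)
    have T: "T s = (\<phi> s * y ^ 2 - (D - 2 * s) * (x * y) - x * (1 + x)) / y ^ 3" for s
      unfolding T_def y_def[symmetric] using y(1)
      by (simp add: diff_divide_distrib power2_eq_square power3_eq_cube)
    have "T (t + 1) = (\<phi> (t + 1) * y ^ 3 + x * (\<phi> t * y ^ 2 - (D - 2 * t) * (x * y) - x * (1 + x))) / y ^ 3"
      unfolding T \<phi>_def y(2) by (simp add: algebra_simps power2_eq_square power3_eq_cube)
    then show ?thesis using y(1) unfolding T by (simp add: add_divide_distrib)
  qed
  define w where "w = (\<lambda>b::nat. (1 / x) ^ b * \<phi> (real b + 1))"
  have S: "(\<Sum>j\<le>b. w j) \<ge> (1 / x) ^ b * T (real b + 1)" for b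
  proof (induction b)
    case 0
    have "0 \<le> D * (x / (1 - x)\<^sup>2)" "0 \<le> x * (1 + x) / (1 - x) ^ 3"
      using x by (auto simp: D_def)
    then have "T 0 \<le> 0" by (simp add: T_def \<phi>_def)
    then have "x * T 0 \<le> 0" using x by (simp add: mult_nonneg_nonpos)
    then show ?case using Trec[of 0] by (simp add: w_def)
  next
    case (Suc b)
    have "(1 / x) ^ Suc b * T (real (Suc b) + 1) = (1 / x) ^ Suc b * \<phi> (real (Suc b) + 1) + (1 / x) ^ b * T (real b + 1)"
      using Trec[of "real b + 1"] x by (simp add: algebra_simps)
    then show ?case using Suc by (simp add: w_def)
  qed
  have key: "(1 + \<eta>) * w b \<le> lam * (1 - \<delta>) * w (Suc b) + 2 * lam * \<delta> * (\<Sum>j\<le>b. w j)" if "b \<le> B" for b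
  proof -
    define t where "t = real b + 1"
    have t: "1 \<le> t" "t \<le> real B + 1" using that by (auto simp: t_def)
    have phi: "\<phi> t \<ge> real B + 1"
    proof -
      have "(t - 1) * (D - 1 - t) \<ge> 0" using t by (auto simp: D_def)
      then show ?thesis by (simp add: \<phi>_def D_def algebra_simps)
    qed
    have xp: "(1 / x) ^ b > 0" using x by simp
    have "(1 / x) ^ b * (lam * (a\<^sup>2 * (\<phi> (t + 1) / x)) + lam * (c\<^sup>2 * T t)) \<le>
       lam * (1 - \<delta>) * w (Suc b) + 2 * lam * \<delta> * (\<Sum>j\<le>b. w j)"
    proof -
      have "lam * (1 - \<delta>) * w (Suc b) = (1 / x) ^ b * (lam * (a\<^sup>2 * (\<phi> (t + 1) / x)))"
        by (simp add: w_def a t_def algebra_simps)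
      moreover have "(1 / x) ^ b * (lam * (c\<^sup>2 * T t)) \<le> 2 * lam * \<delta> * (\<Sum>j\<le>b. w j)"
        using mult_left_mono[OF S[of b], of "2 * lam * \<delta>"] assms by (simp add: c t_def algebra_simps)
      ultimately show ?thesis by (simp add: distrib_left)
    qed
    moreover have "lam * (a\<^sup>2 * (\<phi> (t + 1) / x)) + lam * (c\<^sup>2 * T t) = \<Lambda> * \<phi> t - C0"
    proof -
      \<comment> \<open>\<open>e1\<close> and \<open>e3\<close> have the same right-hand side: this
        is the vanishing derivative, and it removes the terms with \<open>D - 2 * t\<close>.\<close>
      have e1: "a\<^sup>2 / x = a * (a + c)" using a(1) c(1) by (simp add: x_def power2_eq_square)
      have e2: "c\<^sup>2 / (1 - x) = c * (a + c)" unfolding x1 using a(1) c(1) by (simp add: power2_eq_square)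
      have e3: "c\<^sup>2 * (x / (1 - x)\<^sup>2) = a * (a + c)" unfolding x1 unfolding x_def using a(1) c(1)
        by (simp add: power2_eq_square)
      have p1: "\<phi> (t + 1) = \<phi> t + (D - 2 * t) - 1" by (simp add: \<phi>_def algebra_simps)
      have "lam * (a\<^sup>2 * (\<phi> (t + 1) / x)) + lam * (c\<^sup>2 * T t) =
        lam * ((a\<^sup>2 / x) * (\<phi> t + (D - 2 * t) - 1) + (c\<^sup>2 / (1 - x)) * \<phi> t - (D - 2 * t) * (c\<^sup>2 * (x / (1 - x)\<^sup>2))
           - c\<^sup>2 * (x * (1 + x) / (1 - x) ^ 3))"
        unfolding T_def p1 by (simp add: algebra_simps add_divide_distrib diff_divide_distrib)
      also have "\<dots> = \<Lambda> * \<phi> t - C0"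
        unfolding e1 e2 e3 \<Lambda>_def C0_def by (simp add: algebra_simps power2_eq_square)
      finally show ?thesis .
    qed
    moreover have "\<Lambda> * \<phi> t - C0 \<ge> (1 + \<eta>) * \<phi> t"
    proof -
      have "\<eta> > 0" using L by (simp add: \<eta>_def)
      then have "C0 \<le> \<eta> * (real B + 1)" using B(1) by (simp add: field_simps)
      also have "\<dots> \<le> \<eta> * \<phi> t" using phi \<open>\<eta> > 0\<close> by simp
      finally have "C0 \<le> \<eta> * \<phi> t" .
      moreover have "\<Lambda> = 1 + 2 * \<eta>" by (simp add: \<eta>_def field_simps)
      ultimately show ?thesis by (simp add: algebra_simps)
    qed
    ultimately have "(1 / x) ^ b * ((1 + \<eta>) * \<phi> t) \<le> lam * (1 - \<delta>) * w (Suc b) + 2 * lam * \<delta> * (\<Sum>j\<le>b. w j)"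
      using xp by (smt (verit) mult_left_mono)
    then show ?thesis by (simp add: w_def t_def algebra_simps)
  qed
  show ?thesis
  proof (intro exI conjI allI impI)
    show "0 < \<eta>" using L by (simp add: \<eta>_def)
    show "0 < w b" if "b \<le> B" for b
      using that x by (auto simp: w_def \<phi>_def D_def)
    show "w (Suc B) = 0" by (simp add: w_def \<phi>_def D_def)
  qed (rule key)
qed

subsection \<open>Graphs that are almost 2-regular\<close>

definition deg :: "graph \<Rightarrow> nat \<Rightarrow> nat" where
  "deg S x = card {e \<in> S. x \<in> e}"

lemma deg_empty [simp]: "deg {} x = 0"
  by (simp add: deg_def)

lemma deg_union_disjoint:
  assumes "finite S" "finite T" "S \<inter> T = {}"
  shows "deg (S \<union> T) x = deg S x + deg T x"
proof -
  have "{e \<in> S \<union> T. x \<in> e} = {e \<in> S. x \<in> e} \<union> {e \<in> T. x \<in> e}" by auto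
  then show ?thesis
    unfolding deg_def using assms by (simp, subst card_Un_disjoint) auto
qed

lemma deg_insert:
  assumes "finite S" "e \<notin> S"
  shows "deg (insert e S) x = deg S x + (if x \<in> e then 1 else 0)"
proof -
  have "{ea. ea = e \<and> x \<in> ea} = (if x \<in> e then {e} else {})" by auto
  then show ?thesis using deg_union_disjoint[of S "{e}" x] assms by (simp add: deg_def)
qed

lemma deg_mono: "finite T \<Longrightarrow> S \<subseteq> T \<Longrightarrow> deg S x \<le> deg T x"
  unfolding deg_def by (intro card_mono) auto

lemma deg_eq_0: "x \<notin> \<Union>S \<Longrightarrow> deg S x = 0"
  unfolding deg_def by (auto simp: card_eq_0_iff)

lemma deg_Diff:
  assumes "finite S" "T \<subseteq> S"
  shows "deg (S - T) x + deg T x = deg S x"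
proof -
  have "finite T" "(S - T) \<inter> T = {}" "S - T \<union> T = S" using assms finite_subset by auto
  then show ?thesis using deg_union_disjoint[of "S - T" T x] assms by simp
qed

lemma deg_union_le: "finite S \<Longrightarrow> finite T \<Longrightarrow> deg (S \<union> T) x \<le> deg S x + deg T x"
  unfolding deg_def by (rule order_trans[OF card_mono card_Un_le[of "{e \<in> S. x \<in> e}" "{e \<in> T. x \<in> e}"]]) auto

text \<open>The members have as many edges as the planted cycle, so they carry the same posterior
  weight. The bound 4 leaves constantly many possible degrees at each of the at most
  \<open>r\<close> exceptional vertices, which keeps the number of degree sequences under
  control.\<close>

definition near_factors :: "nat \<Rightarrow> nat \<Rightarrow> nat \<Rightarrow> graph set" where
  "near_factors n m r = {S. S \<subseteq> complete_edges n \<and> card S = m \<and> (\<forall>x. deg S x \<le> 4) \<and>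
     card {x \<in> {1..n}. deg S x \<noteq> 0 \<and> deg S x \<noteq> 2} \<le> r}"

subsection \<open>Alternating paths along a cycle\<close>

text \<open>Indexing the cycle by all integers, with period exactly \<open>m\<close>, makes both
  directions and the wrap-around a shift of the index. The size condition leaves room for a window
  of radius \<open>B + 2\<close> with distinct vertices.\<close>

locale cyclic_graph =
  fixes v :: "int \<Rightarrow> nat" and m n B :: nat
  assumes m_large: "2 * B + 6 < m"
    and v_eq: "v i = v j \<longleftrightarrow> i mod int m = j mod int m"
    and v_range: "range v \<subseteq> {1..n}"
begin

abbreviation V where "V \<equiv> range v"

definition H :: graph where "H = range (\<lambda>j. {v j, v (j + 1)})"

definition run :: "int \<Rightarrow> int \<Rightarrow> nat \<Rightarrow> graph" where
  "run j s i = (\<lambda>k. {v (j + s * int k), v (j + s * (int k + 1))}) ` {..<i}"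

lemma v_eq_abs:
  assumes "\<bar>i - j\<bar> < int m"
  shows "v i = v j \<longleftrightarrow> i = j"
proof
  assume "v i = v j"
  then have "int m dvd i - j" by (simp add: v_eq mod_eq_dvd_iff)
  then show "i = j" using assms zdvd_not_zless[of "\<bar>i - j\<bar>" "int m"] by (cases "i = j") auto
qed simp

lemma v_shift: "v i = v j \<longleftrightarrow> v (i + k) = v (j + k)"
  by (simp add: v_eq mod_eq_dvd_iff)

lemma run_Suc: "run j s (Suc i) = insert {v (j + s * int i), v (j + s * (int i + 1))} (run j s i)"
  unfolding run_def lessThan_Suc by simp

lemma run_0 [simp]: "run j s 0 = {}" by (simp add: run_def)

lemma finite_run [simp]: "finite (run j s i)" by (simp add: run_def)

lemma edge_notin_run:
  assumes "i < m" "s = 1 \<or> s = -1"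
  shows "{v (j + s * int i), v (j + s * (int i + 1))} \<notin> run j s i"
proof
  assume "{v (j + s * int i), v (j + s * (int i + 1))} \<in> run j s i"
  then obtain k where k: "k < i" "{v (j + s * int i), v (j + s * (int i + 1))} = {v (j + s * int k), v (j + s * (int k + 1))}"
    by (auto simp: run_def)
  from k(2) consider "v (j + s * int i) = v (j + s * int k)" |
    "v (j + s * int i) = v (j + s * (int k + 1))" "v (j + s * (int i + 1)) = v (j + s * int k)"
    by (auto simp: doubleton_eq_iff)
  then show False
  proof cases
    case 1
    then show ?thesis using k(1) assms by (subst (asm) v_eq_abs) auto
  next
    case 2
    have "v (j + s * (int k + 1) + s) = v (j + s * int i + s)"
      using 2(1) v_shift by metis
    also have "j + s * int i + s = j + s * (int i + 1)" by (simp add: algebra_simps)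
    also note 2(2)
    finally show ?thesis using assms m_large by (subst (asm) v_eq_abs) (auto simp: algebra_simps)
  qed
qed

text \<open>Each vertex is counted once as the start and once as the end of an edge, so the inner
  vertices get 2 and the two ends 1. For \<open>i = m\<close> the run closes up and all vertices get
  2, which yields \<open>deg_H\<close>.\<close>

lemma deg_run:
  assumes "i \<le> m" "s = 1 \<or> s = -1"
  shows "deg (run j s i) x = (if x \<in> (\<lambda>k. v (j + s * int k)) ` {..<i} then 1 else 0) +
    (if x \<in> (\<lambda>k. v (j + s * int k)) ` {1..i} then 1 else 0)"
  using assms(1)
proof (induction i)
  case (Suc i)
  have ne1: "v (j + s * int i) \<notin> (\<lambda>k. v (j + s * int k)) ` {..<i}"
    using Suc.prems assms(2) by (auto simp: v_eq_abs)
  have ne2: "v (j + s * int (Suc i)) \<notin> (\<lambda>k. v (j + s * int k)) ` {1..i}"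
    using Suc.prems assms(2) by (auto simp: v_eq_abs)
  have ne3: "v (j + s * int i) \<noteq> v (j + s * int (Suc i))"
    using m_large assms(2) by (auto simp: v_eq_abs)
  have "deg (run j s (Suc i)) x = deg (run j s i) x + (if x \<in> {v (j + s * int i), v (j + s * int (Suc i))} then 1 else 0)"
    unfolding run_Suc using edge_notin_run[of i s j] Suc.prems assms(2)
    by (subst deg_insert) (auto simp: algebra_simps)
  then show ?case
    using Suc.IH Suc.prems ne1 ne2 ne3 by (auto simp: lessThan_Suc atLeastAtMostSuc_conv)
qed simp

lemma card_run: "i \<le> m \<Longrightarrow> s = 1 \<or> s = -1 \<Longrightarrow> card (run j s i) = i"
  by (induction i) (auto simp: run_Suc edge_notin_run)

lemma run_subset_H: "s = 1 \<or> s = -1 \<Longrightarrow> run j s i \<subseteq> H"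
proof
  fix e assume s: "s = 1 \<or> s = -1" and "e \<in> run j s i"
  then obtain k where e: "e = {v (j + s * int k), v (j + s * (int k + 1))}" by (auto simp: run_def)
  show "e \<in> H"
    using s
  proof
    assume "s = -1"
    then have "e = {v (j - (int k + 1)), v (j - (int k + 1) + 1)}" using e by (auto simp: algebra_simps)
    then show ?thesis by (auto simp: H_def)
  next
    assume "s = 1"
    then have "e = {v (j + int k), v (j + int k + 1)}" using e by (simp add: algebra_simps)
    then show ?thesis by (auto simp: H_def)
  qed
qed

lemma H_eq_run: "H = run 0 1 m"
proof
  show "H \<subseteq> run 0 1 m"
  proof
    fix e assume "e \<in> H"
    then obtain j where e: "e = {v j, v (j + 1)}" by (auto simp: H_def)
    define k where "k = nat (j mod int m)"
    have k: "int k = j mod int m" "k < m" using m_large by (auto simp: k_def nat_less_iff)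
    have "v (int k) = v j" by (simp add: k(1) v_eq)
    moreover from this have "v (int k + 1) = v (j + 1)" using v_shift by blast
    ultimately show "e \<in> run 0 1 m"
      using k(2) e unfolding run_def by (intro image_eqI[of _ _ k]) auto
  qed
qed (rule run_subset_H, simp)

lemma finite_H [simp]: "finite H" by (simp add: H_eq_run)

lemma card_H: "card H = m" by (simp add: H_eq_run card_run)

lemma range_v_eq: "v ` (\<lambda>k. int k) ` {..<m} = V" "v ` (\<lambda>k. int k) ` {1..m} = V"
proof -
  have *: "v j \<in> v ` (\<lambda>k. int k) ` {..<m} \<and> v j \<in> v ` (\<lambda>k. int k) ` {1..m}" for j
  proof -
    define k where "k = nat (j mod int m)"
    have k: "int k = j mod int m" "k < m" using m_large by (auto simp: k_def nat_less_iff)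
    have 1: "v (int k) = v j" by (simp add: k(1) v_eq)
    have "\<exists>k'\<in>{1..m}. v (int k') = v (int k)"
    proof (cases "k = 0")
      case True
      then show ?thesis using m_large by (intro bexI[of _ m]) (auto simp: v_eq)
    next
      case False
      then show ?thesis using k(2) by (intro bexI[of _ k]) auto
    qed
    then show ?thesis using 1 k(2) by (force simp: image_iff)
  qed
  show "v ` (\<lambda>k. int k) ` {..<m} = V" using * by blast
  show "v ` (\<lambda>k. int k) ` {1..m} = V" using * by blast
qed

lemma deg_H: "deg H x = (if x \<in> V then 2 else 0)"
  unfolding H_eq_run using range_v_eq by (subst deg_run) (auto simp: image_image)

lemma card_V: "card V = m"
proof -
  have "inj_on v ((\<lambda>k. int k) ` {..<m})" by (auto simp: inj_on_def v_eq_abs)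
  then have "card (v ` (\<lambda>k. int k) ` {..<m}) = card ((\<lambda>k. int k) ` {..<m})" by (rule card_image)
  then show ?thesis by (simp add: range_v_eq card_image)
qed

lemma H_edges: "H \<subseteq> complete_edges n"
proof
  fix e assume "e \<in> H"
  then obtain j where e: "e = {v j, v (j + 1)}" by (auto simp: H_def)
  have "v j \<noteq> v (j + 1)" using m_large by (simp add: v_eq_abs)
  moreover have "v j \<in> {1..n}" "v (j + 1) \<in> {1..n}" using v_range by blast+
  ultimately show "e \<in> complete_edges n" unfolding e nsets_2_eq by blast
qed

text \<open>The vertices reserved around a newly reached cycle vertex. A run removes at most
  \<open>B + 1\<close> edges, so its far end has distance at most \<open>B + 1\<close>, and the
  cycle neighbours of that end have distance at most \<open>B + 2\<close>.\<close>

definition block :: "nat \<Rightarrow> nat set" where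
  "block u = {v (j + k) | j k. v j = u \<and> \<bar>k\<bar> \<le> int B + 2}"

lemma block_v: "block (v j) = (\<lambda>k. v (j + k)) ` {- (int B + 2)..int B + 2}"
proof -
  have "v (i + k) = v (j + k)" if "v i = v j" for i k using that v_shift by blast
  then have "block (v j) = {v (j + k) | k. \<bar>k\<bar> \<le> int B + 2}" unfolding block_def by blast
  also have "\<dots> = (\<lambda>k. v (j + k)) ` {k. \<bar>k\<bar> \<le> int B + 2}" by blast
  also have "{k. \<bar>k\<bar> \<le> int B + 2} = {- (int B + 2)..int B + 2}" by auto
  finally show ?thesis .
qed

lemma in_blockI: "\<bar>k\<bar> \<le> int B + 2 \<Longrightarrow> v (j + k) \<in> block (v j)"
  unfolding block_def by blast

lemma block_sym: "x \<in> block u \<Longrightarrow> u \<in> block x"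
proof -
  assume "x \<in> block u"
  then obtain j k where "x = v (j + k)" "v j = u" "\<bar>k\<bar> \<le> int B + 2" by (auto simp: block_def)
  then show ?thesis using in_blockI[of "- k" "j + k"] by simp
qed

lemma block_subset: "block u \<subseteq> V" by (auto simp: block_def)

lemma finite_block [simp]: "finite (block u)"
  using finite_subset[OF block_subset] finite_subset[OF v_range] by auto

lemma card_block: "card (block u) \<le> 2 * B + 5"
proof (cases "u \<in> V")
  case True
  then obtain j where "u = v j" by blast
  then have "card (block u) \<le> card {- (int B + 2)..int B + 2}"
    by (simp only: block_v) (rule card_image_le, simp)
  then show ?thesis by simp
next
  case False
  then have "block u = {}" by (auto simp: block_def)
  then show ?thesis by simp
qed

lemma H_neighbour: "{v j, x} \<in> H \<Longrightarrow> x = v (j + 1) \<or> x = v (j - 1)"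
proof -
  assume "{v j, x} \<in> H"
  then obtain i where "{v j, x} = {v i, v (i + 1)}" by (auto simp: H_def)
  then consider "v j = v i" "x = v (i + 1)" | "v j = v (i + 1)" "x = v i" by (auto simp: doubleton_eq_iff)
  then show ?thesis
  proof cases
    case 1
    then show ?thesis using v_shift by metis
  next
    case 2
    then have "v (j - 1) = v i" using v_shift[of j "i + 1" "-1"] by simp
    then show ?thesis using 2 by simp
  qed
qed

text \<open>An alternating path from \<open>a\<close> to \<open>y\<close> trades the edges \<open>R\<close> of \<open>H\<close> for the new edges \<open>Bl\<close>;
  \<open>b\<close> records the surplus of new edges, and \<open>X\<close> collects the vertices that may no longer be used.\<close>

definition alternating :: "nat set \<Rightarrow> graph \<Rightarrow> nat \<Rightarrow> nat \<Rightarrow> nat \<Rightarrow> bool" where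
  "alternating X K y b d \<longleftrightarrow> (\<exists>R Bl a. R \<subseteq> H \<and> R \<noteq> {} \<and> finite Bl \<and> Bl \<subseteq> K \<and> Bl \<inter> H = {} \<and>
     \<Union>R \<subseteq> X \<and> \<Union>Bl \<subseteq> X \<and> y \<in> X \<and> a \<in> X \<and> y \<noteq> a \<and> card Bl = d \<and> card R + b = Suc d \<and>
     deg H y + deg Bl y = Suc (deg R y) \<and> deg H a + deg Bl a \<le> deg R a + 2 \<and>
     (\<forall>x. x \<noteq> y \<longrightarrow> x \<noteq> a \<longrightarrow> deg H x + deg Bl x = deg R x \<or> deg H x + deg Bl x = deg R x + 2))"

lemma alternating_mono:
  "alternating X K y b d \<Longrightarrow> X \<subseteq> X' \<Longrightarrow> K \<subseteq> K' \<Longrightarrow> alternating X' K' y b d"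
  unfolding alternating_def by (elim ex_forward) auto

text \<open>The search starts by deleting one cycle edge; this deletion is the \<open>Suc\<close> in
  the balance \<open>card R + b = Suc d\<close>.\<close>

lemma alternating_root:
  assumes "block (v j) \<subseteq> X"
  shows "alternating X K (v (j + 1)) 0 0"
proof -
  have e: "run j 1 1 = {{v j, v (j + 1)}}" using run_Suc[of j 1 0] by simp
  have eH: "{v j, v (j + 1)} \<in> H" by (auto simp: H_def)
  have ne: "v (j + 1) \<noteq> v j" using m_large by (simp add: v_eq_abs)
  have X: "v j \<in> X" "v (j + 1) \<in> X" using assms in_blockI[of 0 j] in_blockI[of 1 j] by auto
  have d: "deg {{v j, v (j + 1)}} x = (if x \<in> {v j, v (j + 1)} then 1 else 0)" for x
    using deg_insert[of "{}" "{v j, v (j + 1)}" x] by simp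
  show ?thesis unfolding alternating_def
    by (rule exI[of _ "{{v j, v (j + 1)}}"], rule exI[of _ "{}"], rule exI[of _ "v j"])
      (use ne X eH in \<open>auto simp: d deg_H\<close>)
qed

text \<open>Off the cycle the new endpoint has degree 0, so the new edge alone gives it degree 1.
  Nothing is deleted, and the surplus grows by 1.\<close>

lemma alternating_outside:
  assumes "alternating X K y b d" "u \<notin> X" "u \<notin> V"
  shows "alternating (insert u X) (insert {y, u} K) u (Suc b) (Suc d)"
proof -
  from assms(1) obtain R Bl a where *: "R \<subseteq> H" "R \<noteq> {}" "finite Bl" "Bl \<subseteq> K" "Bl \<inter> H = {}"
     "\<Union>R \<subseteq> X" "\<Union>Bl \<subseteq> X" "y \<in> X" "a \<in> X" "y \<noteq> a" "card Bl = d" "card R + b = Suc d"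
     "deg H y + deg Bl y = Suc (deg R y)" "deg H a + deg Bl a \<le> deg R a + 2"
     "\<And>x. x \<noteq> y \<Longrightarrow> x \<noteq> a \<Longrightarrow> deg H x + deg Bl x = deg R x \<or> deg H x + deg Bl x = deg R x + 2"
    unfolding alternating_def by blast
  have new: "{y, u} \<notin> Bl" using *(7) assms(2) by auto
  have newH: "{y, u} \<notin> H" using assms(3) by (auto simp: H_def doubleton_eq_iff)
  have u: "u \<noteq> y" "u \<noteq> a" using * assms by auto
  have d0: "deg Bl u = 0" "deg R u = 0" "deg H u = 0"
    using * assms by (auto intro!: deg_eq_0 simp: deg_H)
  have dB: "deg (insert {y, u} Bl) x = deg Bl x + (if x \<in> {y, u} then 1 else 0)" for x
    using deg_insert[OF *(3) new] .
  show ?thesis unfolding alternating_def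
  proof (rule exI[of _ R], rule exI[of _ "insert {y, u} Bl"], rule exI[of _ a], intro conjI allI impI)
    fix x assume x: "x \<noteq> u" "x \<noteq> a"
    show "deg H x + deg (insert {y, u} Bl) x = deg R x \<or> deg H x + deg (insert {y, u} Bl) x = deg R x + 2"
      using *(13) *(15)[of x] x by (cases "x = y") (auto simp: dB)
  next
    show "R \<subseteq> H" "R \<noteq> {}" "finite (insert {y, u} Bl)" "a \<in> insert u X" "u \<noteq> a" "u \<in> insert u X"
      using *(1,2,3,9) u by auto
    show "insert {y, u} Bl \<inter> H = {}" using *(5) newH by simp
    show "insert {y, u} Bl \<subseteq> insert {y, u} K" using *(4) by blast
    show "\<Union>R \<subseteq> insert u X" "\<Union>(insert {y, u} Bl) \<subseteq> insert u X" using *(6,7,8) by auto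
    show "card (insert {y, u} Bl) = Suc d" using *(3,11) new by simp
    show "card R + Suc b = Suc (Suc d)" using *(12) by simp
    show "deg H u + deg (insert {y, u} Bl) u = Suc (deg R u)" using d0 by (simp add: dB)
    show "deg H a + deg (insert {y, u} Bl) a \<le> deg R a + 2" using *(10,14) u by (simp add: dB)
  qed
qed

text \<open>The third edge at \<open>v j\<close> is compensated by deleting a run that starts there:
  the inner vertices of the run drop to degree 0, its far end to degree 1. One edge is gained and
  \<open>Suc i\<close> are lost, so the surplus falls by \<open>i\<close>. The assumption on the
  neighbours of \<open>y\<close> ensures that the new edge is not a cycle edge.\<close>

lemma alternating_inside:
  assumes alt: "alternating X K y b d" and bl: "block (v j) \<inter> X = {}" and b: "b \<le> B" and i: "i \<le> b"
    and s: "s = 1 \<or> s = -1" and nb: "\<And>x. {y, x} \<in> H \<Longrightarrow> x \<in> X"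
  shows "alternating (block (v j) \<union> X) (insert {y, v j} K) (v (j + s * int (Suc i))) (b - i) (Suc d)"
proof -
  from alt obtain R Bl a where *: "R \<subseteq> H" "R \<noteq> {}" "finite Bl" "Bl \<subseteq> K" "Bl \<inter> H = {}"
     "\<Union>R \<subseteq> X" "\<Union>Bl \<subseteq> X" "y \<in> X" "a \<in> X" "y \<noteq> a" "card Bl = d" "card R + b = Suc d"
     "deg H y + deg Bl y = Suc (deg R y)" "deg H a + deg Bl a \<le> deg R a + 2"
     "\<And>x. x \<noteq> y \<Longrightarrow> x \<noteq> a \<Longrightarrow> deg H x + deg Bl x = deg R x \<or> deg H x + deg Bl x = deg R x + 2"
    unfolding alternating_def by blast
  define u where "u = v j"
  define z where "z = v (j + s * int (Suc i))"
  define P where "P = run j s (Suc i)"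
  have im: "Suc i \<le> m" using m_large b i by simp
  have finR: "finite R" using *(1) finite_subset finite_H by blast
  have inb: "v (j + s * int k) \<in> block u" if "k \<le> Suc i" for k
    unfolding u_def using that b i s by (intro in_blockI) (auto simp: abs_mult)
  have u_in: "u \<in> block u" using inb[of 0] by (simp add: u_def)
  have z_in: "z \<in> block u" using inb[of "Suc i"] by (simp add: z_def)
  have uX: "u \<notin> X" using u_in bl by (auto simp: u_def)
  have zu: "z \<noteq> u" unfolding z_def u_def using m_large b i s by (subst v_eq_abs) auto
  have UP: "\<Union>P \<subseteq> block u"
  proof -
    have "v (j + s * int k) \<in> block u \<and> v (j + s * (int k + 1)) \<in> block u" if "k < Suc i" for k
      using inb[of k] inb[of "Suc k"] that by (auto simp: algebra_simps)
    then show ?thesis by (auto simp: P_def run_def)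
  qed
  have PH: "P \<subseteq> H" and finP: "finite P" and cardP: "card P = Suc i"
    using s im by (auto simp: P_def run_subset_H card_run simp del: run_Suc)
  have PR: "P \<inter> R = {}"
  proof (rule ccontr)
    assume "P \<inter> R \<noteq> {}"
    then obtain e where e: "e \<in> P" "e \<in> R" by blast
    have "e \<noteq> {}" using e(1) PH by (auto simp: H_def)
    then show False using e UP *(6) bl by (fastforce simp: u_def)
  qed
  have dP: "deg P x = (if x \<in> (\<lambda>k. v (j + s * int k)) ` {..<Suc i} then 1 else 0) +
    (if x \<in> (\<lambda>k. v (j + s * int k)) ` {1..Suc i} then 1 else 0)" for x
    unfolding P_def by (rule deg_run[OF im s])
  have nez: "z \<notin> (\<lambda>k. v (j + s * int k)) ` {..<Suc i}"
    unfolding z_def using m_large b i s by (auto simp: v_eq_abs)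
  have neu: "u \<notin> (\<lambda>k. v (j + s * int k)) ` {1..Suc i}"
  proof
    assume "u \<in> (\<lambda>k. v (j + s * int k)) ` {1..Suc i}"
    then obtain k where k: "k \<ge> 1" "k \<le> Suc i" "v j = v (j + s * int k)" by (auto simp: u_def)
    then show False using m_large b i s by (subst (asm) v_eq_abs) (auto simp: abs_mult)
  qed
  have z_mem: "z \<in> (\<lambda>k. v (j + s * int k)) ` {1..Suc i}"
    unfolding z_def by (rule image_eqI[of _ _ "Suc i"]) auto
  have u_mem: "u \<in> (\<lambda>k. v (j + s * int k)) ` {..<Suc i}"
    unfolding u_def by (rule image_eqI[of _ _ 0]) auto
  have dPz: "deg P z = 1" and dPu: "deg P u = 1"
    using nez neu z_mem u_mem by (auto simp: dP)
  have mid: "deg P x = 0 \<or> deg P x = 2" if "x \<noteq> z" "x \<noteq> u" for x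
  proof -
    have "x \<in> (\<lambda>k. v (j + s * int k)) ` {..<Suc i} \<longleftrightarrow> x \<in> (\<lambda>k. v (j + s * int k)) ` {1..i}"
    proof -
      have "{..<Suc i} = insert 0 {1..i}" by auto
      then show ?thesis using that by (simp add: u_def)
    qed
    moreover have "x \<in> (\<lambda>k. v (j + s * int k)) ` {1..Suc i} \<longleftrightarrow> x \<in> (\<lambda>k. v (j + s * int k)) ` {1..i}"
    proof -
      have "{1..Suc i} = insert (Suc i) {1..i}" by auto
      then show ?thesis using that by (simp add: z_def del: of_nat_Suc)
    qed
    ultimately show ?thesis unfolding dP by simp
  qed
  have new: "{y, u} \<notin> Bl" using *(7) uX by auto
  have newH: "{y, u} \<notin> H" using nb uX by blast
  have out: "deg P x = 0" if "x \<in> X" for x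
    using that UP bl by (intro deg_eq_0) (auto simp: u_def)
  have inn: "deg R x = 0" "deg Bl x = 0" if "x \<notin> X" for x
    using that *(6,7) by (auto intro!: deg_eq_0)
  have blockV: "deg H x = 2" if "x \<in> block u" for x
    using that block_subset by (auto simp: deg_H)
  have dR: "deg (R \<union> P) x = deg R x + deg P x" for x
    using finR finP PR by (intro deg_union_disjoint) auto
  have dB: "deg (insert {y, u} Bl) x = deg Bl x + (if x \<in> {y, u} then 1 else 0)" for x
    using deg_insert[OF *(3) new] .
  have zX: "z \<notin> X" using z_in bl by (auto simp: u_def)
  show ?thesis unfolding alternating_def u_def[symmetric] z_def[symmetric]
  proof (rule exI[of _ "R \<union> P"], rule exI[of _ "insert {y, u} Bl"], rule exI[of _ a], intro conjI allI impI)
    fix x assume x: "x \<noteq> z" "x \<noteq> a"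
    show "deg H x + deg (insert {y, u} Bl) x = deg (R \<union> P) x \<or>
          deg H x + deg (insert {y, u} Bl) x = deg (R \<union> P) x + 2"
    proof (cases "x \<in> X")
      case True
      then show ?thesis using *(13) *(15)[of x] x uX out[of x]
        by (cases "x = y") (auto simp: dB dR)
    next
      case xX: False
      show ?thesis
      proof (cases "x = u")
        case True
        then show ?thesis using xX inn[of u] *(8) dPu blockV[OF u_in] by (auto simp: dB dR)
      next
        case False
        then have "deg (insert {y, u} Bl) x = 0" "deg R x = 0"
          using xX inn[of x] *(8) by (auto simp: dB)
        moreover have "deg H x = deg P x \<or> deg H x = deg P x + 2"
        proof (cases "deg P x = 0")
          case True
          then show ?thesis by (simp add: deg_H)
        next
          case F: False
          then have "deg P x = 2" using mid[OF x(1) False] by simp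
          moreover have "x \<in> \<Union>P" using F deg_eq_0[of x P] by argo
          then have "x \<in> V" using subset_trans[OF UP block_subset] by (rule rev_subsetD)
          ultimately show ?thesis by (simp add: deg_H)
        qed
        ultimately show ?thesis by (simp add: dR)
      qed
    qed
  next
    show "card (R \<union> P) + (b - i) = Suc (Suc d)"
      using finR finP PR cardP *(12) i by (simp add: card_Un_disjoint Int_commute)
    show "deg H z + deg (insert {y, u} Bl) z = Suc (deg (R \<union> P) z)"
      using zX zu inn[of z] dPz blockV[OF z_in] *(8) by (auto simp: dB dR)
    show "deg H a + deg (insert {y, u} Bl) a \<le> deg (R \<union> P) a + 2"
      using *(9,10,14) uX out[of a] by (auto simp: dB dR)
    show "\<Union> (insert {y, u} Bl) \<subseteq> block u \<union> X" using *(7,8) u_in by auto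
    show "\<Union> (R \<union> P) \<subseteq> block u \<union> X" using *(6) UP by auto
    show "z \<noteq> a" using zX *(9) by auto
    show "R \<union> P \<subseteq> H" using *(1) PH by simp
    show "insert {y, u} Bl \<inter> H = {}" using *(5) newH by simp
    show "insert {y, u} Bl \<subseteq> insert {y, u} K" using *(4) by blast
    show "card (insert {y, u} Bl) = Suc d" using *(3,11) new by simp
  qed (use *(2,3,9) z_in in simp_all)
qed

text \<open>The exchanged graph has \<open>m + b - 1\<close> edges. Putting back one deleted edge if
  \<open>b = 0\<close>, or dropping \<open>b - 1\<close> new ones otherwise, restores
  \<open>m\<close>. This touches at most \<open>2 * (B + 1)\<close> vertices; together with the two
  ends of the path at most \<open>2 * B + 4\<close> have a degree other than 0 or 2.\<close>

lemma alternating_near_factor: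
  assumes alt: "alternating X K y b d" and b: "b \<le> B" and K: "K \<subseteq> complete_edges n"
  shows "\<exists>S\<in>near_factors n m (2 * B + 4). S \<subseteq> K \<union> H \<and> d \<le> card (S - H) + B"
proof -
  from alt obtain R Bl a where *: "R \<subseteq> H" "R \<noteq> {}" "finite Bl" "Bl \<subseteq> K" "Bl \<inter> H = {}"
     "y \<noteq> a" "card Bl = d" "card R + b = Suc d"
     "deg H y + deg Bl y = Suc (deg R y)" "deg H a + deg Bl a \<le> deg R a + 2"
     "\<And>x. x \<noteq> y \<Longrightarrow> x \<noteq> a \<Longrightarrow> deg H x + deg Bl x = deg R x \<or> deg H x + deg Bl x = deg R x + 2"
    unfolding alternating_def by blast
  have finR: "finite R" using *(1) finite_subset finite_H by blast
  have cR: "card R \<ge> 1" using finR *(2) by (simp add: Suc_le_eq card_gt_0_iff)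
  have RH: "card R \<le> m" using *(1) card_mono[OF finite_H] card_H by metis
  define S0 where "S0 = (H - R) \<union> Bl"
  have dS0: "deg S0 x + deg R x = deg H x + deg Bl x" for x
  proof -
    have "deg S0 x = deg (H - R) x + deg Bl x"
      unfolding S0_def using * by (intro deg_union_disjoint) auto
    then show ?thesis using deg_Diff[OF finite_H *(1), of x] by simp
  qed
  have dbl: "deg H x + deg Bl x \<le> 4" for x
  proof -
    have "deg H x + deg Bl x \<le> deg R x + 2"
      using *(9) *(10) *(11)[of x] by (cases "x = y"; cases "x = a") auto
    moreover have "deg R x \<le> deg H x" using *(1) by (intro deg_mono) auto
    moreover have "deg H x \<le> 2" by (simp add: deg_H)
    ultimately show ?thesis by linarith
  qed
  have cS0: "card S0 = m - card R + d"
    unfolding S0_def using * finR card_H by (subst card_Un_disjoint) (auto simp: card_Diff_subset)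
  have "\<exists>S D. S \<subseteq> H \<union> Bl \<and> card S = m \<and> finite D \<and> card D \<le> B + 1 \<and> D \<subseteq> H \<union> Bl \<and> d \<le> card (S - H) + B \<and>
     (\<forall>x. x \<notin> \<Union>D \<longrightarrow> deg S x = deg S0 x)"
  proof (cases "b = 0")
    case True
    obtain e where e: "e \<in> R" using *(2) by blast
    have "finite S0" using * by (simp add: S0_def)
    moreover have "e \<notin> S0" using e * by (auto simp: S0_def)
    moreover have "Bl \<subseteq> insert e S0 - H" using *(5) by (auto simp: S0_def)
    then have "d \<le> card (insert e S0 - H)"
      using \<open>finite S0\<close> *(7) card_mono by (metis finite_Diff finite_insert)
    ultimately show ?thesis
      using cS0 True *(8) cR RH e *(1)
      by (intro exI[of _ "insert e S0"] exI[of _ "{e}"]) (auto simp: deg_insert S0_def)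
  next
    case False
    then have "b - 1 \<le> card Bl" using *(7,8) cR by simp
    then obtain D where D: "D \<subseteq> Bl" "card D = b - 1" "finite D"
      using obtain_subset_with_card_n by blast
    have DS: "D \<subseteq> S0" using D by (auto simp: S0_def)
    have fS: "finite S0" using * by (simp add: S0_def)
    have "Bl - D \<subseteq> S0 - D - H" using *(5) by (auto simp: S0_def)
    then have "card (Bl - D) \<le> card (S0 - D - H)" using fS by (intro card_mono) auto
    then have "d \<le> card (S0 - D - H) + B" using D b *(7) by (simp add: card_Diff_subset)
    moreover have "deg (S0 - D) x = deg S0 x" if "x \<notin> \<Union>D" for x
      using deg_Diff[OF fS DS, of x] deg_eq_0[OF that] by simp
    moreover have "card (S0 - D) = m"
      using cS0 False *(8) cR RH D DS by (simp add: card_Diff_subset)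
    ultimately show ?thesis
      using D b by (intro exI[of _ "S0 - D"] exI[of _ D]) (auto simp: S0_def)
  qed
  then obtain S D where S: "S \<subseteq> H \<union> Bl" "card S = m" "finite D" "card D \<le> B + 1" "D \<subseteq> H \<union> Bl"
     "d \<le> card (S - H) + B" "\<And>x. x \<notin> \<Union>D \<Longrightarrow> deg S x = deg S0 x"
    by blast
  have sub: "H \<union> Bl \<subseteq> complete_edges n" using *(4) K H_edges by blast
  have cD: "card (\<Union>D) \<le> 2 * (B + 1)"
  proof -
    have "card (\<Union>D) \<le> (\<Sum>e\<in>D. card e)" by (rule card_Union_le_sum_card)
    also have "\<dots> = (\<Sum>e\<in>D. 2)" using S(5) sub by (intro sum.cong) (auto simp: nsets_def)
    finally show ?thesis using S(4) by simp
  qed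
  have "card {y, a} \<le> 2" by (simp add: card_insert_if)
  from add_mono[OF cD this] have "card (\<Union>D) + card {y, a} \<le> 2 * B + 4" by simp
  then have c: "card (\<Union>D \<union> {y, a}) \<le> 2 * B + 4"
    by (rule order_trans[OF card_Un_le])
  have "finite (\<Union>D)" using S(3,5) sub by (auto simp: nsets_def)
  moreover have "{x \<in> {1..n}. deg S x \<noteq> 0 \<and> deg S x \<noteq> 2} \<subseteq> \<Union>D \<union> {y, a}"
  proof
    fix x assume x: "x \<in> {x \<in> {1..n}. deg S x \<noteq> 0 \<and> deg S x \<noteq> 2}"
    show "x \<in> \<Union>D \<union> {y, a}"
    proof (rule ccontr)
      assume "x \<notin> \<Union>D \<union> {y, a}"
      then have "x \<notin> \<Union>D" "x \<noteq> y" "x \<noteq> a" by auto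
      then show False using S(7)[of x] *(11)[of x] dS0[of x] x by auto
    qed
  qed
  ultimately have "card {x \<in> {1..n}. deg S x \<noteq> 0 \<and> deg S x \<noteq> 2} \<le> card (\<Union>D \<union> {y, a})"
    by (intro card_mono) auto
  moreover have "deg S x \<le> 4" for x
  proof -
    have "deg S x \<le> deg (H \<union> Bl) x" using S(1) * by (intro deg_mono) auto
    also have "\<dots> \<le> deg H x + deg Bl x" using * by (intro deg_union_le) auto
    finally show ?thesis using dbl[of x] by simp
  qed
  ultimately have "S \<in> near_factors n m (2 * B + 4)"
    using S(1,2) sub c unfolding near_factors_def by auto
  then show ?thesis using S(1,6) *(4) by blast
qed

end

lemma edge_in: "a \<in> {1..n} \<Longrightarrow> u \<in> {1..n} \<Longrightarrow> a \<noteq> u \<Longrightarrow> {a, u} \<in> complete_edges n"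
  by (auto simp: nsets_def)

subsection \<open>Depth-first exploration of alternating paths\<close>

text \<open>A node \<open>(y, b, Q, d)\<close> is an alternating path with endpoint \<open>y\<close>, surplus \<open>b\<close> and \<open>d\<close> new
  edges, whose potential continuations to the vertices in \<open>Q\<close> have been queried. Nodes with a
  surplus outside \<open>{0..B}\<close> are discarded.\<close>

type_synonym node = "nat \<times> nat \<times> nat set \<times> nat"

text \<open>Every push adds at most \<open>C\<close> nodes, each one step deeper than the former
  top. So at most \<open>C * Suc d\<close> entries lie at or below a node with \<open>d\<close> new
  edges, and a long stack forces a long path.\<close>

fun depth_ok :: "nat \<Rightarrow> node list \<Rightarrow> bool" where
  "depth_ok C [] = True"
| "depth_ok C ((y, b, Q, d) # L) = (Suc (length L) \<le> C * Suc d \<and> depth_ok C L)"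

lemma depth_ok_append:
  assumes "depth_ok C L" "\<And>y b Q d. (y, b, Q, d) \<in> set N \<Longrightarrow> d = dep"
    and "length N + length L \<le> C * Suc dep"
  shows "depth_ok C (N @ L)"
  using assms(2,3)
proof (induction N)
  case (Cons \<nu> N)
  obtain y b Q d where nu: "\<nu> = (y, b, Q, d)" by (cases \<nu>) auto
  then have "d = dep" using Cons.prems(1)[of y b Q d] by simp
  moreover have "depth_ok C (N @ L)"
    using Cons.prems by (intro Cons.IH) auto
  ultimately show ?case using Cons.prems(2) nu by simp
qed (use assms(1) in simp)

text \<open>\<open>cr\<close>, later slightly less than \<open>p\<close>, is the credit charged per
  unit of possible gain at each query. \<open>step_out\<close> and \<open>step_in\<close> make one
  query a step of an exponential supermartingale; \<open>gain\<close> says that a node with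
  exhausted queries has been charged at least \<open>\<zeta>\<close> more than its weight;
  \<open>final\<close> compares the drift from \<open>kmax\<close> such nodes with the largest
  potential of a stack that is still shallow.\<close>

locale exploration = cyclic_graph +
  fixes w :: "nat \<Rightarrow> real" and p cr \<theta> \<zeta> c wmax :: real and kmax D smax :: nat
  assumes w_pos: "b \<le> B \<Longrightarrow> 0 < w b" and w_top: "w (Suc B) = 0"
    and w_le: "b \<le> B \<Longrightarrow> w b \<le> wmax"
    and p: "0 \<le> p" "p \<le> 1" and cr: "0 \<le> cr" and th: "0 < \<theta>" and ze: "0 \<le> \<zeta>"
    and step_out: "b \<le> B \<Longrightarrow> 1 - p + p * exp (- \<theta> * w (Suc b)) \<le> exp (- \<theta> * (cr * w (Suc b)))"
    and step_in: "b \<le> B \<Longrightarrow> 1 - p + p * exp (- \<theta> * (2 * (\<Sum>j\<le>b. w j))) \<le> exp (- \<theta> * (cr * (2 * (\<Sum>j\<le>b. w j))))"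
    and gain: "b \<le> B \<Longrightarrow> s \<le> smax \<Longrightarrow> w b + \<zeta> \<le>
      cr * ((real n - real m - real s) * w (Suc b) + (real m - real ((2 * B + 5) * s)) * (2 * (\<Sum>j\<le>b. w j)))"
    and smax: "(2 * B + 5) * (kmax + 2 * (B + 1) * D) \<le> smax"
    and room: "(2 * B + 5) * smax < m"
    and final: "c \<le> \<theta> * (\<zeta> * real kmax - wmax * real (2 * (B + 1) * D))"
begin

text \<open>The total weight of the nodes that are pushed if the queried edge to \<open>u\<close> is
  present.\<close>

definition g :: "nat \<Rightarrow> nat \<Rightarrow> real" where
  "g b u = (if u \<in> V then 2 * (\<Sum>j\<le>b. w j) else w (Suc b))"

text \<open>A node starts with the weight of its type and pays \<open>cr * g b u\<close> for every
  query, successful or not.\<close>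

definition wt :: "node \<Rightarrow> real" where
  "wt = (\<lambda>(y, b, Q, d). w b - cr * (\<Sum>u\<in>Q. g b u))"

definition Psi :: "node list \<Rightarrow> real" where
  "Psi L = sum_list (map wt L)"

definition fail :: "graph \<Rightarrow> bool" where
  "fail G \<longleftrightarrow> \<not> (\<exists>S\<in>near_factors n m (2 * B + 4). S \<subseteq> G \<union> H \<and> D \<le> card (S - H) + B)"

text \<open>Failure given that the edges in \<open>K\<close> are known to be present and those in \<open>A\<close> are still undecided:
  conditioning on one undecided edge at a time replaces an explicit exploration algorithm.\<close>

definition failp :: "graph \<Rightarrow> graph \<Rightarrow> real" where
  "failp A K = measure_pmf.prob (random_subset A p) {S. fail (K \<union> S)}"

text \<open>The edges that a node may still query are undecided, and by the clause on
  \<open>H\<close> none of them is a cycle edge.\<close>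

definition node_ok :: "nat set \<Rightarrow> graph \<Rightarrow> graph \<Rightarrow> node \<Rightarrow> bool" where
  "node_ok X K A = (\<lambda>(y, b, Q, d). b \<le> B \<and> finite Q \<and> (\<forall>x. {y, x} \<in> H \<longrightarrow> x \<in> X) \<and> y \<in> X \<and>
     alternating X K y b d \<and> (\<forall>u\<in>{1..n} - X - Q. {y, u} \<in> A))"

definition inv :: "node list \<Rightarrow> nat set \<Rightarrow> graph \<Rightarrow> graph \<Rightarrow> nat \<Rightarrow> bool" where
  "inv L X K A k \<longleftrightarrow> X \<subseteq> {1..n} \<and> K \<subseteq> complete_edges n \<and> A \<subseteq> complete_edges n \<and>
     (\<forall>a\<in>{1..n} - X. \<forall>u\<in>{1..n} - X. a \<noteq> u \<longrightarrow> {a, u} \<in> A) \<and>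
     distinct (map fst L) \<and> depth_ok (2 * (B + 1)) L \<and>
     card X \<le> (2 * B + 5) * (k + length L) \<and> (\<forall>\<nu>\<in>set L. node_ok X K A \<nu>)"

lemma finite_edges: "finite (complete_edges n)"
  by (simp add: finite_imp_finite_nsets)

lemma node_ok_mono:
  assumes "node_ok X K A (y, b, Q, d)" "X \<subseteq> X'" "K \<subseteq> K'"
  shows "node_ok X' K' A (y, b, Q, d)"
  using assms alternating_mono[of X K y b d X' K'] unfolding node_ok_def by auto

lemma w_nonneg: "b \<le> Suc B \<Longrightarrow> 0 \<le> w b"
  using w_pos[of b] w_top by (cases "b = Suc B") auto

lemma g_nonneg: "b \<le> B \<Longrightarrow> 0 \<le> g b u"
  using w_nonneg by (auto simp: g_def intro!: sum_nonneg mult_nonneg_nonneg)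

lemma failp_le_1: "failp A K \<le> 1"
  unfolding failp_def by simp

lemma failp_query:
  assumes "A \<subseteq> complete_edges n" "e \<in> A"
  shows "failp A K = p * failp (A - {e}) (insert e K) + (1 - p) * failp (A - {e}) K"
proof -
  have "finite A" using assms(1) finite_edges finite_subset by blast
  then have "failp (insert e (A - {e})) K =
    p * measure_pmf.prob (random_subset (A - {e}) p) {S. fail (K \<union> insert e S)} +
    (1 - p) * failp (A - {e}) K"
    unfolding failp_def by (intro prob_random_subset_insert p) auto
  then show ?thesis using assms(2) by (simp add: failp_def insert_absorb)
qed

text \<open>A path with \<open>D\<close> new edges already contains the desired member, whatever the
  undecided edges turn out to be.\<close>

lemma failp_success:
  assumes "inv ((y, b, Q, d) # L) X K A k" "D \<le> d"
  shows "failp A K = 0"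
proof -
  have "alternating X K y b d" "b \<le> B" "K \<subseteq> complete_edges n"
    using assms(1) by (auto simp: inv_def node_ok_def)
  from alternating_near_factor[OF this] obtain S where
    S: "S \<in> near_factors n m (2 * B + 4)" "S \<subseteq> K \<union> H" "d \<le> card (S - H) + B" by blast
  have "\<not> fail (K \<union> T)" for T
    unfolding fail_def using S assms(2) by (auto intro!: bexI[of _ S])
  then show ?thesis by (simp add: failp_def)
qed

text \<open>The common part of all extensions of the stack: a new root, a child off the cycle, or
  the family of children around a cycle vertex.\<close>

lemma inv_push:
  assumes inv: "inv L X K A k" and X: "X \<subseteq> X'" "X' \<subseteq> {1..n}" "card X' \<le> card X + (2 * B + 5)"
    and K: "K \<subseteq> K'" "K' \<subseteq> complete_edges n"
    and N: "distinct (map fst N)" "N \<noteq> []" "length N \<le> 2 * (B + 1)"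
    and nodes: "\<And>y b Q d. (y, b, Q, d) \<in> set N \<Longrightarrow> b \<le> B \<and> Q = {} \<and> d = dep \<and> y \<in> X' - X \<and>
       (\<forall>x. {y, x} \<in> H \<longrightarrow> x \<in> X') \<and> alternating X' K' y b d"
    and depth: "length L \<le> 2 * (B + 1) * dep"
  shows "inv (N @ L) X' K' A k"
proof -
  have ok: "node_ok X K A \<nu>" if "\<nu> \<in> set L" for \<nu> using inv that by (auto simp: inv_def)
  have pairs: "{a, u} \<in> A" if "a \<in> {1..n} - X" "u \<in> {1..n} - X" "a \<noteq> u" for a u
    using inv that by (auto simp: inv_def)
  have "node_ok X' K' A \<nu>" if "\<nu> \<in> set (N @ L)" for \<nu>
  proof -
    obtain y b Q d where nu: "\<nu> = (y, b, Q, d)" by (cases \<nu>) auto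
    show ?thesis
    proof (cases "\<nu> \<in> set L")
      case True
      then show ?thesis using ok node_ok_mono X(1) K(1) nu by blast
    next
      case False
      then have "(y, b, Q, d) \<in> set N" using that nu by simp
      from nodes[OF this] have *: "b \<le> B" "Q = {}" "y \<in> X' - X" "\<forall>x. {y, x} \<in> H \<longrightarrow> x \<in> X'" "alternating X' K' y b d"
        by auto
      have "{y, u} \<in> A" if "u \<in> {1..n} - X'" for u
        using that * X by (intro pairs) auto
      then show ?thesis unfolding nu node_ok_def using * by simp
    qed
  qed
  moreover have "distinct (map fst (N @ L))"
  proof -
    have "fst \<nu> \<in> X' - X" if "\<nu> \<in> set N" for \<nu>
    proof -
      obtain y b Q d where "\<nu> = (y, b, Q, d)" by (cases \<nu>) auto
      then show ?thesis using nodes[of y b Q d] that by simp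
    qed
    moreover have "fst \<nu> \<in> X" if "\<nu> \<in> set L" for \<nu>
      using ok[OF that] by (auto simp: node_ok_def)
    ultimately have "set (map fst N) \<inter> set (map fst L) = {}" by fastforce
    then show ?thesis using N(1) inv by (auto simp: inv_def)
  qed
  moreover have "depth_ok (2 * (B + 1)) (N @ L)"
  proof (rule depth_ok_append[of _ _ _ dep])
    show "depth_ok (2 * (B + 1)) L" using inv by (auto simp: inv_def)
    show "length N + length L \<le> 2 * (B + 1) * Suc dep" using depth N(3) by simp
    show "d = dep" if "(y, b, Q, d) \<in> set N" for y b Q d using nodes[OF that] by simp
  qed
  moreover have "card X' \<le> (2 * B + 5) * (k + length (N @ L))"
  proof -
    have "card X \<le> (2 * B + 5) * (k + length L)" using inv by (simp add: inv_def)
    then have "card X' \<le> (2 * B + 5) * Suc (k + length L)" using X(3) by simp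
    also have "\<dots> \<le> (2 * B + 5) * (k + length (N @ L))"
      using N(2) by (intro mult_le_mono2) (cases N, auto)
    finally show ?thesis .
  qed
  moreover have "\<forall>a\<in>{1..n} - X'. \<forall>u\<in>{1..n} - X'. a \<noteq> u \<longrightarrow> {a, u} \<in> A"
    using pairs X(1) by blast
  ultimately show ?thesis
    unfolding inv_def using X(2) K(2) inv by (auto simp: inv_def)
qed

lemma inv_query_no:
  assumes inv: "inv ((y, b, Q, d) # L) X K A k" and u: "u \<in> {1..n} - X - Q"
  shows "inv ((y, b, insert u Q, d) # L) X K (A - {{y, u}}) k"
proof -
  have top: "node_ok X K A (y, b, Q, d)" and ok: "\<And>\<nu>. \<nu> \<in> set L \<Longrightarrow> node_ok X K A \<nu>"
    using inv by (auto simp: inv_def)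
  have yX: "y \<in> X" using top by (simp add: node_ok_def)
  have "node_ok X K (A - {{y, u}}) (y, b, insert u Q, d)"
    using top unfolding node_ok_def by (auto simp: doubleton_eq_iff)
  moreover have "node_ok X K (A - {{y, u}}) \<nu>" if "\<nu> \<in> set L" for \<nu>
  proof -
    obtain y' b' Q' d' where nu: "\<nu> = (y', b', Q', d')" by (cases \<nu>) auto
    have "y' \<noteq> y" using inv that nu by (auto simp: inv_def rev_image_eqI)
    moreover have "y' \<noteq> u" using ok[OF that] u nu by (auto simp: node_ok_def)
    ultimately show ?thesis using ok[OF that] unfolding nu node_ok_def by (auto simp: doubleton_eq_iff)
  qed
  ultimately show ?thesis
    using inv yX unfolding inv_def by (auto simp: doubleton_eq_iff)
qed

text \<open>All directions and run lengths at once: a single noise edge to the cycle opens two nodes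
  of each type up to \<open>b\<close>, which is the factor 2 in the branching operator.\<close>

definition children :: "nat \<Rightarrow> nat \<Rightarrow> int \<Rightarrow> node list" where
  "children b d j = map (\<lambda>i. (v (j + int (Suc i)), b - i, {}, Suc d)) [0..<Suc b] @
     map (\<lambda>i. (v (j - int (Suc i)), b - i, {}, Suc d)) [0..<Suc b]"

lemma length_children: "length (children b d j) = 2 * Suc b"
  by (simp add: children_def)

lemma distinct_children:
  assumes "b \<le> B"
  shows "distinct (map fst (children b d j))"
proof -
  have v: "v (j + s) = v (j + t) \<longleftrightarrow> s = t" if "\<bar>s\<bar> \<le> int B + 1" "\<bar>t\<bar> \<le> int B + 1" for s t
    using m_large that by (subst v_eq_abs) auto
  have "inj_on (\<lambda>i. v (j + int (Suc i))) {0..<Suc b}"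
    using v assms by (intro inj_onI) (auto simp del: of_nat_Suc)
  moreover have "inj_on (\<lambda>i. v (j - int (Suc i))) {0..<Suc b}"
  proof (rule inj_onI)
    fix i i' assume "i \<in> {0..<Suc b}" "i' \<in> {0..<Suc b}" "v (j - int (Suc i)) = v (j - int (Suc i'))"
    then have "v (j + - int (Suc i)) = v (j + - int (Suc i'))" "i \<le> B" "i' \<le> B"
      unfolding diff_conv_add_uminus using assms by simp_all
    then show "i = i'" by (subst (asm) v) auto
  qed
  moreover have "v (j + int (Suc i)) \<noteq> v (j - int (Suc i'))" if "i < Suc b" "i' < Suc b" for i i'
    unfolding diff_conv_add_uminus using that assms by (subst v) auto
  then have "(\<lambda>i. v (j + int (Suc i))) ` {0..<Suc b} \<inter> (\<lambda>i. v (j - int (Suc i))) ` {0..<Suc b} = {}"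
    by (auto simp del: of_nat_Suc)
  ultimately show ?thesis
    unfolding children_def by (simp only: map_append map_map o_def fst_conv distinct_append distinct_map
        set_map set_upt distinct_upt simp_thms)
qed

lemma in_children_cases:
  assumes "(y', b', Q', d') \<in> set (children b d j)"
  obtains i s where "i \<le> b" "s = 1 \<or> s = -1" "y' = v (j + s * int (Suc i))" "b' = b - i" "Q' = {}" "d' = Suc d"
proof -
  from assms have "\<exists>i<Suc b. (y' = v (j + int (Suc i)) \<or> y' = v (j - int (Suc i))) \<and> b' = b - i \<and> Q' = {} \<and> d' = Suc d"
    unfolding children_def by (auto simp del: upt_Suc of_nat_Suc)
  then obtain i where "i < Suc b" "y' = v (j + int (Suc i)) \<or> y' = v (j - int (Suc i))" "b' = b - i" "Q' = {}" "d' = Suc d"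
    by blast
  then show ?thesis using that[of i 1] that[of i "-1"] by (auto simp del: of_nat_Suc)
qed

lemma Psi_Cons: "Psi (\<nu> # L) = wt \<nu> + Psi L"
  by (simp add: Psi_def)

lemma Psi_append: "Psi (N @ L) = Psi N + Psi L"
  by (simp add: Psi_def)

lemma Psi_children: "Psi (children b d j) = 2 * (\<Sum>i\<le>b. w i)"
proof -
  have "(\<Sum>i\<leftarrow>[0..<Suc b]. w (b - i)) = (\<Sum>i\<in>{..b}. w (b - i))"
    by (subst interv_sum_list_conv_sum_set_nat) (simp only: atLeast0LessThan lessThan_Suc_atMost set_upt)
  also have "\<dots> = (\<Sum>i\<le>b. w i)" by (rule sum.reindex_bij_witness[of _ "\<lambda>i. b - i" "\<lambda>i. b - i"]) auto
  finally have "(\<Sum>i\<leftarrow>[0..<Suc b]. w (b - i)) = (\<Sum>i\<le>b. w i)" .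
  then show ?thesis
    unfolding children_def Psi_def wt_def by (simp add: o_def del: upt_Suc)
qed

lemma inv_query_yes_inside:
  assumes inv: "inv ((y, b, Q, d) # L) X K A k" and u: "v j \<in> {1..n} - X - Q" and bl: "block (v j) \<inter> X = {}"
  shows "inv (children b d j @ (y, b, insert (v j) Q, d) # L) (block (v j) \<union> X) (insert {y, v j} K) (A - {{y, v j}}) k"
proof -
  have top: "node_ok X K A (y, b, Q, d)" using inv by (auto simp: inv_def)
  have y: "y \<in> X" "b \<le> B" "alternating X K y b d" "\<And>x. {y, x} \<in> H \<Longrightarrow> x \<in> X"
    using top by (auto simp: node_ok_def)
  have XS: "X \<subseteq> {1..n}" and KE: "K \<subseteq> complete_edges n" and finX: "finite X"
    using inv finite_subset by (auto simp: inv_def)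
  have eE: "{y, v j} \<in> complete_edges n"
    using y(1) XS u by (intro edge_in) auto
  show ?thesis
  proof (rule inv_push[OF inv_query_no[OF inv u], where dep = "Suc d"])
    show "block (v j) \<union> X \<subseteq> {1..n}" using XS block_subset v_range by blast
    show "card (block (v j) \<union> X) \<le> card X + (2 * B + 5)"
      using card_Un_le[of "block (v j)" X] card_block[of "v j"] by linarith
    show "insert {y, v j} K \<subseteq> complete_edges n" using KE eE by simp
    show "distinct (map fst (children b d j))" using distinct_children y(2) by blast
    show "length (children b d j) \<le> 2 * (B + 1)" using y(2) by (simp add: length_children)
    show "length ((y, b, insert (v j) Q, d) # L) \<le> 2 * (B + 1) * Suc d"
      using inv by (simp add: inv_def)
    show "children b d j \<noteq> []" by (simp add: children_def)
    fix y' b' Q' d' assume "(y', b', Q', d') \<in> set (children b d j)"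
    then obtain i s where *: "i \<le> b" "s = 1 \<or> s = -1" "y' = v (j + s * int (Suc i))" "b' = b - i" "Q' = {}" "d' = Suc d"
      by (rule in_children_cases)
    have y': "y' = v (j + s * int (Suc i))" by fact
    have alt: "alternating (block (v j) \<union> X) (insert {y, v j} K) y' b' d'"
      unfolding y' *(4,6) by (rule alternating_inside[OF y(3) bl y(2) *(1,2) y(4)])
    have bb: "y' \<in> block (v j)"
      unfolding y' using * y(2) by (intro in_blockI) (auto simp: abs_mult)
    have nb: "x \<in> block (v j)" if "{y', x} \<in> H" for x
    proof -
      from H_neighbour[OF that[unfolded y']]
      have "x = v (j + (s * int (Suc i) + 1)) \<or> x = v (j + (s * int (Suc i) - 1))"
        by (simp add: algebra_simps)
      then show ?thesis using *(1,2) y(2) by (auto intro!: in_blockI)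
    qed
    show "b' \<le> B \<and> Q' = {} \<and> d' = Suc d \<and> y' \<in> block (v j) \<union> X - X \<and>
       (\<forall>x. {y', x} \<in> H \<longrightarrow> x \<in> block (v j) \<union> X) \<and>
       alternating (block (v j) \<union> X) (insert {y, v j} K) y' b' d'"
      using * alt nb bb bl y(2) by auto
  qed auto
qed

lemma inv_query_yes_outside:
  assumes inv: "inv ((y, b, Q, d) # L) X K A k" and u: "u \<in> {1..n} - X - Q" "u \<notin> V" and b: "b < B"
  shows "inv ([(u, Suc b, {}, Suc d)] @ (y, b, insert u Q, d) # L) (insert u X) (insert {y, u} K) (A - {{y, u}}) k"
proof -
  have top: "node_ok X K A (y, b, Q, d)" using inv by (auto simp: inv_def)
  have y: "y \<in> X" "alternating X K y b d"
    using top by (auto simp: node_ok_def)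
  have XS: "X \<subseteq> {1..n}" and KE: "K \<subseteq> complete_edges n" and finX: "finite X"
    using inv finite_subset by (auto simp: inv_def)
  have eE: "{y, u} \<in> complete_edges n"
    using y(1) XS u by (intro edge_in) auto
  have nb: "{u, x} \<notin> H" for x using u(2) by (auto simp: H_def doubleton_eq_iff)
  have alt: "alternating (insert u X) (insert {y, u} K) u (Suc b) (Suc d)"
    using alternating_outside[OF y(2)] u by blast
  show ?thesis
  proof (rule inv_push[OF inv_query_no[OF inv u(1)], where dep = "Suc d"])
    show "insert u X \<subseteq> {1..n}" using XS u by blast
    show "card (insert u X) \<le> card X + (2 * B + 5)" using finX by (simp add: card_insert_if)
    show "insert {y, u} K \<subseteq> complete_edges n" using KE eE by simp
    show "length ((y, b, insert u Q, d) # L) \<le> 2 * (B + 1) * Suc d"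
      using inv by (simp add: inv_def)
    fix y' b' Q' d' assume "(y', b', Q', d') \<in> set [(u, Suc b, {} :: nat set, Suc d)]"
    then have *: "y' = u" "b' = Suc b" "Q' = {}" "d' = Suc d" by auto
    show "b' \<le> B \<and> Q' = {} \<and> d' = Suc d \<and> y' \<in> insert u X - X \<and>
       (\<forall>x. {y', x} \<in> H \<longrightarrow> x \<in> insert u X) \<and>
       alternating (insert u X) (insert {y, u} K) y' b' d'"
      unfolding * using alt nb b u(1) by simp
  qed auto
qed

lemma inv_root:
  assumes inv: "inv [] X K A k" and bl: "block (v j) \<inter> X = {}"
  shows "inv [(v (j + 1), 0, {}, 0)] (block (v j) \<union> X) K A k"
proof -
  have XS: "X \<subseteq> {1..n}" and KE: "K \<subseteq> complete_edges n"
    using inv by (auto simp: inv_def)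
  have bb: "v (j + 1) \<in> block (v j)" by (intro in_blockI) auto
  have nb: "x \<in> block (v j)" if "{v (j + 1), x} \<in> H" for x
    using H_neighbour[OF that] in_blockI[of 2 j] in_blockI[of 0 j] by (auto simp: add.assoc)
  have alt: "alternating (block (v j) \<union> X) K (v (j + 1)) 0 0" by (rule alternating_root) auto
  have "inv ([(v (j + 1), 0, {}, 0)] @ []) (block (v j) \<union> X) K A k"
  proof (rule inv_push[OF inv, where dep = 0])
    show "block (v j) \<union> X \<subseteq> {1..n}" using XS block_subset v_range by blast
    show "card (block (v j) \<union> X) \<le> card X + (2 * B + 5)"
      using card_Un_le[of "block (v j)" X] card_block[of "v j"] by linarith
    fix y' b' Q' d' assume "(y', b', Q', d') \<in> set [(v (j + 1), 0 :: nat, {} :: nat set, 0 :: nat)]"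
    then have *: "y' = v (j + 1)" "b' = 0" "Q' = {}" "d' = 0" by auto
    show "b' \<le> B \<and> Q' = {} \<and> d' = 0 \<and> y' \<in> block (v j) \<union> X - X \<and>
       (\<forall>x. {y', x} \<in> H \<longrightarrow> x \<in> block (v j) \<union> X) \<and> alternating (block (v j) \<union> X) K y' b' d'"
      unfolding * using alt nb bb bl by auto
  qed (use KE in auto)
  then show ?thesis by simp
qed

lemma inv_pop:
  assumes "inv (\<nu> # L) X K A k"
  shows "inv L X K A (Suc k)"
  using assms by (cases \<nu>) (auto simp: inv_def)

text \<open>Lying in a block is a symmetric relation, so the centres blocked by \<open>x\<close> lie
  in \<open>block x\<close>.\<close>

lemma card_blocked:
  assumes "finite X"
  shows "card {u \<in> V. block u \<inter> X \<noteq> {}} \<le> (2 * B + 5) * card X"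
proof -
  have "{u \<in> V. block u \<inter> X \<noteq> {}} \<subseteq> (\<Union>x\<in>X. block x)" using block_sym by blast
  then have "card {u \<in> V. block u \<inter> X \<noteq> {}} \<le> card (\<Union>x\<in>X. block x)"
    using assms by (intro card_mono) auto
  also have "\<dots> \<le> (\<Sum>x\<in>X. card (block x))" by (rule card_UN_le[OF assms])
  also have "\<dots> \<le> (\<Sum>x\<in>X. 2 * B + 5)" using card_block by (intro sum_mono)
  finally show ?thesis by (simp add: mult.commute)
qed

lemma self_in_block: "u \<in> V \<Longrightarrow> u \<in> block u"
  using in_blockI[of 0] by auto

text \<open>Each used vertex spoils at most \<open>2 * B + 5\<close> cycle vertices; all others have
  been queried and charged. Type \<open>B\<close> may skip the vertices off the cycle because
  \<open>w (Suc B) = 0\<close>.\<close>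

lemma credit:
  assumes "finite Q" "X \<subseteq> {1..n}" "card X \<le> smax" "b \<le> B"
    and all: "\<And>u. u \<in> {1..n} - X \<Longrightarrow> (u \<in> V \<and> block u \<inter> X = {}) \<or> (u \<notin> V \<and> b < B) \<Longrightarrow> u \<in> Q"
  shows "w b + \<zeta> \<le> cr * (\<Sum>u\<in>Q. g b u)"
proof -
  have finX: "finite X" using assms(2) finite_subset by blast
  have finV: "finite V" using v_range finite_subset by blast
  define Q1 where "Q1 = {u \<in> V. block u \<inter> X = {}}"
  define Q2 where "Q2 = {1..n} - V - X"
  have Q1Q: "Q1 \<subseteq> Q"
    using all v_range self_in_block unfolding Q1_def by blast
  have "w b + \<zeta> \<le> cr * ((real n - real m - real (card X)) * w (Suc b) +
     (real m - real ((2 * B + 5) * card X)) * (2 * (\<Sum>j\<le>b. w j)))"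
    using assms by (intro gain)
  also have "\<dots> \<le> cr * (\<Sum>u\<in>Q. g b u)"
  proof (intro mult_left_mono cr)
    have "card V = card Q1 + card {u \<in> V. block u \<inter> X \<noteq> {}}"
    proof -
      have "V = Q1 \<union> {u \<in> V. block u \<inter> X \<noteq> {}}" by (auto simp: Q1_def)
      moreover have "card (Q1 \<union> {u \<in> V. block u \<inter> X \<noteq> {}}) = card Q1 + card {u \<in> V. block u \<inter> X \<noteq> {}}"
        using finV by (intro card_Un_disjoint) (auto simp: Q1_def)
      ultimately show ?thesis by simp
    qed
    then have "m \<le> card Q1 + (2 * B + 5) * card X"
      using card_blocked[OF finX] card_V by linarith
    then have c1: "real m - real ((2 * B + 5) * card X) \<le> real (card Q1)" by linarith
    have s1: "(real m - real ((2 * B + 5) * card X)) * (2 * (\<Sum>j\<le>b. w j)) \<le> (\<Sum>u\<in>Q1. g b u)"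
    proof -
      have "(\<Sum>u\<in>Q1. g b u) = real (card Q1) * (2 * (\<Sum>j\<le>b. w j))"
        by (simp add: g_def Q1_def)
      then show ?thesis
        using c1 w_nonneg assms(4) by (auto intro!: mult_right_mono sum_nonneg)
    qed
    have sum2: "(real n - real m - real (card X)) * w (Suc b) + (\<Sum>u\<in>Q1. g b u) \<le> (\<Sum>u\<in>Q. g b u)"
    proof (cases "b < B")
      case True
      then have Q2Q: "Q2 \<subseteq> Q" using all unfolding Q2_def by blast
      have "card ({1..n} - V) = n - m" using v_range card_V finV by (simp add: card_Diff_subset)
      moreover have "card ({1..n} - V) - card X \<le> card Q2"
        unfolding Q2_def by (rule diff_card_le_card_Diff[OF finX])
      moreover have "m \<le> n" using card_mono[OF _ v_range] card_V by simp
      ultimately have "real n - real m - real (card X) \<le> real (card Q2)" by linarith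
      then have "(real n - real m - real (card X)) * w (Suc b) \<le> real (card Q2) * w (Suc b)"
        using w_nonneg[of "Suc b"] True by (intro mult_right_mono) auto
      also have "\<dots> = (\<Sum>u\<in>Q2. g b u)" by (simp add: g_def Q2_def)
      finally have "(real n - real m - real (card X)) * w (Suc b) + (\<Sum>u\<in>Q1. g b u) \<le> (\<Sum>u\<in>Q2 \<union> Q1. g b u)"
        using finV by (subst sum.union_disjoint) (auto simp: Q1_def Q2_def)
      also have "\<dots> \<le> (\<Sum>u\<in>Q. g b u)"
        using Q1Q Q2Q assms(1,4) g_nonneg by (intro sum_mono2) auto
      finally show ?thesis .
    next
      case False
      then have "w (Suc b) = 0" using assms(4) w_top by simp
      moreover have "(\<Sum>u\<in>Q1. g b u) \<le> (\<Sum>u\<in>Q. g b u)"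
        using Q1Q assms(1,4) g_nonneg by (intro sum_mono2) auto
      ultimately show ?thesis by simp
    qed
    show "(real n - real m - real (card X)) * w (Suc b) + (real m - real ((2 * B + 5) * card X)) * (2 * (\<Sum>j\<le>b. w j))
       \<le> (\<Sum>u\<in>Q. g b u)"
      using s1 sum2 by linarith
  qed
  finally show ?thesis .
qed

text \<open>The supermartingale bound, proved by induction instead of along a random process. The
  measure decreases because a query settles one undecided edge and pushes at most
  \<open>2 * (B + 1)\<close> nodes, a new root enlarges \<open>X\<close> at the cost of one stack
  entry, and discarding a node shortens the stack.\<close>

lemma exploration_bound:
  "inv L X K A k \<Longrightarrow> failp A K \<le> exp (- \<theta> * (Psi L - \<zeta> * real k) - c)"
proof (induction "(2 * (B + 1) + 1) * card A + 2 * (n - card X) + length L" arbitrary: L X K A k rule: less_induct)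
  case less
  note inv = less.prems
  have XS: "X \<subseteq> {1..n}" and AE: "A \<subseteq> complete_edges n"
    using inv by (auto simp: inv_def)
  have finA: "finite A" using AE finite_edges finite_subset by blast
  have finX: "finite X" using XS finite_subset by blast
  have cardX: "card X \<le> (2 * B + 5) * (k + length L)" using inv by (simp add: inv_def)
  have wmax0: "0 \<le> wmax" using w_pos[of 0] w_le[of 0] by simp
  \<comment> \<open>After \<open>kmax\<close> discarded nodes and with a small potential left, the
    accumulated drift makes the claimed bound at least 1.\<close>
  have stop: ?case if "kmax \<le> k" "Psi L \<le> wmax * real (2 * (B + 1) * D)"
  proof -
    have "\<zeta> * real kmax \<le> \<zeta> * real k" using that(1) ze by (intro mult_left_mono) auto
    then have "c \<le> \<theta> * (\<zeta> * real k - Psi L)"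
      using final that(2) th by (smt (verit) mult_left_mono)
    then have "1 \<le> exp (- \<theta> * (Psi L - \<zeta> * real k) - c)" by (simp add: algebra_simps)
    then show ?thesis using failp_le_1[of A K] by linarith
  qed
  show ?case
  proof (cases L)
    case Nil
    show ?thesis
    proof (cases "kmax \<le> k")
      case True
      then show ?thesis using stop Nil wmax0 by (simp add: Psi_def)
    next
      case False
      then have "card X \<le> smax"
        using Nil by (intro order_trans[OF cardX] order_trans[OF mult_le_mono2 smax]) auto
      then have "(2 * B + 5) * card X < m" using room by (meson le_less_trans mult_le_mono2)
      then have "card {u \<in> V. block u \<inter> X \<noteq> {}} < card V"
        using card_blocked[OF finX] card_V by linarith
      then have "\<exists>u\<in>V. block u \<inter> X = {}" by (metis (mono_tags, lifting) Collect_cong Collect_mem_eq less_irrefl)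
      then obtain j where j: "block (v j) \<inter> X = {}" by blast
      have inv': "inv [(v (j + 1), 0, {}, 0)] (block (v j) \<union> X) K A k"
        using inv_root[OF _ j] inv Nil by simp
      have "X \<subset> block (v j) \<union> X" using j self_in_block[of "v j"] by blast
      then have "card X < card (block (v j) \<union> X)" using finX by (intro psubset_card_mono) auto
      moreover have "card (block (v j) \<union> X) \<le> n"
        using inv' card_mono[of "{1..n}" "block (v j) \<union> X"] by (simp add: inv_def)
      ultimately have "failp A K \<le> exp (- \<theta> * (Psi [(v (j + 1), 0, {}, 0)] - \<zeta> * real k) - c)"
        using Nil by (intro less.hyps[OF _ inv']) auto
      also have "\<dots> \<le> exp (- \<theta> * (Psi L - \<zeta> * real k) - c)"
      proof -
        have "Psi L - \<zeta> * real k \<le> Psi [(v (j + 1), 0, {}, 0)] - \<zeta> * real k"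
          using w_pos[of 0] Nil by (simp add: Psi_def wt_def)
        then show ?thesis using th by simp
      qed
      finally show ?thesis .
    qed
  next
    case (Cons \<nu> L')
    obtain y b Q d where nu: "\<nu> = (y, b, Q, d)" by (cases \<nu>) auto
    have L: "L = (y, b, Q, d) # L'" using Cons nu by simp
    have top: "node_ok X K A (y, b, Q, d)" using inv by (auto simp: inv_def L)
    have bB: "b \<le> B" and finQ: "finite Q" using top by (auto simp: node_ok_def)
    have lenL: "length L \<le> 2 * (B + 1) * Suc d" using inv by (simp add: inv_def L)
    show ?thesis
    proof (cases "D \<le> d")
      case True
      then show ?thesis using failp_success inv L by simp
    next
      case dD: False
      \<comment> \<open>By \<open>depth_ok\<close> at the top node, a shallow top bounds the whole
        stack.\<close>
      then have lenD: "length L \<le> 2 * (B + 1) * D"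
        using lenL by (meson Suc_leI le_trans mult_le_mono2 not_le)
      show ?thesis
      proof (cases "kmax \<le> k")
        case True
        have "Psi M \<le> wmax * real (length M)" if "\<forall>\<nu>\<in>set M. node_ok X K A \<nu>" for M
          using that
        proof (induction M)
          case Nil
          then show ?case by (simp add: Psi_def)
        next
          case (Cons \<mu> M)
          obtain y' b' Q' d' where mu: "\<mu> = (y', b', Q', d')" by (cases \<mu>) auto
          have b': "b' \<le> B" using Cons.prems by (simp add: node_ok_def mu)
          have "0 \<le> cr * (\<Sum>u\<in>Q'. g b' u)" using cr g_nonneg[OF b'] by (intro mult_nonneg_nonneg sum_nonneg)
          then have "wt \<mu> \<le> wmax" using w_le[OF b'] by (simp add: wt_def mu)
          then show ?case using Cons by (simp add: Psi_Cons algebra_simps)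
        qed
        then have "Psi L \<le> wmax * real (length L)" using inv by (auto simp: inv_def)
        also have "\<dots> \<le> wmax * real (2 * (B + 1) * D)" using lenD wmax0 by (intro mult_left_mono) linarith+
        finally show ?thesis using stop True by blast
      next
        case kk: False
        have "card X \<le> (2 * B + 5) * (kmax + 2 * (B + 1) * D)"
          using kk lenD by (intro order_trans[OF cardX] mult_le_mono2 add_mono) auto
        then have Xs: "card X \<le> smax" using smax by linarith
        define elig where "elig = (\<lambda>u. (u \<in> V \<and> block u \<inter> X = {}) \<or> (u \<notin> V \<and> b < B))"
        show ?thesis
        proof (cases "\<exists>u\<in>{1..n} - X - Q. elig u")
          case False
          then have "w b + \<zeta> \<le> cr * (\<Sum>u\<in>Q. g b u)"
            using finQ XS Xs bB by (intro credit) (auto simp: elig_def)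
          then have wt: "wt (y, b, Q, d) \<le> - \<zeta>" by (simp add: wt_def)
          \<comment> \<open>The charges exceed the weight of the top by \<open>\<zeta>\<close>, so
            discarding it while \<open>k\<close> grows by 1 does not decrease
            \<open>Psi L - \<zeta> * real k\<close>.\<close>
          have "failp A K \<le> exp (- \<theta> * (Psi L' - \<zeta> * real (Suc k)) - c)"
            using inv_pop inv by (intro less.hyps) (auto simp: L)
          also have "\<dots> \<le> exp (- \<theta> * (Psi L - \<zeta> * real k) - c)"
          proof -
            have "Psi L - \<zeta> * real k \<le> Psi L' - \<zeta> * real (Suc k)"
              using wt by (simp add: L Psi_Cons algebra_simps)
            then show ?thesis using th by simp
          qed
          finally show ?thesis .
        next
          case True
          then obtain u where u: "u \<in> {1..n} - X - Q" "elig u" by blast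
          define e where "e = {y, u}"
          have eA: "e \<in> A" using top u(1) by (simp add: node_ok_def e_def)
          obtain a where cA: "card (A - {e}) = a" "card A = Suc a" using card.remove[OF finA eA] by blast
          define L1 where "L1 = (y, b, insert u Q, d) # L'"
          have Psi1: "Psi L1 = Psi L - cr * g b u"
            using u(1) finQ by (simp add: L1_def L Psi_Cons wt_def algebra_simps)
          have no: "failp (A - {e}) K \<le> exp (- \<theta> * (Psi L1 - \<zeta> * real k) - c)"
          proof (rule less.hyps)
            show "inv L1 X K (A - {e}) k" using inv_query_no[of y b Q d L'] inv u(1) by (simp add: L1_def L e_def)
            show "(2 * (B + 1) + 1) * card (A - {e}) + 2 * (n - card X) + length L1
              < (2 * (B + 1) + 1) * card A + 2 * (n - card X) + length L" unfolding cA by (simp add: L1_def L)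
          qed
          have "\<exists>N X'. inv (N @ L1) X' (insert e K) (A - {e}) k \<and> X \<subseteq> X' \<and> length N \<le> 2 * (B + 1) \<and> Psi N = g b u"
          proof (cases "u \<in> V")
            case True
            then obtain j where j: "u = v j" by blast
            then have "block (v j) \<inter> X = {}" using u(2) True by (simp add: elig_def)
            then show ?thesis
              using inv_query_yes_inside[of y b Q d L' X K A k j] inv u(1) j bB
              by (intro exI[of _ "children b d j"] exI[of _ "block (v j) \<union> X"])
                (auto simp: L L1_def e_def Psi_children g_def length_children)
          next
            case False
            then show ?thesis
              using inv_query_yes_outside[of y b Q d L' X K A k u] inv u
              by (intro exI[of _ "[(u, Suc b, {}, Suc d)]"] exI[of _ "insert u X"])
                (auto simp: L L1_def e_def elig_def g_def Psi_def wt_def)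
          qed
          then obtain N X' where N: "inv (N @ L1) X' (insert e K) (A - {e}) k" "X \<subseteq> X'" "length N \<le> 2 * (B + 1)" "Psi N = g b u"
            by blast
          have yes: "failp (A - {e}) (insert e K) \<le> exp (- \<theta> * (Psi (N @ L1) - \<zeta> * real k) - c)"
          proof (rule less.hyps[OF _ N(1)])
            have "X' \<subseteq> {1..n}" using N(1) by (simp add: inv_def)
            then have "card X \<le> card X'" using N(2) finite_subset by (intro card_mono) auto
            then show "(2 * (B + 1) + 1) * card (A - {e}) + 2 * (n - card X') + length (N @ L1)
              < (2 * (B + 1) + 1) * card A + 2 * (n - card X) + length L"
              using N(3) unfolding cA by (simp add: L1_def L)
          qed
          have PsiN: "Psi (N @ L1) = Psi L1 + g b u" using N(4) by (simp add: Psi_append)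
          \<comment> \<open>The charge is paid in both outcomes, while \<open>g b u\<close> is
            gained only if the edge is present. \<open>step_out\<close> and \<open>step_in\<close>
            say that the average of the two resulting bounds is at most \<open>E\<close>.\<close>
          define E where "E = exp (- \<theta> * (Psi L - \<zeta> * real k) - c)"
          have E1: "exp (- \<theta> * (Psi L1 - \<zeta> * real k) - c) = E * exp (\<theta> * (cr * g b u))"
            unfolding E_def Psi1 by (simp add: algebra_simps flip: exp_add)
          have E2: "exp (- \<theta> * (Psi (N @ L1) - \<zeta> * real k) - c) = E * exp (\<theta> * (cr * g b u)) * exp (- \<theta> * g b u)"
            unfolding E_def PsiN Psi1 by (simp add: algebra_simps flip: exp_add)
          have "failp A K = p * failp (A - {e}) (insert e K) + (1 - p) * failp (A - {e}) K"
            by (rule failp_query[OF AE eA])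
          also have "\<dots> \<le> p * (E * exp (\<theta> * (cr * g b u)) * exp (- \<theta> * g b u)) + (1 - p) * (E * exp (\<theta> * (cr * g b u)))"
            using yes no p unfolding E1 E2 by (intro add_mono mult_left_mono) auto
          also have "\<dots> = E * exp (\<theta> * (cr * g b u)) * (1 - p + p * exp (- \<theta> * g b u))"
            by (simp add: algebra_simps)
          also have "\<dots> \<le> E * exp (\<theta> * (cr * g b u)) * exp (- \<theta> * (cr * g b u))"
            using step_out[OF bB] step_in[OF bB] by (intro mult_left_mono) (auto simp: g_def E_def)
          also have "\<dots> = E" by (simp add: exp_minus)
          finally show ?thesis unfolding E_def .
        qed
      qed
    qed
  qed
qed

lemma prob_fail: "measure_pmf.prob (random_subset (complete_edges n) p) {G. fail G} \<le> exp (- c)"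
proof -
  have "inv [] {} {} (complete_edges n) 0" by (auto simp: inv_def nsets_def)
  from exploration_bound[OF this] show ?thesis by (simp add: failp_def Psi_def)
qed

end

section \<open>Choice of the constants for large \<open>n\<close>\<close>

lemma cyclic_graph_of_list:
  assumes "distinct xs" "set xs \<subseteq> {1..n}" "2 * B + 6 < length xs"
  shows "cyclic_graph (\<lambda>j. xs ! nat (j mod int (length xs))) (length xs) n B"
    and "cyclic_graph.H (\<lambda>j. xs ! nat (j mod int (length xs))) = cycle_edges xs"
proof -
  define m where "m = length xs"
  have m: "0 < m" using assms(3) unfolding m_def by linarith
  define v where "v = (\<lambda>j. xs ! nat (j mod int m))"
  have lt: "nat (j mod int m) < m" for j using m by (simp add: nat_less_iff)
  interpret cyclic_graph v m n B
  proof
    show "v i = v j \<longleftrightarrow> i mod int m = j mod int m" for i j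
      using lt[of i] lt[of j] assms(1) m unfolding v_def m_def
      by (subst nth_eq_iff_index_eq) (auto simp: nat_eq_iff2)
    show "range v \<subseteq> {1..n}" using lt assms(2) unfolding v_def m_def by (auto dest!: nth_mem)
  qed (use assms in \<open>simp add: m_def\<close>)
  show "cyclic_graph (\<lambda>j. xs ! nat (j mod int (length xs))) (length xs) n B"
    using cyclic_graph_axioms unfolding v_def m_def .
  have e: "{v (int i), v (int i + 1)} = {xs ! i, xs ! (Suc i mod m)}" if "i < m" for i
  proof -
    have "(int i + 1) mod int m = int (Suc i mod m)" by (simp add: zmod_int add.commute)
    then show ?thesis using that by (simp add: v_def)
  qed
  have "H = run 0 1 m" by (rule H_eq_run)
  also have "\<dots> = (\<lambda>i. {v (int i), v (int i + 1)}) ` {..<m}" by (simp add: run_def)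
  also have "\<dots> = cycle_edges xs"
    unfolding cycle_edges_def using e by (auto simp: m_def)
  finally show "cyclic_graph.H (\<lambda>j. xs ! nat (j mod int (length xs))) = cycle_edges xs"
    unfolding v_def m_def .
qed

text \<open>The product of the right-hand side with the quadratic lower bound of
  \<open>exp y\<close> is \<open>1 + (y\<^sup>2 / 2)\<^sup>2\<close>, hence at least 1.\<close>

lemma exp_minus_le_quadratic:
  fixes y :: real
  assumes "0 \<le> y"
  shows "exp (- y) \<le> 1 - y + y\<^sup>2 / 2"
proof -
  have "(1 - y + y\<^sup>2 / 2) * (1 + y + y\<^sup>2 / 2) = 1 + (y\<^sup>2 / 2)\<^sup>2"
    by (simp add: algebra_simps power2_eq_square)
  then have "1 \<le> (1 - y + y\<^sup>2 / 2) * (1 + y + y\<^sup>2 / 2)" by simp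
  also have "\<dots> \<le> (1 - y + y\<^sup>2 / 2) * exp y"
  proof (intro mult_left_mono exp_lower_Taylor_quadratic assms)
    show "0 \<le> 1 - y + y\<^sup>2 / 2" using zero_le_power2[of "1 - y"] by (simp add: power2_diff)
  qed
  finally show ?thesis by (simp add: exp_minus field_simps)
qed

text \<open>For small \<open>y\<close> only a factor \<open>1 - e\<close> is lost against the
  first-order exponent \<open>p * y\<close>; this is the origin of the credit rate
  \<open>cr = (1 - e1) * p\<close>.\<close>

lemma bernoulli_exp_bound:
  fixes p y e :: real
  assumes "0 \<le> p" "0 \<le> y" "y \<le> 2 * e"
  shows "1 - p + p * exp (- y) \<le> exp (- ((1 - e) * p * y))"
proof -
  have "y * y \<le> 2 * e * y" using assms by (intro mult_right_mono) auto
  then have "exp (- y) \<le> 1 - (1 - e) * y"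
    using exp_minus_le_quadratic[OF assms(2)] by (simp add: power2_eq_square algebra_simps)
  then have "p * exp (- y) \<le> p * (1 - (1 - e) * y)" using assms(1) by (rule mult_left_mono)
  then have "1 - p + p * exp (- y) \<le> 1 + (- ((1 - e) * p * y))" by (simp add: algebra_simps)
  also have "\<dots> \<le> exp (- ((1 - e) * p * y))" by (rule exp_ge_add_one_self)
  finally show ?thesis .
qed

text \<open>The search with linear sizes: about \<open>\<kappa> * n\<close> discarded nodes and
  depth about \<open>\<tau> * n\<close>, where \<open>\<tau> = \<kappa> * \<rho>\<close>. The ratio
  \<open>\<rho>\<close> is fixed by the drift, and \<open>\<kappa>\<close> is then taken so small
  that the used vertices cost little.\<close>

lemma alternative_exists:
  fixes \<delta> lam :: real
  assumes \<delta>: "0 < \<delta>" "\<delta> \<le> 1" and lam: "0 < lam"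
    and super: "lam * (sqrt (2 * \<delta>) + sqrt (1 - \<delta>))\<^sup>2 > 1"
  shows "\<exists>r t c. 0 < t \<and> 0 < c \<and> (\<forall>\<^sub>F n in sequentially. \<forall>xs. distinct xs \<longrightarrow> set xs \<subseteq> {1..n} \<longrightarrow>
     length xs = nat \<lfloor>\<delta> * real n\<rfloor> \<longrightarrow>
     measure_pmf.prob (random_subset (complete_edges n) (lam / real n))
       {G. \<not> (\<exists>S\<in>near_factors n (nat \<lfloor>\<delta> * real n\<rfloor>) r. S \<subseteq> G \<union> cycle_edges xs \<and>
               t * real n \<le> real (card (S - cycle_edges xs)))} \<le> exp (- (c * real n)))"
proof -
  obtain B :: nat and w :: "nat \<Rightarrow> real" and \<eta> :: real where \<eta>: "0 < \<eta>"
    and wpos: "\<And>b. b \<le> B \<Longrightarrow> 0 < w b" and wtop: "w (Suc B) = 0"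
    and grow: "\<And>b. b \<le> B \<Longrightarrow> (1 + \<eta>) * w b \<le> lam * (1 - \<delta>) * w (Suc b) + 2 * lam * \<delta> * (\<Sum>j\<le>b. w j)"
    using weight_exists[OF \<delta> lam super] by blast
  define wmax where "wmax = Max (w ` {..B})"
  define wmin where "wmin = Min (w ` {..B})"
  have wle: "w b \<le> wmax" and wge: "wmin \<le> w b" if "b \<le> B" for b
    using that by (auto simp: wmax_def wmin_def)
  have wmin0: "0 < wmin" unfolding wmin_def using wpos by (subst Min_gr_iff) auto
  have wmax0: "0 < wmax" using wpos[of 0] wle[of 0] by simp
  have wS: "0 \<le> w (Suc b)" "w (Suc b) \<le> wmax" if "b \<le> B" for b
    using that wpos[of "Suc b"] wle[of "Suc b"] wtop wmax0 by (cases "b = B"; force)+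
  define Sig where "Sig = (\<lambda>b. 2 * (\<Sum>j\<le>b. w j))"
  have SigE: "2 * (\<Sum>j\<le>b. w j) = Sig b" for b by (simp add: Sig_def)
  define Gm where "Gm = 2 * (real B + 1) * wmax"
  have Gm0: "0 < Gm" using wmax0 by (simp add: Gm_def)
  have Sig: "0 \<le> Sig b" "Sig b \<le> Gm" if "b \<le> B" for b
  proof -
    show "0 \<le> Sig b" unfolding Sig_def using that wpos by (intro mult_nonneg_nonneg sum_nonneg) (auto intro: less_imp_le)
    have "(\<Sum>j\<le>b. w j) \<le> (\<Sum>j\<le>b. wmax)" using that wle by (intro sum_mono) auto
    also have "\<dots> \<le> (real B + 1) * wmax" using that wmax0 by (simp add: mult_right_mono)
    finally show "Sig b \<le> Gm" by (simp add: Sig_def Gm_def algebra_simps)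
  qed
  have wSG: "w (Suc b) \<le> Gm" if "b \<le> B" for b
  proof -
    have "1 * wmax \<le> 2 * (real B + 1) * wmax" using wmax0 by (intro mult_right_mono) auto
    then show ?thesis using wS(2)[OF that] by (simp add: Gm_def)
  qed
  \<comment> \<open>The growth \<open>\<eta>\<close> is split: one quarter pays for the credit rate,
    one quarter, through \<open>\<xi>\<close>, for used vertices and rounding, and the remaining
    half is the drift \<open>\<zeta>\<close>.\<close>
  define e1 where "e1 = \<eta> / (4 * (1 + \<eta>))"
  have e1: "0 < e1" "e1 < 1" using \<eta> by (auto simp: e1_def field_simps)
  have e1\<eta>: "(1 - e1) * (1 + \<eta>) = 1 + 3 * \<eta> / 4" using \<eta> by (simp add: e1_def field_simps)
  \<comment> \<open>The largest rate for which all possible gains, being at most \<open>Gm\<close>,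
    satisfy the smallness condition of \<open>bernoulli_exp_bound\<close>.\<close>
  define \<theta> where "\<theta> = 2 * e1 / Gm"
  have \<theta>: "0 < \<theta>" using e1 Gm0 by (simp add: \<theta>_def)
  define \<zeta> where "\<zeta> = \<eta> / 2 * wmin"
  have \<zeta>: "0 < \<zeta>" using \<eta> wmin0 by (simp add: \<zeta>_def)
  define \<xi> where "\<xi> = \<eta> / 4 * wmin / (lam * Gm)"
  have \<xi>: "0 < \<xi>" "lam * Gm * \<xi> = \<eta> / 4 * wmin" using \<eta> wmin0 lam Gm0 by (auto simp: \<xi>_def)
  \<comment> \<open>A stack of \<open>2 * (B + 1) * D\<close> nodes of weight \<open>wmax\<close>
    may undo only a quarter of the drift \<open>\<zeta> * \<kappa> * n\<close>.\<close>
  define \<rho> where "\<rho> = \<zeta> / (8 * wmax * (real B + 1))"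
  have B1: "0 < real B + 1" by simp
  have \<rho>: "0 < \<rho>" unfolding \<rho>_def using \<zeta> wmax0 B1 by (intro divide_pos_pos mult_pos_pos) auto
  have \<rho>': "wmax * (2 * (real B + 1)) * \<rho> = \<zeta> / 4"
  proof -
    define q where "q = real B + 1"
    have "q \<noteq> 0" "wmax \<noteq> 0" using wmax0 B1 by (auto simp: q_def)
    then show ?thesis unfolding \<rho>_def q_def[symmetric] by simp
  qed
  define C2 where "C2 = (2 * real B + 5) * (1 + 2 * (real B + 1) * \<rho>)"
  have C2: "0 < C2" using \<rho> by (simp add: C2_def add_pos_pos)
  \<comment> \<open>At most \<open>\<kappa> * C2 * n\<close> vertices are used. The first term keeps
    their effect on the gain below \<open>\<xi>\<close>, the second leaves unblocked cycle vertices
    for new roots.\<close>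
  define \<kappa> where "\<kappa> = min (\<xi> / (2 * C2 * (2 * real B + 6))) (\<delta> / (2 * C2 * (2 * real B + 5)))"
  have B6: "0 < 2 * real B + 6" "0 < 2 * real B + 5" by auto
  have \<kappa>: "0 < \<kappa>" using \<xi> \<delta> C2 by (auto simp: \<kappa>_def)
  have \<kappa>1: "\<kappa> * C2 * (2 * real B + 6) \<le> \<xi> / 2"
  proof -
    have "\<kappa> \<le> \<xi> / (2 * C2 * (2 * real B + 6))" by (simp add: \<kappa>_def)
    then have "\<kappa> * (2 * C2 * (2 * real B + 6)) \<le> \<xi>" using C2 by (subst (asm) pos_le_divide_eq) auto
    then show ?thesis by (simp add: algebra_simps)
  qed
  have \<kappa>2: "\<kappa> * C2 * (2 * real B + 5) \<le> \<delta> / 2"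
  proof -
    have "\<kappa> \<le> \<delta> / (2 * C2 * (2 * real B + 5))" by (simp add: \<kappa>_def)
    then have "\<kappa> * (2 * C2 * (2 * real B + 5)) \<le> \<delta>" using C2 by (subst (asm) pos_le_divide_eq) auto
    then show ?thesis by (simp add: algebra_simps)
  qed
  define \<tau> where "\<tau> = \<kappa> * \<rho>"
  have \<tau>: "0 < \<tau>" using \<kappa> \<rho> by (simp add: \<tau>_def)
  define c0 where "c0 = \<theta> * \<zeta> * \<kappa> / 2"
  have c0: "0 < c0" using \<theta> \<zeta> \<kappa> by (simp add: c0_def)
  \<comment> \<open>Makes \<open>p\<close> at most 1 and absorbs the rounding of \<open>m\<close>,
    \<open>kmax\<close> and \<open>D\<close> as well as the additive loss \<open>B\<close> in
    \<open>fail\<close>.\<close>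
  define bound where "bound = max (max (lam + 1) (2 / \<xi>)) (max (max ((2 * real B + 8) / \<delta>) (4 / \<delta>)) (max (4 / \<kappa>) (2 * (real B + 1) / \<tau>)))"
  have "\<forall>\<^sub>F n in sequentially. bound \<le> real n"
    by real_asymp
  moreover have "measure_pmf.prob (random_subset (complete_edges n) (lam / real n))
       {G. \<not> (\<exists>S\<in>near_factors n (nat \<lfloor>\<delta> * real n\<rfloor>) (2 * B + 4). S \<subseteq> G \<union> cycle_edges xs \<and>
               \<tau> / 2 * real n \<le> real (card (S - cycle_edges xs)))} \<le> exp (- (c0 * real n))"
    if n: "bound \<le> real n" and xs: "distinct xs" "set xs \<subseteq> {1..n}" "length xs = nat \<lfloor>\<delta> * real n\<rfloor>" for n xs
  proof -
    have nb: "lam \<le> real n" "2 / \<xi> \<le> real n" "(2 * real B + 8) / \<delta> \<le> real n" "4 / \<delta> \<le> real n" "4 / \<kappa> \<le> real n"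
      "2 * (real B + 1) / \<tau> \<le> real n"
      using n by (auto simp: bound_def)
    have n0: "0 < real n" using nb(1) lam by linarith
    have nx: "2 \<le> real n * \<xi>" "2 * real B + 8 \<le> real n * \<delta>" "4 \<le> real n * \<delta>" "4 \<le> real n * \<kappa>" "2 * (real B + 1) \<le> real n * \<tau>"
      using nb(2-6) \<xi> \<delta> \<kappa> \<tau> by (simp_all add: pos_divide_le_eq)
    define m where "m = nat \<lfloor>\<delta> * real n\<rfloor>"
    have m: "real m \<le> \<delta> * real n" "\<delta> * real n - 1 \<le> real m"
      using \<delta> unfolding m_def by (auto intro: of_nat_floor)
    define v where "v = (\<lambda>j. xs ! nat (j mod int (length xs)))"
    have m_large: "2 * B + 6 < length xs"
    proof -
      have "2 * real B + 6 < real m" using m nx(2) by (simp add: mult.commute)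
      then show ?thesis using xs(3) m_def by linarith
    qed
    have cyc: "cyclic_graph v m n B" and Hc: "cyclic_graph.H v = cycle_edges xs"
      using cyclic_graph_of_list[OF xs(1,2) m_large] xs(3) unfolding v_def m_def by simp_all
    define p where "p = lam / real n"
    define cr where "cr = (1 - e1) * p"
    define kmax where "kmax = nat \<lfloor>\<kappa> * real n\<rfloor>"
    define D where "D = nat \<lfloor>\<tau> * real n\<rfloor>"
    define smax where "smax = (2 * B + 5) * (kmax + 2 * (B + 1) * D)"
    have p: "0 < p" "p \<le> 1" using lam nb(1) n0 by (auto simp: p_def)
    have kmax: "real kmax \<le> \<kappa> * real n" "\<kappa> * real n - 1 \<le> real kmax"
      using \<kappa> unfolding kmax_def by (auto intro: of_nat_floor)
    have D: "real D \<le> \<tau> * real n" "\<tau> * real n - 1 \<le> real D"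
      using \<tau> unfolding D_def by (auto intro: of_nat_floor)
    have sm: "real smax \<le> \<kappa> * C2 * real n"
    proof -
      have "real smax = (2 * real B + 5) * (real kmax + 2 * (real B + 1) * real D)" by (simp add: smax_def algebra_simps)
      also have "\<dots> \<le> (2 * real B + 5) * (\<kappa> * real n + 2 * (real B + 1) * (\<tau> * real n))"
        using kmax D by (intro mult_left_mono add_mono) auto
      also have "\<dots> = \<kappa> * C2 * real n" by (simp add: C2_def \<tau>_def algebra_simps)
      finally show ?thesis .
    qed
    interpret exploration v m n B w p cr \<theta> \<zeta> "c0 * real n" wmax kmax D smax
    proof (intro exploration.intro cyc exploration_axioms.intro wpos wtop wle)
      show "0 \<le> p" "p \<le> 1" "0 \<le> cr" "0 < \<theta>" "0 \<le> \<zeta>" using p e1 \<theta> \<zeta> by (auto simp: cr_def)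
      have y: "\<theta> * z \<le> 2 * e1" if "z \<le> Gm" for z
      proof -
        have "\<theta> * z \<le> \<theta> * Gm" using that \<theta> by simp
        also have "\<dots> = 2 * e1" using Gm0 by (simp add: \<theta>_def)
        finally show ?thesis .
      qed
      show "1 - p + p * exp (- \<theta> * w (Suc b)) \<le> exp (- \<theta> * (cr * w (Suc b)))" if "b \<le> B" for b
        using bernoulli_exp_bound[of p "\<theta> * w (Suc b)" e1] y[OF wSG[OF that]] wS[OF that] p \<theta>
        by (simp add: cr_def algebra_simps)
      show "1 - p + p * exp (- \<theta> * (2 * (\<Sum>j\<le>b. w j))) \<le> exp (- \<theta> * (cr * (2 * (\<Sum>j\<le>b. w j))))" if "b \<le> B" for b
        using bernoulli_exp_bound[of p "\<theta> * Sig b" e1] y[OF Sig(2)[OF that]] Sig(1)[OF that] p \<theta>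
        unfolding SigE by (simp add: cr_def algebra_simps)
      show "(2 * B + 5) * (kmax + 2 * (B + 1) * D) \<le> smax" by (simp add: smax_def)
      have "real ((2 * B + 5) * smax) = (2 * real B + 5) * real smax" by (simp add: algebra_simps)
      also have "\<dots> \<le> (2 * real B + 5) * (\<kappa> * C2 * real n)" using sm by (intro mult_left_mono) auto
      also have "\<dots> = \<kappa> * C2 * (2 * real B + 5) * real n" by (simp add: algebra_simps)
      also have "\<dots> \<le> \<delta> / 2 * real n" using \<kappa>2 by (intro mult_right_mono) auto
      also have "\<dots> < real m" using m nx(3) by (simp add: algebra_simps)
      finally show "(2 * B + 5) * smax < m" by linarith
      show "c0 * real n \<le> \<theta> * (\<zeta> * real kmax - wmax * real (2 * (B + 1) * D))"
      proof -
        have "wmax * real (2 * (B + 1) * D) = (wmax * (2 * (real B + 1))) * real D" by (simp add: algebra_simps)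
        also have "\<dots> \<le> (wmax * (2 * (real B + 1))) * (\<tau> * real n)" using D wmax0 by (intro mult_left_mono) auto
        also have "\<dots> = (wmax * (2 * (real B + 1)) * \<rho>) * (\<kappa> * real n)" by (simp add: \<tau>_def)
        also have "\<dots> = \<zeta> / 4 * (\<kappa> * real n)" by (simp only: \<rho>')
        finally have 1: "wmax * real (2 * (B + 1) * D) \<le> \<zeta> / 4 * (\<kappa> * real n)" .
        have "\<zeta> * (3 / 4 * (\<kappa> * real n)) \<le> \<zeta> * real kmax"
          using kmax(2) nx(4) \<zeta> by (intro mult_left_mono) (auto simp: algebra_simps)
        with 1 have "\<zeta> / 2 * (\<kappa> * real n) \<le> \<zeta> * real kmax - wmax * real (2 * (B + 1) * D)"
          by (simp add: algebra_simps)
        then have "\<theta> * (\<zeta> / 2 * (\<kappa> * real n)) \<le> \<theta> * (\<zeta> * real kmax - wmax * real (2 * (B + 1) * D))"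
          using \<theta> by (intro mult_left_mono) auto
        then show ?thesis by (simp add: c0_def algebra_simps)
      qed
      show "w b + \<zeta> \<le> cr * ((real n - real m - real s) * w (Suc b) +
          (real m - real ((2 * B + 5) * s)) * (2 * (\<Sum>j\<le>b. w j)))" if b: "b \<le> B" and s: "s \<le> smax" for b s
      proof -
        define Z where "Z = (1 - \<delta>) * w (Suc b) + \<delta> * Sig b"
        have sn: "real s * (2 * real B + 6) + 1 \<le> \<xi> * real n"
        proof -
          have "real s * (2 * real B + 6) \<le> (\<kappa> * C2 * real n) * (2 * real B + 6)"
            using s sm by (intro mult_right_mono) auto
          also have "\<dots> = \<kappa> * C2 * (2 * real B + 6) * real n" by (simp add: algebra_simps)
          also have "\<dots> \<le> \<xi> / 2 * real n" using \<kappa>1 by (intro mult_right_mono) auto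
          finally show ?thesis using nx(1) by (simp add: algebra_simps)
        qed
        have "(real n - real m - real s) * w (Suc b) \<ge> ((1 - \<delta>) * real n - real s) * w (Suc b)"
          using m(1) wS[OF b] by (intro mult_right_mono) (auto simp: algebra_simps)
        moreover have "(real m - real ((2 * B + 5) * s)) * Sig b \<ge> (\<delta> * real n - 1 - real s * (2 * real B + 5)) * Sig b"
          using m(2) Sig[OF b] by (intro mult_right_mono) (auto simp: algebra_simps)
        moreover have "real s * w (Suc b) \<le> real s * Gm" using wSG[OF b] by (intro mult_left_mono) auto
        moreover have "(1 + real s * (2 * real B + 5)) * Sig b \<le> (1 + real s * (2 * real B + 5)) * Gm"
          using Sig(2)[OF b] by (intro mult_left_mono) auto
        ultimately have "real n * Z - (real s * (2 * real B + 6) + 1) * Gm \<le>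
          (real n - real m - real s) * w (Suc b) + (real m - real ((2 * B + 5) * s)) * Sig b"
          by (simp add: Z_def algebra_simps)
        moreover have "(real s * (2 * real B + 6) + 1) * Gm \<le> (\<xi> * real n) * Gm"
          using sn Gm0 by (intro mult_right_mono) auto
        ultimately have "real n * (Z - \<xi> * Gm) \<le> (real n - real m - real s) * w (Suc b) + (real m - real ((2 * B + 5) * s)) * Sig b"
          by (simp add: algebra_simps)
        then have "cr * (real n * (Z - \<xi> * Gm)) \<le> cr * ((real n - real m - real s) * w (Suc b) + (real m - real ((2 * B + 5) * s)) * Sig b)"
          using p e1 by (intro mult_left_mono) (auto simp: cr_def)
        moreover have "cr * (real n * (Z - \<xi> * Gm)) = (1 - e1) * (lam * Z) - (1 - e1) * (\<eta> / 4 * wmin)"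
        proof -
          have "cr * (real n * (Z - \<xi> * Gm)) = (1 - e1) * (lam * Z - lam * Gm * \<xi>)"
          proof -
            have "p * real n = lam" using n0 by (simp add: p_def)
            then have "cr * (real n * (Z - \<xi> * Gm)) = (1 - e1) * (lam * (Z - \<xi> * Gm))"
              by (simp add: cr_def mult.assoc flip: mult.assoc[of p])
            then show ?thesis by (simp add: algebra_simps)
          qed
          then show ?thesis unfolding \<xi>(2) by (simp add: right_diff_distrib)
        qed
        moreover have "(1 - e1) * ((1 + \<eta>) * w b) \<le> (1 - e1) * (lam * Z)"
          using grow[OF b] e1 by (intro mult_left_mono) (auto simp: Z_def Sig_def algebra_simps)
        moreover have "(1 - e1) * ((1 + \<eta>) * w b) = w b + 3 / 4 * (\<eta> * w b)"
          unfolding mult.assoc[symmetric] e1\<eta> by (simp add: algebra_simps)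
        moreover have "(1 - e1) * (\<eta> / 4 * wmin) \<le> 1 * (\<eta> / 4 * wmin)"
          using e1 \<eta> wmin0 by (intro mult_right_mono) auto
        moreover have "\<eta> * wmin \<le> \<eta> * w b" using \<eta> wge[OF b] by (intro mult_left_mono) auto
        moreover have "\<zeta> = 1 / 2 * (\<eta> * wmin)" "\<eta> / 4 * wmin = 1 / 4 * (\<eta> * wmin)" by (simp_all add: \<zeta>_def)
        ultimately show ?thesis unfolding SigE by linarith
      qed
    qed
    have "measure_pmf.prob (random_subset (complete_edges n) p)
       {G. \<not> (\<exists>S\<in>near_factors n m (2 * B + 4). S \<subseteq> G \<union> cycle_edges xs \<and>
               \<tau> / 2 * real n \<le> real (card (S - cycle_edges xs)))} \<le>
       measure_pmf.prob (random_subset (complete_edges n) p) {G. fail G}"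
    proof (intro measure_pmf.finite_measure_mono subsetI CollectI)
      fix G assume "G \<in> {G. \<not> (\<exists>S\<in>near_factors n m (2 * B + 4). S \<subseteq> G \<union> cycle_edges xs \<and>
               \<tau> / 2 * real n \<le> real (card (S - cycle_edges xs)))}"
      then have no: "\<not> (\<tau> / 2 * real n \<le> real (card (S - cycle_edges xs)))"
        if "S \<in> near_factors n m (2 * B + 4)" "S \<subseteq> G \<union> cycle_edges xs" for S using that by blast
      show "fail G" unfolding fail_def
      proof
        assume "\<exists>S\<in>near_factors n m (2 * B + 4). S \<subseteq> G \<union> H \<and> D \<le> card (S - H) + B"
        then obtain S where S: "S \<in> near_factors n m (2 * B + 4)" "S \<subseteq> G \<union> cycle_edges xs"
          "D \<le> card (S - cycle_edges xs) + B" unfolding Hc by blast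
        have "\<tau> / 2 * real n \<le> real D - real B" using D(2) nx(5) by (simp add: algebra_simps)
        also have "\<dots> \<le> real (card (S - cycle_edges xs))" using S(3) by linarith
        finally show False using no[OF S(1,2)] by blast
      qed
    qed auto
    also have "\<dots> \<le> exp (- (c0 * real n))" using prob_fail by simp
    finally show ?thesis unfolding p_def m_def .
  qed
  ultimately have "\<forall>\<^sub>F n in sequentially. \<forall>xs. distinct xs \<longrightarrow> set xs \<subseteq> {1..n} \<longrightarrow> length xs = nat \<lfloor>\<delta> * real n\<rfloor> \<longrightarrow>
     measure_pmf.prob (random_subset (complete_edges n) (lam / real n))
       {G. \<not> (\<exists>S\<in>near_factors n (nat \<lfloor>\<delta> * real n\<rfloor>) (2 * B + 4). S \<subseteq> G \<union> cycle_edges xs \<and>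
               \<tau> / 2 * real n \<le> real (card (S - cycle_edges xs)))} \<le> exp (- (c0 * real n))"
    by (elim eventually_mono) blast
  then show ?thesis using \<tau> c0
    by (intro exI[of _ "2 * B + 4"] exI[of _ "\<tau> / 2"] exI[of _ c0] conjI) simp_all
qed

subsection \<open>Counting small sets\<close>

text \<open>Give each subset \<open>T\<close> the weight \<open>x ^ card T\<close>: the small ones
  weigh at least \<open>x ^ s\<close> each, and all together weigh
  \<open>(1 + x) ^ card A\<close>.\<close>

lemma card_small_subsets_le:
  fixes x :: real
  assumes "finite A" "0 < x" "x \<le> 1"
  shows "real (card {T. T \<subseteq> A \<and> card T \<le> s}) \<le> (1 / x) ^ s * (1 + x) ^ card A"
proof -
  have sum: "(\<Sum>T\<in>Pow A. x ^ card T) = (1 + x) ^ card A"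
    using assms(1)
  proof (induction A rule: finite_induct)
    case (insert a A)
    have "(\<Sum>T\<in>insert a ` Pow A. x ^ card T) = (\<Sum>T\<in>Pow A. x ^ card (insert a T))"
      using insert(2) by (intro sum.reindex_cong[of "insert a"]) (auto simp: inj_on_def)
    also have "\<dots> = (\<Sum>T\<in>Pow A. x * x ^ card T)"
    proof (intro sum.cong refl)
      fix T assume "T \<in> Pow A"
      then have "finite T" "a \<notin> T" using insert(1,2) finite_subset by auto
      then show "x ^ card (insert a T) = x * x ^ card T" by simp
    qed
    finally have "(\<Sum>T\<in>insert a ` Pow A. x ^ card T) = x * (1 + x) ^ card A"
      using insert.IH by (simp flip: sum_distrib_left)
    moreover have "(\<Sum>T\<in>Pow (insert a A). x ^ card T) = (\<Sum>T\<in>Pow A. x ^ card T) + (\<Sum>T\<in>insert a ` Pow A. x ^ card T)"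
      unfolding Pow_insert using insert(1,2) by (intro sum.union_disjoint) auto
    ultimately show ?case using insert by (simp add: algebra_simps)
  qed simp
  have "real (card {T. T \<subseteq> A \<and> card T \<le> s}) * x ^ s = (\<Sum>T\<in>{T. T \<subseteq> A \<and> card T \<le> s}. x ^ s)" by simp
  also have "\<dots> \<le> (\<Sum>T\<in>{T. T \<subseteq> A \<and> card T \<le> s}. x ^ card T)"
    using assms by (intro sum_mono power_decreasing) auto
  also have "\<dots> \<le> (\<Sum>T\<in>Pow A. x ^ card T)" using assms by (intro sum_mono2) auto
  finally show ?thesis using sum assms(2) by (simp add: power_divide field_simps)
qed

text \<open>The case \<open>x = 1 / N\<close>, where the last factor is at most
  \<open>exp 1\<close>.\<close>

lemma card_small_subsets_poly:
  assumes "finite A" "card A \<le> N" "0 < N"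
  shows "real (card {T. T \<subseteq> A \<and> card T \<le> s}) \<le> 3 * real N ^ s"
proof -
  have "(1 + 1 / real N) ^ N \<le> exp (1 / real N) ^ N"
    by (intro power_mono exp_ge_add_one_self) auto
  also have "exp (1 / real N) ^ N = exp 1" using assms by (simp flip: exp_of_nat_mult)
  also have "exp 1 \<le> (3::real)" by (rule exp_le)
  finally have e: "(1 + 1 / real N) ^ N \<le> 3" .
  have "real (card {T. T \<subseteq> A \<and> card T \<le> s}) \<le> (1 / (1 / real N)) ^ s * (1 + 1 / real N) ^ card A"
    using assms by (intro card_small_subsets_le) auto
  also have "\<dots> \<le> real N ^ s * (1 + 1 / real N) ^ N"
    using assms by (intro mult_mono power_increasing) auto
  also have "\<dots> \<le> real N ^ s * 3" using e by (intro mult_left_mono) auto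
  finally show ?thesis by (simp add: mult.commute)
qed

subsection \<open>Graphs with a given degree sequence\<close>

text \<open>A list of \<open>m\<close> edges together with a set of reversed edges is written as a word of \<open>2m\<close>
  vertices; this embeds the edge orderings of all graphs with a given degree sequence into the
  permutations of a multiset.\<close>

definition word :: "graph \<Rightarrow> nat set list \<Rightarrow> nat list" where
  "word T es = concat (map (\<lambda>e. if e \<in> T then [Max e, Min e] else [Min e, Max e]) es)"

lemma word_Cons: "word T (e # es) = (if e \<in> T then [Max e, Min e] else [Min e, Max e]) @ word T es"
  by (simp add: word_def)

lemma doubleton_Min_Max:
  assumes "card (e :: nat set) = 2"
  shows "e = {Min e, Max e}" "Min e < Max e" "mset_set e = {#Min e, Max e#}"
proof -
  obtain a b where e: "e = {a, b}" "a \<noteq> b" using assms by (meson card_2_iff)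
  show 1: "e = {Min e, Max e}" "Min e < Max e" using e by (auto simp: min_def max_def)
  then have "mset_set e = mset_set {Min e, Max e}" by metis
  also have "\<dots> = {#Min e, Max e#}" using 1(2) by simp
  finally show "mset_set e = {#Min e, Max e#}" .
qed

text \<open>Letters are read in pairs: each pair gives back its edge, and the order of its two
  letters tells whether the edge lies in \<open>T\<close>.\<close>

lemma word_inj:
  assumes "\<forall>e\<in>set es. card e = 2" "\<forall>e\<in>set es'. card e = 2" "word T es = word T' es'"
  shows "es = es' \<and> T \<inter> set es = T' \<inter> set es'"
  using assms
proof (induction es arbitrary: es')
  case Nil
  then show ?case by (cases es') (auto simp: word_def split: if_splits)
next
  case (Cons e es)
  then obtain e' es'' where es': "es' = e' # es''" by (cases es') (auto simp: word_def split: if_splits)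
  have c: "card e = 2" "card e' = 2" using Cons.prems es' by auto
  have eq: "(if e \<in> T then [Max e, Min e] else [Min e, Max e]) = (if e' \<in> T' then [Max e', Min e'] else [Min e', Max e'])"
    and rest: "word T es = word T' es''"
    using Cons.prems(3) unfolding es' word_Cons by (auto split: if_splits)
  have "e = e' \<and> (e \<in> T \<longleftrightarrow> e' \<in> T')"
    using eq doubleton_Min_Max(1,2)[OF c(1)] doubleton_Min_Max(1,2)[OF c(2)] by (auto split: if_splits)
  moreover have "es = es'' \<and> T \<inter> set es = T' \<inter> set es''"
    using Cons.prems es' rest by (intro Cons.IH) auto
  ultimately show ?case unfolding es' by auto
qed

lemma mset_word:
  assumes "\<forall>e\<in>set es. card e = 2"
  shows "mset (word T es) = (\<Sum>e\<leftarrow>es. mset_set e)"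
  using assms
proof (induction es)
  case (Cons e es)
  then have "mset_set e = {#Min e, Max e#}" by (intro doubleton_Min_Max) auto
  then show ?case using Cons by (simp add: word_Cons)
qed (simp add: word_def)

lemma count_mset_word:
  assumes "\<forall>e\<in>set es. card e = 2" "distinct es"
  shows "count (mset (word T es)) x = deg (set es) x"
proof -
  have "count (mset (word T es)) x = (\<Sum>e\<leftarrow>es. count (mset_set e) x)"
    unfolding mset_word[OF assms(1)] by (induction es) auto
  also have "\<dots> = (\<Sum>e\<in>set es. count (mset_set e) x)" using assms(2) by (rule sum_list_distinct_conv_sum_set)
  also have "\<dots> = (\<Sum>e\<in>set es. if x \<in> e then 1 else 0)"
    using assms(1) by (intro sum.cong refl) (metis card.infinite count_mset_set(1,3) zero_neq_numeral)
  also have "\<dots> = deg (set es) x" by (simp add: deg_def sum.If_cases Int_def)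
  finally show ?thesis .
qed

lemma length_word: "length (word T es) = 2 * length es"
  by (induction es) (auto simp: word_def)

lemma sum_deg:
  assumes "S \<subseteq> complete_edges n"
  shows "(\<Sum>x\<in>{1..n}. deg S x) = 2 * card S"
proof -
  have fin: "finite S" using assms finite_subset finite_imp_finite_nsets by (metis finite_atLeastAtMost)
  have "(\<Sum>x\<in>{1..n}. deg S x) = (\<Sum>x\<in>{1..n}. \<Sum>e\<in>S. if x \<in> e then 1 else 0)"
    using fin by (simp add: deg_def sum.If_cases Int_def)
  also have "\<dots> = (\<Sum>e\<in>S. \<Sum>x\<in>{1..n}. if x \<in> e then 1 else 0)" by (rule sum.swap)
  also have "\<dots> = (\<Sum>e\<in>S. 2)"
  proof (intro sum.cong refl)
    fix e assume "e \<in> S"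
    then have "e \<subseteq> {1..n}" "card e = 2" using assms by (auto simp: nsets_def)
    then show "(\<Sum>x\<in>{1..n}. if x \<in> e then 1 else 0) = (2::nat)"
      by (simp add: sum.If_cases Int_absorb1)
  qed
  finally show ?thesis by simp
qed

text \<open>Each graph gives \<open>fact m * 2 ^ m\<close> words, all of them arrangements of one
  multiset of \<open>2 * m\<close> letters in which \<open>k\<close> vertices occur exactly twice;
  so there are at most \<open>fact (2 * m) / 2 ^ k\<close> words. With
  \<open>fact (2 * m) \<le> 4 ^ m * (fact m * fact m)\<close> this leaves
  \<open>fact m * 2 ^ m / 2 ^ k\<close> graphs.\<close>

lemma card_graphs_with_degrees:
  assumes d2: "k = card {x \<in> {1..n}. d x = 2}" and km: "m \<le> k + j"
  shows "real (card {S. S \<subseteq> complete_edges n \<and> card S = m \<and> (\<forall>x. deg S x = d x)}) \<le> fact m * 2 ^ j"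
proof -
  define F where "F = {S. S \<subseteq> complete_edges n \<and> card S = m \<and> (\<forall>x. deg S x = d x)}"
  have finE: "finite (complete_edges n)" by (simp add: finite_imp_finite_nsets)
  have finF: "finite F" unfolding F_def by (rule finite_subset[of _ "Pow (complete_edges n)"]) (use finE in auto)
  show ?thesis
  proof (cases "F = {}")
    case True
    then show ?thesis unfolding F_def[symmetric] by simp
  next
    case False
    have S: "finite S" "card S = m" "\<forall>e\<in>S. card e = 2" "\<forall>x. deg S x = d x" if "S \<in> F" for S
    proof -
      have sub: "S \<subseteq> complete_edges n" using that by (simp add: F_def)
      show "finite S" using finite_subset[OF sub finE] .
      show "\<forall>e\<in>S. card e = 2" using sub by (auto simp: nsets_def)
      show "card S = m" "\<forall>x. deg S x = d x" using that by (simp_all add: F_def)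
    qed
    from False obtain S0 where S0: "S0 \<in> F" by blast
    obtain es0 where es0: "set es0 = S0" "distinct es0" using finite_distinct_list S(1)[OF S0] by blast
    define M where "M = mset (word {} es0)"
    have cM: "count M x = d x" for x
      unfolding M_def using count_mset_word[of es0 "{}" x] es0 S[OF S0] by simp
    have sizeM: "size M = 2 * m"
      using es0 S(2)[OF S0] by (simp add: M_def length_word distinct_card[symmetric])
    define D where "D = (SIGMA S:F. permutations_of_set S \<times> Pow S)"
    have "(\<lambda>(S, es, T). word T es) ` D \<subseteq> permutations_of_multiset M"
    proof clarify
      fix S es T assume "(S, es, T) \<in> D"
      then have *: "S \<in> F" "set es = S" "distinct es" by (auto simp: D_def permutations_of_set_def)
      have "mset (word T es) = M"
        using * S[OF *(1)] cM by (intro multiset_eqI) (simp add: count_mset_word)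
      then show "word T es \<in> permutations_of_multiset M" by (rule permutations_of_multisetI)
    qed
    moreover have "inj_on (\<lambda>(S, es, T). word T es) D"
    proof (rule inj_onI)
      fix z z' assume z: "z \<in> D" "z' \<in> D" "(case z of (S, es, T) \<Rightarrow> word T es) = (case z' of (S, es, T) \<Rightarrow> word T es)"
      obtain S es T S' es' T' where zz: "z = (S, es, T)" "z' = (S', es', T')" by (metis prod_cases3)
      have a: "(S, es, T) \<in> D" "(S', es', T') \<in> D" "word T es = word T' es'"
        using z by (simp_all add: zz)
      from a(1,2) have *: "S \<in> F" "set es = S" "T \<subseteq> S" "S' \<in> F" "set es' = S'" "T' \<subseteq> S'"
        by (auto simp: D_def permutations_of_set_def)
      have "es = es' \<and> T \<inter> set es = T' \<inter> set es'"
        using * S[OF *(1)] S[OF *(4)] a(3) by (intro word_inj) auto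
      then show "z = z'" unfolding zz using * by auto
    qed
    ultimately have "card D \<le> card (permutations_of_multiset M)"
      by (intro card_inj_on_le) auto
    moreover have "card D = card F * (fact m * 2 ^ m)"
    proof -
      have "card D = (\<Sum>S\<in>F. card (permutations_of_set S \<times> Pow S))"
        unfolding D_def using finF S(1) by (intro card_SigmaI) auto
      also have "\<dots> = (\<Sum>S\<in>F. fact m * 2 ^ m)"
        using S by (intro sum.cong refl) (simp add: card_cartesian_product card_Pow)
      finally show ?thesis by simp
    qed
    ultimately have c1: "card F * (fact m * 2 ^ m) \<le> card (permutations_of_multiset M)" by simp
    have c2: "card (permutations_of_multiset M) * (\<Prod>x\<in>set_mset M. fact (count M x)) = fact (2 * m)"
      using card_permutations_of_multiset_aux[of M] sizeM by simp
    have c3: "2 ^ k \<le> (\<Prod>x\<in>set_mset M. fact (count M x) :: nat)"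
    proof -
      have sub: "{x \<in> {1..n}. d x = 2} \<subseteq> set_mset M"
      proof
        fix x assume "x \<in> {x \<in> {1..n}. d x = 2}"
        then have "count M x = 2" using cM by simp
        then show "x \<in># M" by (intro count_inI) simp
      qed
      have "(2::nat) ^ k = (\<Prod>x\<in>{x \<in> {1..n}. d x = 2}. fact (count M x))"
        unfolding d2 by (simp add: cM)
      also have "\<dots> \<le> (\<Prod>x\<in>set_mset M. fact (count M x))"
        using sub by (intro dvd_imp_le prod_dvd_prod_subset) (auto intro!: Nat.gr0I)
      finally show ?thesis .
    qed
    have c4: "fact (2 * m) \<le> 4 ^ m * (fact m * fact m :: nat)"
    proof -
      have "fact (2 * m) = fact m * fact m * (2 * m choose m)"
        using binomial_fact_lemma[of m "2 * m"] by (simp add: mult_2)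
      also have "(2 * m choose m) \<le> 2 ^ (2 * m)" by (rule binomial_le_pow2)
      also have "(2::nat) ^ (2 * m) = 4 ^ m" by (simp add: power_mult)
      finally show ?thesis by (simp add: mult.commute)
    qed
    have "card F * (fact m * 2 ^ m) * 2 ^ k \<le> card (permutations_of_multiset M) * (\<Prod>x\<in>set_mset M. fact (count M x))"
      using c1 c3 by (rule mult_le_mono)
    also have "\<dots> \<le> 4 ^ m * (fact m * fact m)" using c2 c4 by simp
    also have "(4::nat) ^ m = 2 ^ m * 2 ^ m" by (simp flip: power_mult_distrib)
    finally have "(fact m * 2 ^ m) * (card F * 2 ^ k) \<le> (fact m * 2 ^ m) * (fact m * (2::nat) ^ m)"
      by (simp add: mult_ac)
    then have "card F * 2 ^ k \<le> fact m * (2::nat) ^ m" by simp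
    also have "\<dots> \<le> fact m * 2 ^ (k + j)" using km by (intro mult_le_mono2 power_increasing) auto
    finally have "card F * 2 ^ k \<le> (fact m * 2 ^ j) * (2::nat) ^ k" by (simp add: power_add mult_ac)
    then have "card F \<le> fact m * 2 ^ j" by simp
    then have "real (card F) \<le> real (fact m * 2 ^ j)" by (rule of_nat_mono)
    then show ?thesis unfolding F_def[symmetric] by simp
  qed
qed

text \<open>It remains to count degree sequences. The number of vertices of degree 2 lies between
  \<open>m - 2 * r\<close> and \<open>m\<close>. Padding them to exactly \<open>m\<close> makes
  \<open>n choose m\<close> the main factor, as in the number of \<open>m\<close>-cycles; the
  padding and the exceptional degrees cost only powers of \<open>n\<close>.\<close>

lemma card_near_factors:
  assumes n: "0 < n" and mn: "m \<le> n"
  shows "real (card (near_factors n m r)) \<le>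
    fact m * 4 ^ r * (real (n choose m) * (3 * real n ^ (2 * r)) * (3 * real (5 * n) ^ r))"
proof -
  define F where "F = near_factors n m r"
  have finE: "finite (complete_edges n)" by (simp add: finite_imp_finite_nsets)
  have finF: "finite F" unfolding F_def near_factors_def
    by (rule finite_subset[of _ "Pow (complete_edges n)"]) (use finE in auto)
  define Df where "Df = deg ` F"
  have finD: "finite Df" using finF by (simp add: Df_def)
  have outside: "d x = 0" if h: "d \<in> Df" "x \<notin> {1..n}" for d x
  proof -
    obtain S where S: "S \<subseteq> complete_edges n" "d = deg S" using h(1) by (auto simp: Df_def F_def near_factors_def)
    then have "\<Union>S \<subseteq> {1..n}" by (auto simp: nsets_def)
    then show ?thesis unfolding S(2) using h(2) by (intro deg_eq_0) blast
  qed
  define D2 where "D2 = (\<lambda>d::nat\<Rightarrow>nat. {x \<in> {1..n}. d x = 2})"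
  define Ex where "Ex = (\<lambda>d::nat\<Rightarrow>nat. {(x, i). x \<in> {1..n} \<and> i = d x \<and> d x \<noteq> 0 \<and> d x \<noteq> 2})"
  have facts: "card (D2 d) \<le> m" "m \<le> card (D2 d) + 2 * r" "Ex d \<subseteq> {1..n} \<times> {..4}" "card (Ex d) \<le> r"
    if h: "d \<in> Df" for d
  proof -
    obtain S where S: "S \<in> F" "d = deg S" using h by (auto simp: Df_def)
    have SE: "S \<subseteq> complete_edges n" "card S = m" "\<And>x. deg S x \<le> 4"
      "card {x \<in> {1..n}. deg S x \<noteq> 0 \<and> deg S x \<noteq> 2} \<le> r"
      using S(1) by (auto simp: F_def near_factors_def)
    define X where "X = {x \<in> {1..n}. d x \<noteq> 0 \<and> d x \<noteq> 2}"
    have cX: "card X \<le> r" using SE(4) S(2) by (simp add: X_def)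
    have "(\<Sum>x\<in>{1..n}. d x) = (\<Sum>x\<in>D2 d \<union> X. d x)"
      by (intro sum.mono_neutral_right) (auto simp: D2_def X_def)
    also have "\<dots> = (\<Sum>x\<in>D2 d. d x) + (\<Sum>x\<in>X. d x)"
      by (intro sum.union_disjoint) (auto simp: D2_def X_def)
    also have "(\<Sum>x\<in>D2 d. d x) = 2 * card (D2 d)" by (simp add: D2_def)
    finally have eq: "2 * m = 2 * card (D2 d) + (\<Sum>x\<in>X. d x)" using sum_deg[OF SE(1)] SE(2) S(2) by simp
    have "(\<Sum>x\<in>X. d x) \<le> (\<Sum>x\<in>X. 4)" using SE(3) S(2) by (intro sum_mono) auto
    then have "(\<Sum>x\<in>X. d x) \<le> 4 * r" using cX by simp
    then show "card (D2 d) \<le> m" "m \<le> card (D2 d) + 2 * r" using eq by linarith+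
    have "Ex d = (\<lambda>x. (x, d x)) ` X" by (auto simp: Ex_def X_def)
    then show "card (Ex d) \<le> r" using cX card_image_le[of X "\<lambda>x. (x, d x)"] by (simp add: X_def)
    show "Ex d \<subseteq> {1..n} \<times> {..4}" using SE(3) S(2) by (auto simp: Ex_def)
  qed
  have "\<forall>d\<in>Df. \<exists>W. D2 d \<subseteq> W \<and> W \<subseteq> {1..n} \<and> card W = m"
  proof
    fix d assume "d \<in> Df"
    then have c: "card (D2 d) \<le> m" by (rule facts(1))
    have "D2 d \<subseteq> {1..n}" by (auto simp: D2_def)
    then obtain W where "D2 d \<subseteq> W" "W \<subseteq> {1..n}" "card W = m"
      using exists_subset_between[of "D2 d" m "{1..n}"] c mn by auto
    then show "\<exists>W. D2 d \<subseteq> W \<and> W \<subseteq> {1..n} \<and> card W = m" by blast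
  qed
  from bchoice[OF this] obtain W
    where W: "\<And>d. d \<in> Df \<Longrightarrow> D2 d \<subseteq> W d \<and> W d \<subseteq> {1..n} \<and> card (W d) = m" by blast
  define code where "code = (\<lambda>d. (W d, W d - D2 d, Ex d))"
  define T where "T = [{1..n}]\<^bsup>m\<^esup> \<times> {J. J \<subseteq> {1..n} \<and> card J \<le> 2 * r} \<times> {P. P \<subseteq> {1..n} \<times> {..4::nat} \<and> card P \<le> r}"
  have finT: "finite T" unfolding T_def by (intro finite_cartesian_product) (auto simp: finite_imp_finite_nsets)
  have "code ` Df \<subseteq> T"
  proof
    fix c assume "c \<in> code ` Df"
    then obtain d where d: "d \<in> Df" "c = code d" by blast
    have finW: "finite (W d)" "finite (D2 d)" using W[OF d(1)] finite_subset by (auto simp: D2_def)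
    have "card (W d - D2 d) \<le> 2 * r" using W[OF d(1)] facts(2)[OF d(1)] finW by (simp add: card_Diff_subset)
    then show "c \<in> T" using d W[OF d(1)] facts[OF d(1)] finW by (auto simp: code_def T_def nsets_def)
  qed
  moreover have "inj_on code Df"
  proof (rule inj_onI, rule ext)
    fix d d' x assume d: "d \<in> Df" "d' \<in> Df" "code d = code d'"
    have "D2 d = W d - (W d - D2 d)" "D2 d' = W d' - (W d' - D2 d')" using W d by blast+
    moreover have "W d = W d'" "W d - D2 d = W d' - D2 d'"
      using d(3) unfolding code_def prod.inject by blast+
    ultimately have 1: "D2 d = D2 d'" by metis
    have 2: "Ex d = Ex d'" using d(3) by (simp add: code_def)
    show "d x = d' x"
    proof (cases "x \<in> {1..n}")
      case False
      then show ?thesis using outside[OF d(1)] outside[OF d(2)] by metis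
    next
      case True
      have a: "d x = 2 \<longleftrightarrow> d' x = 2" using 1 True by (auto simp: D2_def)
      have b: "(x, d x) \<in> Ex d \<longleftrightarrow> (x, d x) \<in> Ex d'" "(x, d' x) \<in> Ex d \<longleftrightarrow> (x, d' x) \<in> Ex d'" using 2 by simp_all
      show ?thesis using a b True unfolding Ex_def by auto
    qed
  qed
  ultimately have "card Df \<le> card T" using finT by (metis card_image card_mono)
  then have "real (card Df) \<le> real (card T)" by simp
  also have "\<dots> = real (n choose m) * (real (card {J. J \<subseteq> {1..n} \<and> card J \<le> 2 * r}) * real (card {P. P \<subseteq> {1..n} \<times> {..4::nat} \<and> card P \<le> r}))"
    unfolding T_def by (simp add: card_cartesian_product)
  also have "\<dots> \<le> real (n choose m) * ((3 * real n ^ (2 * r)) * (3 * real (5 * n) ^ r))"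
    using n by (intro mult_left_mono mult_mono card_small_subsets_poly) (auto simp: card_cartesian_product)
  finally have cD: "real (card Df) \<le> real (n choose m) * (3 * real n ^ (2 * r)) * (3 * real (5 * n) ^ r)"
    by (simp add: mult.assoc)
  have "F = (\<Union>d\<in>Df. {S \<in> F. deg S = d})" by (auto simp: Df_def)
  then have "card F = card (\<Union>d\<in>Df. {S \<in> F. deg S = d})" by (rule arg_cong)
  also have "\<dots> \<le> (\<Sum>d\<in>Df. card {S \<in> F. deg S = d})" by (rule card_UN_le[OF finD])
  finally have "card F \<le> (\<Sum>d\<in>Df. card {S \<in> F. deg S = d})" .
  then have "real (card F) \<le> real (\<Sum>d\<in>Df. card {S \<in> F. deg S = d})" by (rule of_nat_mono)
  also have "\<dots> = (\<Sum>d\<in>Df. real (card {S \<in> F. deg S = d}))" by simp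
  also have "\<dots> \<le> (\<Sum>d\<in>Df. fact m * 2 ^ (2 * r))"
  proof (intro sum_mono)
    fix d assume d: "d \<in> Df"
    have "real (card {S \<in> F. deg S = d}) \<le> real (card {S. S \<subseteq> complete_edges n \<and> card S = m \<and> (\<forall>x. deg S x = d x)})"
    proof (intro of_nat_mono card_mono)
      show "finite {S. S \<subseteq> complete_edges n \<and> card S = m \<and> (\<forall>x. deg S x = d x)}"
        by (rule finite_subset[of _ "Pow (complete_edges n)"]) (use finE in auto)
    qed (auto simp: F_def near_factors_def)
    also have "\<dots> \<le> fact m * 2 ^ (2 * r)"
      using facts(2)[OF d] by (intro card_graphs_with_degrees[OF refl]) (simp add: D2_def)
    finally show "real (card {S \<in> F. deg S = d}) \<le> fact m * 2 ^ (2 * r)" .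
  qed
  also have "\<dots> = fact m * 4 ^ r * real (card Df)" by (simp add: power_mult)
  also have "\<dots> \<le> fact m * 4 ^ r * (real (n choose m) * (3 * real n ^ (2 * r)) * (3 * real (5 * n) ^ r))"
    using cD by (intro mult_left_mono) auto
  finally show ?thesis unfolding F_def .
qed

section \<open>Probabilities under compound distributions\<close>

lemma prob_bind_pmf:
  "measure_pmf.prob (M \<bind> f) X = measure_pmf.expectation M (\<lambda>x. measure_pmf.prob (f x) X)"
proof -
  have "integrable (measure_pmf M) (\<lambda>x. measure_pmf.prob (f x) X)"
    by (rule measure_pmf.integrable_const_bound[of _ 1]) auto
  then have "emeasure (measure_pmf (M \<bind> f)) X = ennreal (measure_pmf.expectation M (\<lambda>x. measure_pmf.prob (f x) X))"
    unfolding emeasure_bind_pmf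
    unfolding measure_pmf.emeasure_eq_measure by (rule nn_integral_eq_integral) auto
  then show ?thesis
    unfolding measure_pmf.emeasure_eq_measure
    by (subst (asm) ennreal_inj) (auto intro: integral_nonneg_AE)
qed

lemma prob_bind_pmf_sum:
  assumes "finite A" "set_pmf M \<subseteq> A"
  shows "measure_pmf.prob (M \<bind> f) X = (\<Sum>a\<in>A. pmf M a * measure_pmf.prob (f a) X)"
  unfolding prob_bind_pmf using assms by (subst integral_measure_pmf_real[of A]) (auto simp: mult.commute)

lemma prob_bind_pmf_of_set:
  assumes "finite A" "A \<noteq> {}"
  shows "measure_pmf.prob (pmf_of_set A \<bind> f) X = (\<Sum>a\<in>A. measure_pmf.prob (f a) X) / real (card A)"
  unfolding prob_bind_pmf using assms by (simp add: integral_pmf_of_set)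

subsection \<open>Many alternatives by thinning\<close>

text \<open>A graph with few alternatives \<open>S\<close> loses all of them under thinning with probability at
  least \<open>1/2\<close>, by the union bound.\<close>

lemma many_alternatives:
  assumes pq: "0 \<le> p" "p \<le> 1" "0 \<le> q" "q \<le> 1" and fin: "finite E" "finite F" "\<And>S. S \<in> F \<Longrightarrow> finite S"
    and thin: "measure_pmf.prob (random_subset E (p * q)) {G. \<not> (\<exists>S\<in>F. S \<subseteq> G \<union> H \<and> L \<le> card (S - H))} \<le> \<beta>"
    and A: "A * q ^ L \<le> 1 / 2"
  shows "measure_pmf.prob (random_subset E p) {G. real (card {S \<in> F. S \<subseteq> G \<union> H}) < A} \<le> 2 * \<beta>"
proof -
  define X where "X = {G. \<not> (\<exists>S\<in>F. S \<subseteq> G \<union> H \<and> L \<le> card (S - H))}"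
  define Y where "Y = {G. real (card {S \<in> F. S \<subseteq> G \<union> H}) < A}"
  have half: "1 / 2 \<le> measure_pmf.prob (random_subset G q) X" if G: "G \<in> Y" "finite G" for G
  proof -
    define Z where "Z = {S \<in> F. S \<subseteq> G \<union> H \<and> L \<le> card (S - H)}"
    have finZ: "finite Z" using fin(2) by (simp add: Z_def)
    have "card Z \<le> card {S \<in> F. S \<subseteq> G \<union> H}" unfolding Z_def using fin(2) by (intro card_mono) auto
    then have cZ: "real (card Z) \<le> A" using G(1) by (simp add: Y_def)
    have "measure_pmf.prob (random_subset G q) (- X) \<le> measure_pmf.prob (random_subset G q) (\<Union>S\<in>Z. {T. S - H \<subseteq> T})"
    proof (rule measure_pmf.finite_measure_mono_AE)
      show "AE T in random_subset G q. T \<in> - X \<longrightarrow> T \<in> (\<Union>S\<in>Z. {T. S - H \<subseteq> T})"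
        using set_random_subset[OF G(2), of q] by (auto simp: AE_measure_pmf_iff X_def Z_def)
    qed simp
    also have "\<dots> \<le> (\<Sum>S\<in>Z. measure_pmf.prob (random_subset G q) {T. S - H \<subseteq> T})"
      using finZ by (intro measure_pmf.finite_measure_subadditive_finite) auto
    also have "\<dots> \<le> (\<Sum>S\<in>Z. q ^ L)"
    proof (rule sum_mono)
      fix S assume S: "S \<in> Z"
      then have "measure_pmf.prob (random_subset G q) {T. S - H \<subseteq> T} = q ^ card (S - H)"
        using pq G(2) by (intro prob_random_subset_superset) (auto simp: Z_def)
      also have "\<dots> \<le> q ^ L" using S pq by (intro power_decreasing) (auto simp: Z_def)
      finally show "measure_pmf.prob (random_subset G q) {T. S - H \<subseteq> T} \<le> q ^ L" .
    qed
    also have "\<dots> = real (card Z) * q ^ L" by simp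
    also have "\<dots> \<le> A * q ^ L" using cZ pq by (intro mult_right_mono) auto
    also have "\<dots> \<le> 1 / 2" by (rule A)
    finally have "measure_pmf.prob (random_subset G q) (- X) \<le> 1 / 2" .
    moreover have "measure_pmf.prob (random_subset G q) (- X) = 1 - measure_pmf.prob (random_subset G q) X"
      using measure_pmf.prob_compl[of X "random_subset G q"] by (simp add: Compl_eq_Diff_UNIV)
    ultimately show ?thesis by simp
  qed
  have "measure_pmf.prob (random_subset E p) Y = (\<Sum>G\<in>Pow E. pmf (random_subset E p) G * indicator Y G)"
  proof -
    have "measure_pmf.prob (random_subset E p) Y = measure_pmf.expectation (random_subset E p) (indicator Y)" by simp
    also have "\<dots> = (\<Sum>G\<in>Pow E. indicator Y G * pmf (random_subset E p) G)"
      using set_random_subset[OF fin(1), of p] fin(1) by (intro integral_measure_pmf_real) auto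
    finally show ?thesis by (simp add: mult.commute)
  qed
  also have "\<dots> \<le> (\<Sum>G\<in>Pow E. pmf (random_subset E p) G * (2 * measure_pmf.prob (random_subset G q) X))"
  proof (intro sum_mono mult_left_mono)
    fix G assume "G \<in> Pow E"
    then have "finite G" using fin(1) finite_subset by auto
    then show "indicator Y G \<le> 2 * measure_pmf.prob (random_subset G q) X"
      using half[of G] by (auto simp: indicator_def)
  qed auto
  also have "\<dots> = 2 * (\<Sum>G\<in>Pow E. pmf (random_subset E p) G * measure_pmf.prob (random_subset G q) X)"
    by (simp add: sum_distrib_left mult_ac)
  also have "(\<Sum>G\<in>Pow E. pmf (random_subset E p) G * measure_pmf.prob (random_subset G q) X) =
      measure_pmf.prob (random_subset E p \<bind> (\<lambda>G. random_subset G q)) X"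
    using set_random_subset[OF fin(1), of p] fin(1) by (intro prob_bind_pmf_sum[symmetric]) auto
  also have "\<dots> = measure_pmf.prob (random_subset E (p * q)) X"
    using random_subset_compose[OF pq fin(1)] by simp
  finally show ?thesis using thin unfolding X_def Y_def by simp
qed

subsection \<open>Hamiltonian cycles\<close>

lemma cycle_edges_facts:
  assumes "distinct xs" "set xs \<subseteq> {1..n}" "6 < length xs"
  shows "card (cycle_edges xs) = length xs" "cycle_edges xs \<subseteq> complete_edges n" "\<Union>(cycle_edges xs) = set xs"
proof -
  define v where "v = (\<lambda>j. xs ! nat (j mod int (length xs)))"
  interpret cyclic_graph v "length xs" n 0
    using cyclic_graph_of_list(1)[OF assms(1,2), of 0] assms(3) by (simp add: v_def)
  have H: "H = cycle_edges xs"
    using cyclic_graph_of_list(2)[OF assms(1,2), of 0] assms(3) by (simp add: v_def)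
  show "card (cycle_edges xs) = length xs" "cycle_edges xs \<subseteq> complete_edges n"
    using card_H H_edges by (simp_all add: H)
  have "i < length xs \<Longrightarrow> xs ! i \<in> \<Union>(cycle_edges xs)" for i
    unfolding cycle_edges_def by blast
  moreover have "\<Union>(cycle_edges xs) \<subseteq> set xs" using assms(3) by (auto simp: cycle_edges_def intro!: nth_mem mod_less_divisor)
  ultimately show "\<Union>(cycle_edges xs) = set xs" by (auto simp: in_set_conv_nth)
qed

text \<open>After two vertices there is no choice left: the next one is the cycle neighbour of the
  present vertex other than its predecessor.\<close>

lemma cycle_edges_determine:
  assumes xs: "distinct xs" "6 < length xs" and ys: "distinct ys" "length ys = length xs"
    and eq: "cycle_edges xs = cycle_edges ys" "xs ! 0 = ys ! 0" "xs ! 1 = ys ! 1"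
    and sub: "set xs \<subseteq> {1..n}" "set ys \<subseteq> {1..n}"
  shows "xs = ys"
proof -
  define v where "v = (\<lambda>j. ys ! nat (j mod int (length ys)))"
  interpret cyclic_graph v "length ys" n 0
    using cyclic_graph_of_list(1)[OF ys(1) sub(2), of 0] xs(2) ys(2) by (simp add: v_def)
  have H: "H = cycle_edges ys"
    using cyclic_graph_of_list(2)[OF ys(1) sub(2), of 0] xs(2) ys(2) by (simp add: v_def)
  have v: "v (int i) = ys ! i" if "i < length ys" for i
    using that by (simp add: v_def)
  have "i < length xs \<Longrightarrow> xs ! i = ys ! i" for i
  proof (induction i rule: less_induct)
    case (less i)
    consider "i = 0" | "i = 1" | j where "i = Suc (Suc j)"
      by (metis One_nat_def not0_implies_Suc)
    then show ?case
    proof cases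
      case 3
      have IH: "xs ! j = ys ! j" "xs ! Suc j = ys ! Suc j" using less 3 by auto
      have "{xs ! Suc j, xs ! (Suc (Suc j) mod length xs)} \<in> cycle_edges xs"
        using less.prems 3 unfolding cycle_edges_def by auto
      moreover have "v (int (Suc j)) = xs ! Suc j" using v[of "Suc j"] less.prems 3 ys(2) IH by (simp del: of_nat_Suc)
      moreover have "Suc (Suc j) mod length xs = i" using less.prems 3 by simp
      ultimately have "{v (int (Suc j)), xs ! i} \<in> H" by (simp only: H eq(1))
      then have "xs ! i = v (int (Suc j) + 1) \<or> xs ! i = v (int (Suc j) - 1)" by (rule H_neighbour)
      moreover have "xs ! i \<noteq> xs ! j" using xs(1) less.prems 3 by (simp add: nth_eq_iff_index_eq)
      moreover have "v (int (Suc j) - 1) = xs ! j" using v[of j] IH less.prems 3 ys(2) by simp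
      moreover have "v (int (Suc j) + 1) = ys ! i" using v[of i] less.prems 3 ys(2) by (simp add: add.commute)
      ultimately show ?thesis by simp
    qed (use eq in auto)
  qed
  then show ?thesis using ys(2) by (intro nth_equalityI) auto
qed

lemma hamiltonian_cycleD:
  assumes "H \<in> hamiltonian_cycles V" "V \<in> [{1..n}]\<^bsup>m\<^esup>"
  obtains xs where "distinct xs" "set xs = V" "length xs = m" "H = cycle_edges xs" "set xs \<subseteq> {1..n}"
proof -
  obtain xs where "distinct xs" "set xs = V" "H = cycle_edges xs"
    using assms(1) by (auto simp: hamiltonian_cycles_def)
  moreover have "length xs = m" using calculation distinct_card[of xs] assms(2) by (simp add: nsets_def)
  moreover have "set xs \<subseteq> {1..n}" using calculation(2) assms(2) by (simp add: nsets_def)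
  ultimately show ?thesis using that by blast
qed

text \<open>A listing is determined by its edge set and its first two vertices, for which there are
  at most \<open>m * m\<close> choices. The exact overcount is \<open>2 * m\<close>; the difference
  is only a polynomial factor.\<close>

lemma card_hamiltonian_cycles:
  assumes V: "V \<in> [{1..n}]\<^bsup>m\<^esup>" and m: "6 < m"
  shows "finite (hamiltonian_cycles V)" "fact m \<le> card (hamiltonian_cycles V) * (m * m)"
proof -
  have VV: "finite V" "card V = m" "V \<subseteq> {1..n}" using V by (auto simp: nsets_def)
  define L where "L = permutations_of_set V"
  have L: "distinct xs" "set xs = V" "length xs = m" if "xs \<in> L" for xs
    using that VV distinct_card[of xs] by (auto simp: L_def permutations_of_set_def)
  have hc: "hamiltonian_cycles V = cycle_edges ` L"
  proof -
    have "{xs. distinct xs \<and> set xs = V \<and> 3 \<le> length xs} = L"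
    proof (intro equalityI subsetI)
      fix xs assume "xs \<in> L"
      then show "xs \<in> {xs. distinct xs \<and> set xs = V \<and> 3 \<le> length xs}" using L[of xs] m by simp
    qed (auto simp: L_def permutations_of_set_def)
    then show ?thesis unfolding hamiltonian_cycles_def by simp
  qed
  show fin: "finite (hamiltonian_cycles V)" unfolding hc by (simp add: L_def)
  define f where "f = (\<lambda>xs::nat list. (cycle_edges xs, xs ! 0, xs ! 1))"
  have "inj_on f L"
  proof (rule inj_onI)
    fix xs ys assume *: "xs \<in> L" "ys \<in> L" "f xs = f ys"
    then show "xs = ys"
      using L[OF *(1)] L[OF *(2)] m VV(3) by (intro cycle_edges_determine[of xs ys n]) (auto simp: f_def)
  qed
  moreover have "f ` L \<subseteq> hamiltonian_cycles V \<times> V \<times> V"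
  proof
    fix z assume "z \<in> f ` L"
    then obtain xs where xs: "xs \<in> L" "z = f xs" by blast
    have "xs ! 0 \<in> V" "xs ! 1 \<in> V" using L[OF xs(1)] m nth_mem[of 0 xs] nth_mem[of 1 xs] by auto
    then show "z \<in> hamiltonian_cycles V \<times> V \<times> V" using xs by (auto simp: f_def hc)
  qed
  ultimately have "card L \<le> card (hamiltonian_cycles V \<times> V \<times> V)"
    using fin VV(1) by (intro card_inj_on_le[of f]) auto
  then show "fact m \<le> card (hamiltonian_cycles V) * (m * m)"
    using VV by (simp add: L_def card_cartesian_product)
qed

section \<open>Cycles close to a given edge set\<close>

lemma card_sym_diff_triangle:
  assumes "finite A" "finite B" "finite C"
  shows "card (sym_diff A B) \<le> card (sym_diff A C) + card (sym_diff B C)"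
proof -
  have "sym_diff A B \<subseteq> sym_diff A C \<union> sym_diff B C" by blast
  then have "card (sym_diff A B) \<le> card (sym_diff A C \<union> sym_diff B C)" using assms by (intro card_mono) auto
  also have "\<dots> \<le> card (sym_diff A C) + card (sym_diff B C)" by (rule card_Un_le)
  finally show ?thesis .
qed

text \<open>\<open>K\<close> need not lie in \<open>G\<close>, so a member \<open>H0\<close> serves
  as the centre, at twice the radius: differences with \<open>H0\<close> are subsets of
  \<open>G\<close>, and they are distinct for distinct members.\<close>

lemma card_close_subgraphs:
  fixes x e :: real
  assumes G: "finite G" and K: "finite K" and x: "0 < x" "x \<le> 1" and m: "0 < m"
    and C: "\<And>H. H \<in> C \<Longrightarrow> card H = m \<and> H \<subseteq> G \<and> recon_error H K < e"
    and s: "2 * e * real m \<le> real s"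
  shows "real (card C) \<le> (1 / x) ^ s * (1 + x) ^ card G"
proof (cases "C = {}")
  case True
  then show ?thesis using x by simp
next
  case False
  then obtain H0 where H0: "H0 \<in> C" by blast
  have close: "real (card (sym_diff H K)) < e * real m" if "H \<in> C" for H
  proof -
    have "card H = m" "real (card (sym_diff H K)) / real (card H) < e"
      using C[OF that] by (auto simp: recon_error_def)
    then have "real (card (sym_diff H K)) / real m < e" by metis
    then show ?thesis using m by (simp add: pos_divide_less_eq)
  qed
  have "(\<lambda>H. sym_diff H H0) ` C \<subseteq> {T. T \<subseteq> G \<and> card T \<le> s}"
  proof clarify
    fix H assume H: "H \<in> C"
    have "finite H" "finite H0" using C[OF H] C[OF H0] G finite_subset by blast+
    then have "card (sym_diff H H0) \<le> card (sym_diff H K) + card (sym_diff H0 K)"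
      using K by (intro card_sym_diff_triangle)
    then have "real (card (sym_diff H H0)) \<le> real s" using close[OF H] close[OF H0] s by linarith
    then show "sym_diff H H0 \<subseteq> G \<and> card (sym_diff H H0) \<le> s" using C[OF H] C[OF H0] by auto
  qed
  moreover have "inj_on (\<lambda>H. sym_diff H H0) C" by (rule inj_onI) blast
  ultimately have "card C \<le> card {T. T \<subseteq> G \<and> card T \<le> s}"
    using G by (intro card_inj_on_le) auto
  then have "real (card C) \<le> real (card {T. T \<subseteq> G \<and> card T \<le> s})" by simp
  also have "\<dots> \<le> (1 / x) ^ s * (1 + x) ^ card G" using G x by (rule card_small_subsets_le)
  finally show ?thesis .
qed

subsection \<open>The posterior law is uniform\<close>

text \<open>At most \<open>b\<close> cycles in a good \<open>G\<close> are close to the output of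
  the estimator, while \<open>G\<close> contains at least \<open>A\<close> members of
  \<open>F\<close>; so \<open>b\<close> is at most \<open>b / A\<close> times the number of these
  members. After exchanging the sums each member contributes at most 1. The remaining factor is the
  reciprocal of a lower bound for the number of \<open>m\<close>-cycles.\<close>

lemma posterior_bound:
  fixes n m :: nat and p e \<beta> A b :: real
  assumes p: "0 \<le> p" "p \<le> 1" and m: "6 < m" "m \<le> n" and est: "estimator n est"
    and F: "finite F" "\<And>S. S \<in> F \<Longrightarrow> S \<subseteq> complete_edges n \<and> card S = m"
    and bad: "\<And>V H. V \<in> [{1..n}]\<^bsup>m\<^esup> \<Longrightarrow> H \<in> hamiltonian_cycles V \<Longrightarrow>
       measure_pmf.prob (random_subset (complete_edges n) p) {G. \<not> good (G \<union> H)} \<le> \<beta>"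
    and A: "0 < A" "\<And>G. G \<subseteq> complete_edges n \<Longrightarrow> good G \<Longrightarrow> A \<le> real (card {S \<in> F. S \<subseteq> G})"
    and b: "0 \<le> b" "\<And>G K. G \<subseteq> complete_edges n \<Longrightarrow> good G \<Longrightarrow> finite K \<Longrightarrow>
       real (card {H \<in> (\<Union>V\<in>[{1..n}]\<^bsup>m\<^esup>. hamiltonian_cycles V). H \<subseteq> G \<and> recon_error H K < e}) \<le> b"
  shows "measure_pmf.prob (random_subset (complete_edges n) p \<bind> (\<lambda>G0. pmf_of_set ([{1..n}]\<^bsup>m\<^esup>) \<bind>
      (\<lambda>V. pmf_of_set (hamiltonian_cycles V) \<bind> (\<lambda>H. est (G0 \<union> H) \<bind> (\<lambda>K. return_pmf (H, K))))))
      {(H, K). recon_error H K < e} \<le>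
    \<beta> + real (m * m) / (fact m * real (n choose m)) * (b / A * real (card F))"
proof -
  define E where "E = complete_edges n"
  define Vs where "Vs = [{1..n}]\<^bsup>m\<^esup>"
  define HC where "HC = (\<Union>V\<in>Vs. hamiltonian_cycles V)"
  define ER where "ER = random_subset E p"
  define s where "s = (\<lambda>H G. measure_pmf.prob (est G) {K. recon_error H K < e})"
  define h where "h = (\<lambda>H. measure_pmf.prob (ER \<bind> (\<lambda>G0. map_pmf (Pair H) (est (G0 \<union> H)))) {(H, K). recon_error H K < e})"
  \<comment> \<open>The probability of observing \<open>G\<close> when any one of its
    \<open>m\<close>-edge subsets is planted.\<close>
  define q where "q = (\<lambda>G::graph. p ^ (card G - m) * (1 - p) ^ (card E - card G))"
  define Good where "Good = {G \<in> Pow E. good G}"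
  define t where "t = (\<lambda>H. \<Sum>G\<in>Good. if H \<subseteq> G then q G * s H G else 0)"
  have finE: "finite E" by (simp add: E_def finite_imp_finite_nsets)
  have finVs: "finite Vs" and cVs: "card Vs = n choose m" by (simp_all add: Vs_def finite_imp_finite_nsets)
  have Vs0: "Vs \<noteq> {}" using cVs m(2) by (metis binomial_eq_0_iff card.empty leD)
  have finHC: "finite (hamiltonian_cycles V)" and cHC: "fact m \<le> card (hamiltonian_cycles V) * (m * m)" if "V \<in> Vs" for V
    using card_hamiltonian_cycles that m(1) by (simp_all add: Vs_def)
  have HC0: "hamiltonian_cycles V \<noteq> {}" if "V \<in> Vs" for V
  proof
    assume "hamiltonian_cycles V = {}"
    then have "(fact m :: nat) = 0" using cHC[OF that] by simp
    then show False by simp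
  qed
  have finGood: "finite Good" using finE by (simp add: Good_def)
  have HCsub: "card H = m" "H \<subseteq> E" "\<Union>H = V" if h: "V \<in> Vs" "H \<in> hamiltonian_cycles V" for V H
  proof -
    obtain xs where xs: "distinct xs" "set xs = V" "length xs = m" "H = cycle_edges xs" "set xs \<subseteq> {1..n}"
      using hamiltonian_cycleD[OF h(2)] h(1) unfolding Vs_def by blast
    then show "card H = m" "H \<subseteq> E" "\<Union>H = V"
      using cycle_edges_facts[OF xs(1,5)] m(1) by (auto simp: E_def)
  qed
  have q0: "0 \<le> q G" for G using p by (simp add: q_def)
  have s0: "0 \<le> s H G" "s H G \<le> 1" for H G by (simp_all add: s_def)
  have t0: "0 \<le> t H" for H unfolding t_def using q0 s0 by (intro sum_nonneg) auto
  have qpmf: "pmf (map_pmf (\<lambda>S. S \<union> H) ER) G = q G" if "card H = m" "H \<subseteq> G" "G \<subseteq> E" for H G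
    using pmf_union_random_subset[OF p finE that(2,3)] that(1) by (simp add: ER_def q_def)
  have h_le: "h H \<le> \<beta> + t H" if V: "V \<in> Vs" "H \<in> hamiltonian_cycles V" for V H
  proof -
    define M where "M = map_pmf (\<lambda>S. S \<union> H) ER"
    note H = HCsub[OF V]
    have setM: "set_pmf M \<subseteq> {G \<in> Pow E. H \<subseteq> G}"
      using set_random_subset[OF finE, of p] H(2) by (auto simp: M_def ER_def)
    have "h H = measure_pmf.prob (M \<bind> (\<lambda>G. map_pmf (Pair H) (est G))) {(H, K). recon_error H K < e}"
      by (simp add: h_def M_def bind_map_pmf)
    also have "\<dots> = (\<Sum>G\<in>{G \<in> Pow E. H \<subseteq> G}. pmf M G * s H G)"
      using setM finE by (subst prob_bind_pmf_sum[of "{G \<in> Pow E. H \<subseteq> G}"]) (auto simp: s_def vimage_def)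
    also have "\<dots> = (\<Sum>G\<in>{G \<in> Pow E. H \<subseteq> G \<and> good G} \<union> {G \<in> Pow E. H \<subseteq> G \<and> \<not> good G}. pmf M G * s H G)"
      by (intro sum.cong) auto
    also have "\<dots> = (\<Sum>G\<in>{G \<in> Pow E. H \<subseteq> G \<and> good G}. pmf M G * s H G) + (\<Sum>G\<in>{G \<in> Pow E. H \<subseteq> G \<and> \<not> good G}. pmf M G * s H G)"
      using finE by (intro sum.union_disjoint) auto
    also have "(\<Sum>G\<in>{G \<in> Pow E. H \<subseteq> G \<and> good G}. pmf M G * s H G) = (\<Sum>G\<in>{G \<in> Pow E. H \<subseteq> G \<and> good G}. if H \<subseteq> G then q G * s H G else 0)"
      using qpmf[OF H(1)] by (intro sum.cong refl) (simp add: M_def)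
    also have "\<dots> = t H"
      unfolding t_def using finE by (intro sum.mono_neutral_left) (auto simp: Good_def)
    also have "(\<Sum>G\<in>{G \<in> Pow E. H \<subseteq> G \<and> \<not> good G}. pmf M G * s H G) \<le> (\<Sum>G\<in>{G \<in> Pow E. H \<subseteq> G \<and> \<not> good G}. pmf M G * 1)"
      using s0 by (intro sum_mono mult_left_mono) auto
    also have "\<dots> = measure_pmf.prob M {G \<in> Pow E. H \<subseteq> G \<and> \<not> good G}"
      using finE by (subst measure_measure_pmf_finite) auto
    also have "\<dots> \<le> measure_pmf.prob M {G. \<not> good G}" by (intro measure_pmf.finite_measure_mono) auto
    also have "\<dots> = measure_pmf.prob ER {G. \<not> good (G \<union> H)}" by (simp add: M_def vimage_def)
    also have "\<dots> \<le> \<beta>" using bad V by (simp add: ER_def E_def Vs_def)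
    finally show ?thesis by simp
  qed
  have total: "(\<Sum>V\<in>Vs. \<Sum>H\<in>hamiltonian_cycles V. t H) \<le> b / A * real (card F)"
  proof -
    have "(\<Sum>V\<in>Vs. \<Sum>H\<in>hamiltonian_cycles V. t H) = (\<Sum>H\<in>HC. t H)"
      unfolding HC_def
    proof (rule sum.UNION_disjoint[symmetric])
      show "\<forall>V\<in>Vs. \<forall>V'\<in>Vs. V \<noteq> V' \<longrightarrow> hamiltonian_cycles V \<inter> hamiltonian_cycles V' = {}"
      proof (intro ballI impI equals0I)
        fix V V' H assume *: "V \<in> Vs" "V' \<in> Vs" "V \<noteq> V'" "H \<in> hamiltonian_cycles V \<inter> hamiltonian_cycles V'"
        then have "\<Union>H = V" "\<Union>H = V'" using HCsub(3)[of V H] HCsub(3)[of V' H] by simp_all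
        then show False using *(3) by simp
      qed
    qed (use finVs finHC in auto)
    also have "\<dots> = (\<Sum>G\<in>Good. \<Sum>H\<in>HC. if H \<subseteq> G then q G * s H G else 0)"
      unfolding t_def by (rule sum.swap)
    also have "\<dots> \<le> (\<Sum>G\<in>Good. q G * b)"
    proof (intro sum_mono)
      fix G assume G: "G \<in> Good"
      define HG where "HG = {H \<in> HC. H \<subseteq> G}"
      have finHCs: "finite HC" unfolding HC_def using finVs finHC by auto
      have finHG: "finite HG" using finHCs by (simp add: HG_def)
      have GE: "G \<subseteq> complete_edges n" "good G" using G by (auto simp: Good_def E_def)
      have Kfin: "finite K" if "K \<in> set_pmf (est G)" for K
        using est GE(1) that finE finite_subset unfolding estimator_def E_def by (meson PowD subsetD)
      have "(\<Sum>H\<in>HC. if H \<subseteq> G then q G * s H G else 0) = (\<Sum>H\<in>HG. q G * s H G)"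
        unfolding HG_def using finHCs by (simp add: sum.inter_filter)
      also have "\<dots> = q G * (\<Sum>H\<in>HG. s H G)" by (simp add: sum_distrib_left)
      also have "(\<Sum>H\<in>HG. s H G) = (\<Sum>H\<in>HG. measure_pmf.expectation (est G) (\<lambda>K. indicator {K. recon_error H K < e} K))"
        by (simp add: s_def)
      also have "\<dots> = measure_pmf.expectation (est G) (\<lambda>K. \<Sum>H\<in>HG. indicator {K. recon_error H K < e} K)"
        by (intro Bochner_Integration.integral_sum[symmetric] measure_pmf.integrable_const_bound[of _ 1]) auto
      also have "\<dots> \<le> measure_pmf.expectation (est G) (\<lambda>K. b)"
      proof (intro integral_mono_AE)
        have int: "integrable (measure_pmf (est G)) (indicator {K. recon_error H K < e} :: graph \<Rightarrow> real)" for H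
          by (rule measure_pmf.integrable_const_bound[of _ 1]) auto
        show "integrable (measure_pmf (est G)) (\<lambda>K. \<Sum>H\<in>HG. indicator {K. recon_error H K < e} K :: real)"
          using int by (intro Bochner_Integration.integrable_sum)
        show "AE K in est G. (\<Sum>H\<in>HG. indicator {K. recon_error H K < e} K) \<le> b"
        proof (simp only: AE_measure_pmf_iff, intro ballI)
          fix K assume "K \<in> set_pmf (est G)"
          then have fK: "finite K" by (rule Kfin)
          have "(\<Sum>H\<in>HG. indicator {K. recon_error H K < e} K) = (\<Sum>H\<in>HG. if recon_error H K < e then 1 else 0 :: real)"
            by (intro sum.cong) (auto simp: indicator_def)
          also have "\<dots> = real (card {H \<in> HG. recon_error H K < e})"
            using finHG by (simp flip: sum.inter_filter)
          also have "{H \<in> HG. recon_error H K < e} = {H \<in> HC. H \<subseteq> G \<and> recon_error H K < e}" by (auto simp: HG_def)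
          also have "real (card \<dots>) \<le> b" using b(2)[OF GE fK] by (simp add: HC_def Vs_def)
          finally show "(\<Sum>H\<in>HG. indicator {K. recon_error H K < e} K) \<le> b" .
        qed
      qed auto
      also have "\<dots> = b" by simp
      finally show "(\<Sum>H\<in>HC. if H \<subseteq> G then q G * s H G else 0) \<le> q G * b"
        using q0[of G] by (simp add: mult_left_mono)
    qed
    \<comment> \<open>Here members of \<open>F\<close> take the place of cycles.\<close>
    also have "\<dots> \<le> (\<Sum>G\<in>Good. q G * (b / A * real (card {S \<in> F. S \<subseteq> G})))"
    proof (intro sum_mono mult_left_mono q0)
      fix G assume "G \<in> Good"
      then have "A \<le> real (card {S \<in> F. S \<subseteq> G})" by (intro A(2)) (auto simp: Good_def E_def)
      then have "b * A \<le> b * real (card {S \<in> F. S \<subseteq> G})" using b(1) by (rule mult_left_mono)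
      then show "b \<le> b / A * real (card {S \<in> F. S \<subseteq> G})" using A(1) by (simp add: field_simps)
    qed
    also have "\<dots> = b / A * (\<Sum>G\<in>Good. q G * real (card {S \<in> F. S \<subseteq> G}))"
      by (simp add: sum_distrib_left mult_ac)
    also have "(\<Sum>G\<in>Good. q G * real (card {S \<in> F. S \<subseteq> G})) = (\<Sum>G\<in>Good. \<Sum>S\<in>F. if S \<subseteq> G then q G else 0)"
      using F(1) by (intro sum.cong refl) (simp flip: sum.inter_filter)
    also have "\<dots> = (\<Sum>S\<in>F. \<Sum>G\<in>Good. if S \<subseteq> G then q G else 0)" by (rule sum.swap)
    also have "b / A * (\<Sum>S\<in>F. \<Sum>G\<in>Good. if S \<subseteq> G then q G else 0) \<le> b / A * (\<Sum>S\<in>F. 1)"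
    proof (intro mult_left_mono sum_mono)
      fix S assume S: "S \<in> F"
      have "(\<Sum>G\<in>Good. if S \<subseteq> G then q G else 0) = (\<Sum>G\<in>{G \<in> Good. S \<subseteq> G}. q G)"
        using finGood by (simp add: sum.inter_filter)
      \<comment> \<open>\<open>q G\<close> is also the probability of \<open>G\<close> in the model
        with \<open>S\<close> planted, so the sum over \<open>G\<close> is at most 1.\<close>
      also have "\<dots> = (\<Sum>G\<in>{G \<in> Good. S \<subseteq> G}. pmf (map_pmf (\<lambda>T. T \<union> S) ER) G)"
        using F(2)[OF S] by (intro sum.cong refl qpmf[symmetric]) (auto simp: Good_def)
      also have "\<dots> = measure_pmf.prob (map_pmf (\<lambda>T. T \<union> S) ER) {G \<in> Good. S \<subseteq> G}"
        using finGood by (intro measure_measure_pmf_finite[symmetric]) auto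
      also have "\<dots> \<le> 1" by simp
      finally show "(\<Sum>G\<in>Good. if S \<subseteq> G then q G else 0) \<le> 1" .
    qed (use b(1) A(1) in auto)
    finally show ?thesis by simp
  qed
  have "ER \<bind> (\<lambda>G0. pmf_of_set Vs \<bind> (\<lambda>V. pmf_of_set (hamiltonian_cycles V) \<bind> (\<lambda>H. est (G0 \<union> H) \<bind> (\<lambda>K. return_pmf (H, K))))) =
    pmf_of_set Vs \<bind> (\<lambda>V. ER \<bind> (\<lambda>G0. pmf_of_set (hamiltonian_cycles V) \<bind> (\<lambda>H. map_pmf (Pair H) (est (G0 \<union> H)))))"
    by (subst bind_commute_pmf) (simp add: map_pmf_def)
  also have "\<dots> = pmf_of_set Vs \<bind> (\<lambda>V. pmf_of_set (hamiltonian_cycles V) \<bind> (\<lambda>H. ER \<bind> (\<lambda>G0. map_pmf (Pair H) (est (G0 \<union> H)))))"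
    by (subst bind_commute_pmf) simp
  finally have eq: "ER \<bind> (\<lambda>G0. pmf_of_set Vs \<bind> (\<lambda>V. pmf_of_set (hamiltonian_cycles V) \<bind> (\<lambda>H. est (G0 \<union> H) \<bind> (\<lambda>K. return_pmf (H, K))))) =
    pmf_of_set Vs \<bind> (\<lambda>V. pmf_of_set (hamiltonian_cycles V) \<bind> (\<lambda>H. ER \<bind> (\<lambda>G0. map_pmf (Pair H) (est (G0 \<union> H)))))" .
  have "measure_pmf.prob (pmf_of_set Vs \<bind> (\<lambda>V. pmf_of_set (hamiltonian_cycles V) \<bind> (\<lambda>H. ER \<bind> (\<lambda>G0. map_pmf (Pair H) (est (G0 \<union> H))))))
      {(H, K). recon_error H K < e} = (\<Sum>V\<in>Vs. (\<Sum>H\<in>hamiltonian_cycles V. h H) / real (card (hamiltonian_cycles V))) / real (card Vs)"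
    using finVs Vs0 finHC HC0 by (simp add: prob_bind_pmf_of_set h_def cong: sum.cong)
  also have "\<dots> \<le> (\<Sum>V\<in>Vs. \<beta> + real (m * m) / fact m * (\<Sum>H\<in>hamiltonian_cycles V. t H)) / real (card Vs)"
  proof (intro divide_right_mono sum_mono)
    fix V assume V: "V \<in> Vs"
    define c where "c = card (hamiltonian_cycles V)"
    have c0: "0 < c" using HC0[OF V] finHC[OF V] by (simp add: c_def card_gt_0_iff)
    have "(\<Sum>H\<in>hamiltonian_cycles V. h H) / real c \<le> (\<Sum>H\<in>hamiltonian_cycles V. \<beta> + t H) / real c"
      using h_le[OF V] by (intro divide_right_mono sum_mono) auto
    also have "\<dots> = \<beta> + 1 / real c * (\<Sum>H\<in>hamiltonian_cycles V. t H)"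
      using c0 by (simp add: sum.distrib add_divide_distrib c_def)
    also have "\<dots> \<le> \<beta> + real (m * m) / fact m * (\<Sum>H\<in>hamiltonian_cycles V. t H)"
    proof (intro add_left_mono mult_right_mono sum_nonneg t0)
      have "(fact m :: real) \<le> real (c * (m * m))" using cHC[OF V] unfolding c_def by (metis of_nat_fact of_nat_mono)
      then show "1 / real c \<le> real (m * m) / fact m" using c0 by (simp add: field_simps)
    qed
    finally show "(\<Sum>H\<in>hamiltonian_cycles V. h H) / real (card (hamiltonian_cycles V)) \<le>
      \<beta> + real (m * m) / fact m * (\<Sum>H\<in>hamiltonian_cycles V. t H)" by (simp add: c_def)
  qed auto
  also have "\<dots> = \<beta> + real (m * m) / fact m * (\<Sum>V\<in>Vs. \<Sum>H\<in>hamiltonian_cycles V. t H) / real (card Vs)"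
    using finVs Vs0 by (simp add: sum.distrib add_divide_distrib sum_distrib_left)
  also have "\<dots> \<le> \<beta> + real (m * m) / fact m * (b / A * real (card F)) / real (card Vs)"
    using total by (intro add_left_mono divide_right_mono mult_left_mono) auto
  also have "\<dots> = \<beta> + real (m * m) / (fact m * real (n choose m)) * (b / A * real (card F))"
    by (simp add: cVs)
  finally show ?thesis
    unfolding eq[symmetric] unfolding ER_def E_def Vs_def .
qed

section \<open>From the search to the failure of every estimator\<close>

lemma estimation_eq:
  "estimation n \<delta> lam est = random_subset (complete_edges n) (lam / real n) \<bind>
    (\<lambda>G0. pmf_of_set ([{1..n}]\<^bsup>nat \<lfloor>\<delta> * real n\<rfloor>\<^esup>) \<bind>
    (\<lambda>V. pmf_of_set (hamiltonian_cycles V) \<bind> (\<lambda>H. est (G0 \<union> H) \<bind> (\<lambda>K. return_pmf (H, K)))))"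
  unfolding estimation_def planted_cycle_def erdos_renyi_def random_subset_def
  by (simp add: bind_assoc_pmf bind_return_pmf)

text \<open>The Chernoff bound with the moment \<open>2 ^ card G\<close>, whose expectation is
  \<open>(1 + p) ^ card E\<close>.\<close>

lemma prob_many_edges:
  assumes "0 \<le> p" "p \<le> 1" "finite E"
  shows "measure_pmf.prob (random_subset E p) {G. k \<le> real (card G)} \<le> exp (p * real (card E) - k * ln 2)"
proof -
  have int: "integrable (measure_pmf (random_subset E p)) f" for f :: "_ \<Rightarrow> real"
    using assms by (intro integrable_measure_pmf_finite) auto
  have "measure_pmf.prob (random_subset E p) {G. k \<le> real (card G)} =
     measure_pmf.expectation (random_subset E p) (indicator {G. k \<le> real (card G)})" by simp
  also have "\<dots> \<le> measure_pmf.expectation (random_subset E p) (\<lambda>G. exp (- k * ln 2) * 2 ^ card G)"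
  proof (intro integral_mono int)
    fix G :: "'a set"
    have "1 \<le> exp (- k * ln 2) * 2 ^ card G" if "k \<le> real (card G)"
    proof -
      have "(2::real) ^ card G = exp (real (card G) * ln 2)" by (simp add: exp_of_nat_mult)
      then have "exp (- k * ln 2) * 2 ^ card G = exp ((real (card G) - k) * ln 2)"
        by (simp add: algebra_simps flip: exp_add)
      also have "1 \<le> \<dots>" using that by simp
      finally show ?thesis .
    qed
    then show "indicator {G. k \<le> real (card G)} G \<le> exp (- k * ln 2) * (2::real) ^ card G"
      by (auto simp: indicator_def)
  qed
  also have "\<dots> = exp (- k * ln 2) * (1 - p + p * 2) ^ card E"
    using assms by (simp add: expectation_power_card_random_subset)
  also have "\<dots> \<le> exp (- k * ln 2) * exp p ^ card E"
  proof (intro mult_left_mono power_mono)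
    show "1 - p + p * 2 \<le> exp p" using exp_ge_add_one_self[of p] by linarith
  qed (use assms in auto)
  also have "\<dots> = exp (p * real (card E) - k * ln 2)"
    by (simp add: exp_diff exp_minus field_simps flip: exp_of_nat_mult)
  finally show ?thesis .
qed

text \<open>There are about \<open>exp (a * n)\<close> alternatives against about
  \<open>exp (a / 2 * n)\<close> close cycles, and this ratio beats the polynomial overcount of
  near-factors.\<close>

lemma small_error_unlikely:
  fixes \<delta> lam :: real
  assumes \<delta>: "0 < \<delta>" "\<delta> \<le> 1" and lam: "0 < lam"
    and super: "lam > 1 / (sqrt (2 * \<delta>) + sqrt (1 - \<delta>))\<^sup>2"
  shows "\<exists>\<epsilon> a c K d. 0 < \<epsilon> \<and> 0 < a \<and> 0 < c \<and> (\<forall>\<^sub>F n in sequentially. \<forall>est. estimator n est \<longrightarrow>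
    measure_pmf.prob (estimation n \<delta> lam est) {(H, K). recon_error H K < \<epsilon> / 2}
      \<le> 2 * exp (- (c * real n)) + exp (- (real n / 2)) + K * real n ^ d * exp (- (a * real n)))"
proof -
  define T where "T = (sqrt (2 * \<delta>) + sqrt (1 - \<delta>))\<^sup>2"
  have "0 < sqrt (2 * \<delta>) + sqrt (1 - \<delta>)" using \<delta> by (intro add_pos_nonneg) auto
  then have T: "0 < T" unfolding T_def by (rule zero_less_power)
  have lamT: "1 < lam * T" using super T unfolding T_def[symmetric] by (simp add: pos_divide_less_eq)
  define u where "u = 1 / T"
  \<comment> \<open>Strictly between the threshold \<open>1 / T\<close> and \<open>lam\<close>: the
    search still works at \<open>lam1\<close>, and the gap leaves a retention probability
    \<open>q = lam1 / lam\<close> below 1 for the thinning.\<close>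
  define lam1 where "lam1 = (lam + u) / 2"
  have l1: "0 < lam1" "lam1 < lam" "lam1 * T > 1"
  proof -
    have T': "0 < u" "u < lam" using T super by (simp_all add: T_def u_def)
    show "0 < lam1" using T' lam by (simp add: lam1_def)
    show "lam1 < lam" using T' by (simp add: lam1_def)
    have "lam1 * T = (lam * T + 1) / 2" using T by (simp add: lam1_def u_def distrib_right)
    then show "lam1 * T > 1" using lamT by simp
  qed
  define q where "q = lam1 / lam"
  have q: "0 < q" "q < 1" using l1 lam by (auto simp: q_def)
  obtain r t c where tc: "0 < t" "0 < c" and ev: "\<forall>\<^sub>F n in sequentially. \<forall>xs. distinct xs \<longrightarrow> set xs \<subseteq> {1..n} \<longrightarrow>
     length xs = nat \<lfloor>\<delta> * real n\<rfloor> \<longrightarrow>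
     measure_pmf.prob (random_subset (complete_edges n) (lam1 / real n))
       {G. \<not> (\<exists>S\<in>near_factors n (nat \<lfloor>\<delta> * real n\<rfloor>) r. S \<subseteq> G \<union> cycle_edges xs \<and>
               t * real n \<le> real (card (S - cycle_edges xs)))} \<le> exp (- (c * real n))"
    using alternative_exists[OF \<delta> l1(1) l1(3)[unfolded T_def]] by blast
  \<comment> \<open>A member with at least \<open>t * n\<close> noise edges survives the thinning
    with probability at most \<open>exp (- (a * n))\<close>.\<close>
  define a where "a = t * ln (1 / q)"
  have "1 < 1 / q" using q by simp
  then have a: "0 < a" unfolding a_def using tc by (intro mult_pos_pos ln_gt_zero)
  \<comment> \<open>With high probability there are at most \<open>(lam + 1) * n\<close> noise
    edges, and the cycle adds at most \<open>n\<close>.\<close>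
  define C where "C = lam + 2"
  have C: "0 < C" using lam by (simp add: C_def)
  \<comment> \<open>\<open>x\<close> and \<open>\<epsilon>\<close> make each of the two factors in
    the bound for close cycles at most \<open>exp (a / 4 * n)\<close>, up to the constant
    \<open>1 / x\<close>.\<close>
  define x where "x = min 1 (a / (4 * C))"
  have x: "0 < x" "x \<le> 1" using a C by (auto simp: x_def)
  have xC: "x * C \<le> a / 4"
  proof -
    have "x * C \<le> a / (4 * C) * C" using C by (intro mult_right_mono) (auto simp: x_def)
    then show ?thesis using C by simp
  qed
  define l where "l = ln (1 / x)"
  have l: "0 \<le> l" using x by (simp add: l_def)
  define \<epsilon> where "\<epsilon> = a / (4 * (1 + l))"
  have \<epsilon>: "0 < \<epsilon>" using a l by (simp add: \<epsilon>_def)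
  have \<epsilon>l: "\<epsilon> * l \<le> a / 4"
  proof -
    have "\<epsilon> * l \<le> \<epsilon> * (1 + l)" using \<epsilon> by simp
    also have "\<dots> = a / 4"
    proof -
      define l' where "l' = 1 + l"
      have "l' \<noteq> 0" using l by (simp add: l'_def)
      then show ?thesis unfolding \<epsilon>_def l'_def[symmetric] by simp
    qed
    finally show ?thesis .
  qed
  have "\<forall>\<^sub>F n in sequentially. max lam (8 / \<delta>) \<le> real n" by real_asymp
  then have "\<forall>\<^sub>F n in sequentially. \<forall>est. estimator n est \<longrightarrow>
    measure_pmf.prob (estimation n \<delta> lam est) {(H, K). recon_error H K < \<epsilon> / 2}
      \<le> 2 * exp (- (c * real n)) + exp (- (real n / 2)) + (18 * 20 ^ r / x) * real n ^ (3 * r + 2) * exp (- (a / 2 * real n))"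
    using ev
  proof eventually_elim
    case (elim n)
    then have n: "lam \<le> real n" "8 / \<delta> \<le> real n"
      and alt: "\<And>xs. distinct xs \<Longrightarrow> set xs \<subseteq> {1..n} \<Longrightarrow> length xs = nat \<lfloor>\<delta> * real n\<rfloor> \<Longrightarrow>
     measure_pmf.prob (random_subset (complete_edges n) (lam1 / real n))
       {G. \<not> (\<exists>S\<in>near_factors n (nat \<lfloor>\<delta> * real n\<rfloor>) r. S \<subseteq> G \<union> cycle_edges xs \<and>
               t * real n \<le> real (card (S - cycle_edges xs)))} \<le> exp (- (c * real n))"
      by auto
    have n0: "0 < real n" using n(1) lam by linarith
    define m where "m = nat \<lfloor>\<delta> * real n\<rfloor>"
    have dn: "8 \<le> \<delta> * real n" using n(2) \<delta> by (simp add: pos_divide_le_eq mult.commute)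
    have m: "real m \<le> \<delta> * real n" "\<delta> * real n - 1 \<le> real m"
      using \<delta> unfolding m_def by (auto intro: of_nat_floor)
    have m6: "6 < m" using m dn by linarith
    have "\<delta> * real n \<le> 1 * real n" using \<delta> by (intro mult_right_mono) auto
    then have mn: "m \<le> n" using m by linarith
    define E where "E = complete_edges n"
    have finE: "finite E" by (simp add: E_def finite_imp_finite_nsets)
    define p where "p = lam / real n"
    have p: "0 \<le> p" "p \<le> 1" using lam n n0 by (auto simp: p_def)
    define F where "F = near_factors n m r"
    have F: "S \<subseteq> E" "card S = m" if "S \<in> F" for S using that by (auto simp: F_def E_def near_factors_def)
    have finF: "finite F" by (rule finite_subset[of _ "Pow E"]) (use F finE in auto)
    define A where "A = exp (a * real n) / 2"
    define L where "L = nat \<lceil>t * real n\<rceil>"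
    define good where "good = (\<lambda>G. A \<le> real (card {S \<in> F. S \<subseteq> G}) \<and> real (card G) \<le> C * real n)"
    define b where "b = (1 / x) * exp (a / 2 * real n)"
    define \<beta> where "\<beta> = 2 * exp (- (c * real n)) + exp (- (real n / 2))"
    have AL: "A * q ^ L \<le> 1 / 2"
    proof -
      have "q ^ L = q powr real L" using q by (simp add: powr_realpow)
      also have "\<dots> \<le> q powr (t * real n)" using q by (intro powr_mono') (auto simp: L_def real_nat_ceiling_ge)
      also have "\<dots> = exp (- (a * real n))" using q by (simp add: powr_def a_def ln_div)
      finally have "A * q ^ L \<le> A * exp (- (a * real n))" by (intro mult_left_mono) (auto simp: A_def)
      then show ?thesis by (simp add: A_def flip: exp_add)
    qed
    have bad: "measure_pmf.prob (random_subset (complete_edges n) p) {G. \<not> good (G \<union> H)} \<le> \<beta>"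
      if V: "V \<in> [{1..n}]\<^bsup>m\<^esup>" and H: "H \<in> hamiltonian_cycles V" for V H
    proof -
      obtain xs where xs: "distinct xs" "set xs = V" "length xs = m" "H = cycle_edges xs" "set xs \<subseteq> {1..n}"
        using hamiltonian_cycleD[OF H V] by blast
      have cH: "card H = m" using cycle_edges_facts(1)[OF xs(1,5)] xs(3,4) m6 by simp
      have pq: "p * q = lam1 / real n" using lam by (simp add: p_def q_def)
      have L: "t * real n \<le> real k \<longleftrightarrow> L \<le> k" for k :: nat
        unfolding L_def by (simp add: nat_le_iff ceiling_le_iff)
      have 1: "measure_pmf.prob (random_subset E p) {G. real (card {S \<in> F. S \<subseteq> G \<union> H}) < A} \<le> 2 * exp (- (c * real n))"
      proof (rule many_alternatives[where q = q and L = L])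
        show "measure_pmf.prob (random_subset E (p * q)) {G. \<not> (\<exists>S\<in>F. S \<subseteq> G \<union> H \<and> L \<le> card (S - H))} \<le> exp (- (c * real n))"
          using alt[OF xs(1,5)] xs(3) unfolding pq E_def F_def xs(4) m_def L by simp
        show "finite S" if "S \<in> F" for S using F(1)[OF that] finE finite_subset by blast
      qed (use p q finE finF AL in auto)
      have 2: "measure_pmf.prob (random_subset E p) {G. C * real n < real (card (G \<union> H))} \<le> exp (- (real n / 2))"
      proof -
        have "measure_pmf.prob (random_subset E p) {G. C * real n < real (card (G \<union> H))} \<le>
            measure_pmf.prob (random_subset E p) {G. (lam + 1) * real n \<le> real (card G)}"
        proof (intro measure_pmf.finite_measure_mono subsetI CollectI)
          fix G assume "G \<in> {G. C * real n < real (card (G \<union> H))}"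
          moreover have "real (card (G \<union> H)) \<le> real (card G) + real n"
            using card_Un_le[of G H] cH mn by linarith
          ultimately show "(lam + 1) * real n \<le> real (card G)" by (simp add: C_def algebra_simps)
        qed simp
        also have "\<dots> \<le> exp (p * real (card E) - (lam + 1) * real n * ln 2)"
          by (rule prob_many_edges[OF p finE])
        also have "\<dots> \<le> exp (- (real n / 2))"
        proof -
          have "card E = n * (n - 1) div 2" by (simp add: E_def choose_two)
          then have "2 * card E \<le> n * n" by (metis div_times_less_eq_dividend diff_le_self le_trans mult.commute mult_le_mono2)
          then have "2 * real (card E) \<le> real n * real n" by (metis of_nat_le_iff of_nat_mult of_nat_numeral)
          then have "p * (2 * real (card E)) \<le> p * (real n * real n)" using p by (intro mult_left_mono)
          moreover have "p * (real n * real n) = lam * real n" using n0 by (simp add: p_def)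
          ultimately have 3: "p * real (card E) \<le> lam / 2 * real n" by simp
          have "(lam + 1) * real n * (1 / 2) \<le> (lam + 1) * real n * ln 2"
            using ln2_ge_two_thirds lam n0 by (intro mult_left_mono) auto
          with 3 have "p * real (card E) - (lam + 1) * real n * ln 2 \<le> - (real n / 2)" by (simp add: algebra_simps)
          then show ?thesis by simp
        qed
        finally show ?thesis .
      qed
      have "measure_pmf.prob (random_subset E p) {G. \<not> good (G \<union> H)} \<le>
        measure_pmf.prob (random_subset E p) ({G. real (card {S \<in> F. S \<subseteq> G \<union> H}) < A} \<union> {G. C * real n < real (card (G \<union> H))})"
        by (intro measure_pmf.finite_measure_mono) (auto simp: good_def)
      also have "\<dots> \<le> measure_pmf.prob (random_subset E p) {G. real (card {S \<in> F. S \<subseteq> G \<union> H}) < A} +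
         measure_pmf.prob (random_subset E p) {G. C * real n < real (card (G \<union> H))}"
        by (rule measure_Un_le) auto
      finally show ?thesis using 1 2 unfolding \<beta>_def E_def by linarith
    qed
    have ball: "real (card {H \<in> (\<Union>V\<in>[{1..n}]\<^bsup>m\<^esup>. hamiltonian_cycles V). H \<subseteq> G \<and> recon_error H K < \<epsilon> / 2}) \<le> b"
      if G: "G \<subseteq> complete_edges n" "good G" and K: "finite K" for G K
    proof -
      define s where "s = nat \<lceil>\<epsilon> * real n\<rceil>"
      have s: "\<epsilon> * real n \<le> real s" "real s \<le> \<epsilon> * real n + 1"
        using \<epsilon> n0 unfolding s_def by (auto simp: real_nat_ceiling_ge of_nat_ceiling)
      have "real (card {H \<in> (\<Union>V\<in>[{1..n}]\<^bsup>m\<^esup>. hamiltonian_cycles V). H \<subseteq> G \<and> recon_error H K < \<epsilon> / 2})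
        \<le> (1 / x) ^ s * (1 + x) ^ card G"
      proof (rule card_close_subgraphs[OF _ K x])
        show "finite G" using G(1) finE finite_subset unfolding E_def by blast
        show "0 < m" using m6 by simp
        have "\<epsilon> * real m \<le> \<epsilon> * real n" using mn \<epsilon> by simp
        then show "2 * (\<epsilon> / 2) * real m \<le> real s" using s(1) by simp
        fix H assume "H \<in> {H \<in> (\<Union>V\<in>[{1..n}]\<^bsup>m\<^esup>. hamiltonian_cycles V). H \<subseteq> G \<and> recon_error H K < \<epsilon> / 2}"
        then obtain V where V: "V \<in> [{1..n}]\<^bsup>m\<^esup>" "H \<in> hamiltonian_cycles V" and HG: "H \<subseteq> G" "recon_error H K < \<epsilon> / 2" by blast
        obtain xs where xs: "distinct xs" "set xs = V" "length xs = m" "H = cycle_edges xs" "set xs \<subseteq> {1..n}"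
          using hamiltonian_cycleD[OF V(2,1)] by blast
        then show "card H = m \<and> H \<subseteq> G \<and> recon_error H K < \<epsilon> / 2"
          using cycle_edges_facts(1)[OF xs(1,5)] m6 HG by simp
      qed
      also have "\<dots> \<le> b"
      proof -
      have "(1 / x) ^ s = exp (real s * l)" using x by (simp add: l_def exp_of_nat_mult)
      also have "\<dots> \<le> exp ((\<epsilon> * real n + 1) * l)" using s(2) l by (simp add: mult_right_mono)
      also have "\<dots> = exp (\<epsilon> * l * real n) * (1 / x)"
        using x by (simp add: l_def algebra_simps exp_add)
      also have "\<dots> \<le> exp (a / 4 * real n) * (1 / x)"
        using mult_right_mono[OF \<epsilon>l, of "real n"] x by (intro mult_right_mono) auto
      finally have 1: "(1 / x) ^ s \<le> exp (a / 4 * real n) * (1 / x)" .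
      have "(1 + x) ^ card G \<le> exp x ^ card G"
        using x by (intro power_mono exp_ge_add_one_self) auto
      also have "\<dots> = exp (x * real (card G))" by (simp add: mult.commute flip: exp_of_nat_mult)
      also have "\<dots> \<le> exp (a / 4 * real n)"
      proof -
        have "x * real (card G) \<le> x * (C * real n)" using G(2) x by (intro mult_left_mono) (auto simp: good_def)
        also have "\<dots> = (x * C) * real n" by simp
        also have "\<dots> \<le> a / 4 * real n" using xC by (intro mult_right_mono) auto
        finally show ?thesis by simp
      qed
      finally have 2: "(1 + x) ^ card G \<le> exp (a / 4 * real n)" .
      have "(1 / x) ^ s * (1 + x) ^ card G \<le> (exp (a / 4 * real n) * (1 / x)) * exp (a / 4 * real n)"
        using 1 2 x by (intro mult_mono) auto
      also have "\<dots> = b" by (simp add: b_def flip: exp_add)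
      finally show ?thesis .
      qed
      finally show ?thesis .
    qed
    show ?case
    proof (intro allI impI)
      fix est assume est: "estimator n est"
      have "measure_pmf.prob (estimation n \<delta> lam est) {(H, K). recon_error H K < \<epsilon> / 2} \<le>
         \<beta> + real (m * m) / (fact m * real (n choose m)) * (b / A * real (card F))"
        unfolding estimation_eq p_def[symmetric] m_def[symmetric]
      proof (rule posterior_bound[where good = good])
        show "0 < A" by (simp add: A_def)
        show "0 \<le> b" using x by (simp add: b_def)
        show "A \<le> real (card {S \<in> F. S \<subseteq> G})" if "good G" for G using that by (simp add: good_def)
      qed (use p m6 mn est finF F bad ball in \<open>auto simp: E_def\<close>)
      also have "real (m * m) / (fact m * real (n choose m)) * (b / A * real (card F)) \<le>
         real (m * m) / (fact m * real (n choose m)) * (b / A * (fact m * 4 ^ r * (real (n choose m) * (3 * real n ^ (2 * r)) * (3 * real (5 * n) ^ r))))"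
        using n0 mn x unfolding F_def by (intro mult_left_mono card_near_factors) (auto simp: A_def b_def)
      also have "\<dots> = real (m * m) * (b / A) * (9 * 20 ^ r * real n ^ (3 * r))"
      proof -
        have "(4::real) ^ r * 5 ^ r = 20 ^ r" by (simp flip: power_mult_distrib)
        moreover have "real n ^ (3 * r) = real n ^ (2 * r) * real n ^ r" by (simp flip: power_add)
        moreover have "real (n choose m) \<noteq> 0" using mn by (simp add: binomial_eq_0_iff)
        ultimately show ?thesis by (simp add: power_mult_distrib field_simps)
      qed
      also have "\<dots> \<le> (real n * real n) * (b / A) * (9 * 20 ^ r * real n ^ (3 * r))"
      proof -
        have "real (m * m) \<le> real n * real n" using mn by (simp add: mult_mono)
        then show ?thesis using x by (intro mult_right_mono) (auto simp: A_def b_def)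
      qed
      also have "\<dots> = (18 * 20 ^ r / x) * real n ^ (3 * r + 2) * exp (- (a / 2 * real n))"
      proof -
        have "b / A = 2 / x * exp (- (a / 2 * real n))"
        proof -
          have "exp (a / 2 * real n) / exp (a * real n) = exp (a / 2 * real n - a * real n)"
            by (rule exp_diff[symmetric])
          moreover have "a / 2 * real n - a * real n = - (a / 2 * real n)" by simp
          moreover have "b / A = 2 / x * (exp (a / 2 * real n) / exp (a * real n))"
            unfolding b_def A_def by simp
          ultimately show ?thesis by metis
        qed
        then show ?thesis by (simp add: power_add power2_eq_square)
      qed
      finally show "measure_pmf.prob (estimation n \<delta> lam est) {(H, K). recon_error H K < \<epsilon> / 2}
        \<le> 2 * exp (- (c * real n)) + exp (- (real n / 2)) + (18 * 20 ^ r / x) * real n ^ (3 * r + 2) * exp (- (a / 2 * real n))"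
        unfolding \<beta>_def by simp
    qed
  qed
  then show ?thesis using \<epsilon> a tc
    by (intro exI[of _ \<epsilon>] exI[of _ "a / 2"] exI[of _ c] exI[of _ "18 * 20 ^ r / x"] exI[of _ "3 * r + 2"]) simp
qed

text \<open>Finite support makes the error integrable, so that its expectation can be compared with
  that of an indicator.\<close>

lemma finite_set_estimation:
  assumes est: "estimator n est" and m: "6 < nat \<lfloor>\<delta> * real n\<rfloor>" "nat \<lfloor>\<delta> * real n\<rfloor> \<le> n"
  shows "finite (set_pmf (estimation n \<delta> lam est))"
proof -
  define m where "m = nat \<lfloor>\<delta> * real n\<rfloor>"
  define Vs where "Vs = [{1..n}]\<^bsup>m\<^esup>"
  have finE: "finite (complete_edges n)" by (simp add: finite_imp_finite_nsets)
  have finVs: "finite Vs" and "card Vs = n choose m" by (simp_all add: Vs_def finite_imp_finite_nsets)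
  then have Vs0: "Vs \<noteq> {}" using m(2) unfolding m_def by (metis binomial_eq_0_iff card.empty leD)
  have HC: "finite (hamiltonian_cycles V)" "hamiltonian_cycles V \<noteq> {}" "\<And>H. H \<in> hamiltonian_cycles V \<Longrightarrow> H \<subseteq> complete_edges n"
    if V: "V \<in> Vs" for V
  proof -
    have V': "V \<in> [{1..n}]\<^bsup>m\<^esup>" and m6: "6 < m" using V m(1) by (auto simp: Vs_def m_def)
    show "finite (hamiltonian_cycles V)" using card_hamiltonian_cycles(1)[OF V' m6] .
    show "hamiltonian_cycles V \<noteq> {}"
    proof
      assume "hamiltonian_cycles V = {}"
      then have "(fact m :: nat) = 0" using card_hamiltonian_cycles(2)[OF V' m6] by simp
      then show False by simp
    qed
    fix H assume H: "H \<in> hamiltonian_cycles V"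
    obtain xs where "distinct xs" "set xs = V" "length xs = m" "H = cycle_edges xs" "set xs \<subseteq> {1..n}"
      by (rule hamiltonian_cycleD[OF H V'])
    then show "H \<subseteq> complete_edges n" using cycle_edges_facts(2) m6 by simp
  qed
  have fin_est: "finite (set_pmf (est G))" if "G \<subseteq> complete_edges n" for G
  proof (rule finite_subset)
    show "set_pmf (est G) \<subseteq> Pow (complete_edges n)" using est that by (auto simp: estimator_def)
  qed (use finE in simp)
  show ?thesis
    unfolding estimation_eq m_def[symmetric] Vs_def[symmetric]
  proof (simp only: set_bind_pmf, intro finite_UN_I)
    show "finite (set_pmf (random_subset (complete_edges n) (lam / real n)))" using finE by simp
    fix G0 V H assume G0: "G0 \<in> set_pmf (random_subset (complete_edges n) (lam / real n))"
      and V: "V \<in> set_pmf (pmf_of_set Vs)" and H: "H \<in> set_pmf (pmf_of_set (hamiltonian_cycles V))"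
    have V': "V \<in> Vs" using V finVs Vs0 by simp
    then have "H \<subseteq> complete_edges n" using H HC[OF V'] by simp
    then have "G0 \<union> H \<subseteq> complete_edges n" using set_random_subset[OF finE] G0 by blast
    then show "finite (set_pmf (est (G0 \<union> H)))" by (rule fin_est)
  qed (use finVs Vs0 HC in auto)
qed

theorem lemma20:
  fixes \<delta> lam :: real
  assumes "0 < \<delta>" and "\<delta> \<le> 1" and "0 < lam"
    and "lam > 1 / (sqrt (2 * \<delta>) + sqrt (1 - \<delta>))\<^sup>2"
  shows "\<exists>\<epsilon>>0.
    (\<exists>c>0. \<forall>\<^sub>F n in sequentially. \<forall>est. estimator n est \<longrightarrow>
       measure_pmf.prob (estimation n \<delta> lam est) {(H, K). recon_error H K \<ge> \<epsilon> / 2}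
         \<ge> 1 - real n powr (- (c * ln (real n)))) \<and>
    (\<forall>\<^sub>F n in sequentially. \<forall>est. estimator n est \<longrightarrow>
       measure_pmf.expectation (estimation n \<delta> lam est) (\<lambda>(H, K). recon_error H K) \<ge> \<epsilon> / 4)"
proof -
  obtain \<epsilon> a c K d where pos: "0 < \<epsilon>" "0 < a" "0 < c" and ev: "\<forall>\<^sub>F n in sequentially. \<forall>est. estimator n est \<longrightarrow>
    measure_pmf.prob (estimation n \<delta> lam est) {(H, K). recon_error H K < \<epsilon> / 2}
      \<le> 2 * exp (- (c * real n)) + exp (- (real n / 2)) + K * real n ^ d * exp (- (a * real n))"
    using small_error_unlikely[OF assms] by (elim exE conjE) (rule that)
  have compl: "measure_pmf.prob M {(H, K). recon_error H K \<ge> \<epsilon> / 2} =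
      1 - measure_pmf.prob M {(H, K). recon_error H K < \<epsilon> / 2}" for M
  proof -
    have "{(H, K). recon_error H K \<ge> \<epsilon> / 2} = UNIV - {(H, K). recon_error H K < \<epsilon> / 2}" by auto
    then show ?thesis using measure_pmf.prob_compl[of "{(H, K). recon_error H K < \<epsilon> / 2}" M] by simp
  qed
  \<comment> \<open>The terms on the left are exponentially small up to a power of \<open>n\<close>,
    while the right-hand side is only \<open>exp (- (ln n)\<^sup>2)\<close>.\<close>
  have "\<forall>\<^sub>F n in sequentially. 2 * exp (- (c * real n)) + exp (- (real n / 2)) + K * real n ^ d * exp (- (a * real n))
      \<le> real n powr (- (1 * ln (real n)))"
  proof -
    have "\<forall>\<^sub>F n in sequentially. 2 * exp (- (c * real n)) \<le> real n powr (- (1 * ln (real n))) / 3"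
      using pos(3) by real_asymp
    moreover have "\<forall>\<^sub>F n in sequentially. exp (- (real n / 2)) \<le> real n powr (- (1 * ln (real n))) / 3"
      by real_asymp
    moreover have "(\<lambda>n. K * (real n ^ d * exp (- (a * real n)) / real n powr (- (1 * ln (real n))))) \<longlonglongrightarrow> 0"
      using pos(2) by real_asymp
    then have "\<forall>\<^sub>F n in sequentially. K * (real n ^ d * exp (- (a * real n)) / real n powr (- (1 * ln (real n)))) < 1 / 3"
      by (rule order_tendstoD) simp
    ultimately show ?thesis
      using eventually_gt_at_top[of 0]
    proof eventually_elim
      case (elim n)
      define P where "P = real n powr (- (1 * ln (real n)))"
      have "0 < P" using elim(4) by (simp add: P_def)
      then have "K * real n ^ d * exp (- (a * real n)) \<le> P / 3"
        using elim(3) unfolding P_def[symmetric] by (simp add: field_simps)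
      then show ?case using elim(1,2) unfolding P_def[symmetric] by linarith
    qed
  qed
  with ev have conc: "\<forall>\<^sub>F n in sequentially. \<forall>est. estimator n est \<longrightarrow>
       measure_pmf.prob (estimation n \<delta> lam est) {(H, K). recon_error H K \<ge> \<epsilon> / 2}
         \<ge> 1 - real n powr (- (1 * ln (real n)))"
  proof eventually_elim
    case (elim n)
    show ?case
    proof (intro allI impI)
      fix est assume "estimator n est"
      with elim(1) have "measure_pmf.prob (estimation n \<delta> lam est) {(H, K). recon_error H K < \<epsilon> / 2}
        \<le> 2 * exp (- (c * real n)) + exp (- (real n / 2)) + K * real n ^ d * exp (- (a * real n))" by blast
      also note elim(2)
      finally show "measure_pmf.prob (estimation n \<delta> lam est) {(H, K). recon_error H K \<ge> \<epsilon> / 2}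
         \<ge> 1 - real n powr (- (1 * ln (real n)))" unfolding compl by simp
    qed
  qed
  have "\<forall>\<^sub>F n in sequentially. real n powr (- (1 * ln (real n))) \<le> 1 / 2" by real_asymp
  moreover have "\<forall>\<^sub>F n in sequentially. 8 / \<delta> \<le> real n" by real_asymp
  ultimately have "\<forall>\<^sub>F n in sequentially. \<forall>est. estimator n est \<longrightarrow>
       measure_pmf.expectation (estimation n \<delta> lam est) (\<lambda>(H, K). recon_error H K) \<ge> \<epsilon> / 4"
    using conc
  proof eventually_elim
    case (elim n)
    show ?case
    proof (intro allI impI)
      fix est assume est: "estimator n est"
      define M where "M = estimation n \<delta> lam est"
      define X where "X = {(H, K). recon_error H K \<ge> \<epsilon> / 2}"
      have "8 \<le> \<delta> * real n" using elim(2) assms(1) by (simp add: pos_divide_le_eq mult.commute)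
      moreover have "\<delta> * real n \<le> 1 * real n" using assms by (intro mult_right_mono) auto
      ultimately have "6 < nat \<lfloor>\<delta> * real n\<rfloor>" "nat \<lfloor>\<delta> * real n\<rfloor> \<le> n" by linarith+
      then have fin: "finite (set_pmf M)" unfolding M_def using est by (intro finite_set_estimation)
      \<comment> \<open>Markov's inequality: an error of at least \<open>\<epsilon> / 2\<close> with
        probability at least 1/2 forces the expectation up to \<open>\<epsilon> / 4\<close>.\<close>
      have "1 / 2 \<le> measure_pmf.prob M X" using elim(1,3) est unfolding M_def X_def by fastforce
      then have "\<epsilon> / 2 * (1 / 2) \<le> \<epsilon> / 2 * measure_pmf.prob M X" using pos by (intro mult_left_mono) auto
      also have "\<dots> = measure_pmf.expectation M (\<lambda>z. \<epsilon> / 2 * indicator X z)" by simp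
      also have "\<dots> \<le> measure_pmf.expectation M (\<lambda>(H, K). recon_error H K)"
      proof (intro integral_mono integrable_measure_pmf_finite fin)
        fix z :: "graph \<times> graph"
        show "\<epsilon> / 2 * indicator X z \<le> (case z of (H, K) \<Rightarrow> recon_error H K)"
          by (cases z) (auto simp: X_def indicator_def recon_error_def)
      qed
      finally show "\<epsilon> / 4 \<le> measure_pmf.expectation (estimation n \<delta> lam est) (\<lambda>(H, K). recon_error H K)"
        by (simp add: M_def)
    qed
  qed
  with conc show ?thesis using pos by (intro exI[of _ \<epsilon>] conjI exI[of _ 1]) auto
qed

end
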